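(* Let $(k,|\cdot|_k)\hookrightarrow(\ell,|\cdot|_\ell)$ be an extension of non-Archimedean fields such that one of the following holds: - $k$ is spherically complete, or - $\ell$ is of countable type over $k$, that is, $\ell$ has a dense $k$-subspace with a countable $k$-basis. Then for all integers $n>0$, the extension of Tate algebras $T_n(k)\hookrightarrow T_n(\ell)$ is Ohm-Rush trace, i.e. $T_n(\ell)$ is an Ohm-Rush trace $T_n(k)$-module. Moreover, $T_n(k)\hookrightarrow T_n(\ell)$ is a split (i.e. it admits a $T_n(k)$-linear left inverse) faithfully flat extension.
   Context: A non-Archimedean (NA) field is a field $k$ with a function $|\cdot|:k\to\mathbb{R}_{\ge 0}$ satisfying $|x|=0\iff x=0$, $|xy|=|x||y|$, $|x+y|\le\max\{|x|,|y|\}$, such that $k$ is complete for the induced metric and $|k^\times|\ne\{1\}$. An extension of NA fields is a field extension $k\hookrightarrow\ell$ with both fields NA and $|\cdot|_\ell$ extending $|\cdot|_k$. $k$ is spherically complete if every decreasing sequence $D_1\supseteq D_2\supseteq\cdots$ of non-empty closed balls (not assumed to have a common center) has non-empty intersection. $T_n(k)$ is the subring of $k\llbracket X_1,\dots,X_n\rrbracket$ of power series $\sum_{\nu\in\mathbb{Z}_{\ge0}^n}a_\nu X^\nu$ with $|a_\nu|\to0$ as $\nu_1+\dots+\nu_n\to\infty$. For an $R$-module $M$ and $x\in M$, $\operatorname{Tr}_M(x)$ is the ideal $\{f(x):f\in\operatorname{Hom}_R(M,R)\}$ of $R$; $M$ is Ohm-Rush trace (ORT) if $x\in\operatorname{Tr}_M(x)M$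 for all $x\in M$. *)

theory Defs
  imports "HOL-Analysis.Analysis" "HOL-Algebra.Algebra"
begin

section \<open>Non-Archimedean fields\<close>

text \<open>
  Base fields are types of class \<open>field\<close> carrying an explicit absolute value. Everything that cannot
  be a type (Tate algebras depend on \<open>n\<close> and on the absolute value) is a HOL-Algebra structure.
\<close>

definition na_dist :: "('k::field \<Rightarrow> real) \<Rightarrow> 'k \<Rightarrow> 'k \<Rightarrow> real"
  where "na_dist v x y = v (x - y)"

locale na_field =
  fixes v :: "'k::field \<Rightarrow> real"
  assumes nonneg: "0 \<le> v x"
    and eq_0_iff: "v x = 0 \<longleftrightarrow> x = 0"
    and mult: "v (x * y) = v x * v y"
    and ultrametric: "v (x + y) \<le> max (v x) (v y)"
    and complete: "Metric_space.mcomplete UNIV (na_dist v)"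
    and nontrivial: "v ` (UNIV - {0}) \<noteq> {1}"

locale na_field_extension = base: na_field v + ext: na_field w
  for v :: "'k::field \<Rightarrow> real" and w :: "'l::field \<Rightarrow> real" +
  fixes \<iota> :: "'k \<Rightarrow> 'l"
  assumes hom_add: "\<iota> (x + y) = \<iota> x + \<iota> y"
    and hom_mult: "\<iota> (x * y) = \<iota> x * \<iota> y"
    and hom_one: "\<iota> 1 = 1"
    and extends: "w (\<iota> x) = v x"

definition spherically_complete :: "('k::field \<Rightarrow> real) \<Rightarrow> bool"
  where "spherically_complete v \<longleftrightarrow>
    (\<forall>D :: nat \<Rightarrow> 'k set.
      (\<forall>i. D i \<noteq> {} \<and> (\<exists>x r. D i = Metric_space.mcball UNIV (na_dist v) x r)) \<and> decseq D
      \<longrightarrow> (\<Inter>i. D i) \<noteq> {})"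

text \<open>The dense subspace is the span of its countable (possibly finite) basis \<open>B\<close>.\<close>

definition countable_type :: "('l::field \<Rightarrow> real) \<Rightarrow> ('k::field \<Rightarrow> 'l) \<Rightarrow> bool"
  where "countable_type w \<iota> \<longleftrightarrow>
    (\<exists>B. countable B \<and> \<not> Modules.module.dependent (\<lambda>c x. \<iota> c * x) B \<and>
      Metric_space.mtopology UNIV (na_dist w) closure_of
        Modules.module.span (\<lambda>c x. \<iota> c * x) B = UNIV)"


section \<open>Tate algebras\<close>

definition multi_indices :: "nat \<Rightarrow> (nat \<Rightarrow> nat) set"
  where "multi_indices n = {\<nu>. \<forall>i\<ge>n. \<nu> i = 0}"

text \<open>
  \<open>k[[X\<^sub>0, \<dots>, X\<^bsub>n-1\<^esub>]]\<close>: a power series is its coefficient family, extended by \<open>0\<close> outside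
  \<open>multi_indices n\<close>. In the product, \<open>\<le>\<close> and \<open>-\<close> on multi-indices are pointwise, so
  \<open>\<mu> \<le> \<nu>\<close> ranges over the finitely many \<open>\<mu>\<close> with \<open>\<mu> + (\<nu> - \<mu>) = \<nu>\<close>. For \<open>\<nu>\<close> outside
  \<open>multi_indices n\<close> the sum vanishes, since one factor of each summand does.
\<close>

definition power_series :: "nat \<Rightarrow> ((nat \<Rightarrow> nat) \<Rightarrow> 'k::field) ring"
  where "power_series n =
    \<lparr>carrier = {a. \<forall>\<nu>. \<nu> \<notin> multi_indices n \<longrightarrow> a \<nu> = 0},
     monoid.mult = (\<lambda>a b \<nu>. \<Sum>\<mu>\<in>{..\<nu>}. a \<mu> * b (\<nu> - \<mu>)),
     one = (\<lambda>\<nu>. if \<nu> = (\<lambda>_. 0) then 1 else 0),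
     ring.zero = (\<lambda>\<nu>. 0),
     ring.add = (\<lambda>a b \<nu>. a \<nu> + b \<nu>)\<rparr>"

definition tate :: "('k::field \<Rightarrow> real) \<Rightarrow> nat \<Rightarrow> ((nat \<Rightarrow> nat) \<Rightarrow> 'k) ring"
  where "tate v n = (power_series n)
    \<lparr>carrier := {a \<in> carrier (power_series n).
      \<forall>\<epsilon>>0. \<exists>N. \<forall>\<nu>\<in>multi_indices n. (\<Sum>i<n. \<nu> i) \<ge> N \<longrightarrow> v (a \<nu>) < \<epsilon>}\<rparr>"

definition tate_map :: "('k::field \<Rightarrow> 'l::field) \<Rightarrow> ((nat \<Rightarrow> nat) \<Rightarrow> 'k) \<Rightarrow> (nat \<Rightarrow> nat) \<Rightarrow> 'l"
  where "tate_map \<iota> a = (\<lambda>\<nu>. \<iota> (a \<nu>))"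


section \<open>Ring extensions and modules\<close>

definition ring_extension ::
    "('a, 'p) ring_scheme \<Rightarrow> ('b, 'q) ring_scheme \<Rightarrow> ('a \<Rightarrow> 'b) \<Rightarrow> bool"
  where "ring_extension R S \<phi> \<longleftrightarrow>
    cring R \<and> cring S \<and> \<phi> \<in> ring_hom R S \<and> inj_on \<phi> (carrier R)"

text \<open>The ring \<open>S\<close> as an \<open>R\<close>-module via \<open>\<phi> : R \<rightarrow> S\<close>.\<close>

definition ring_as_module :: "('b, 'q) ring_scheme \<Rightarrow> ('a \<Rightarrow> 'b) \<Rightarrow> ('a, 'b) module"
  where "ring_as_module S \<phi> =
    \<lparr>carrier = carrier S, monoid.mult = monoid.mult S, one = one S, ring.zero = ring.zero S,
     ring.add = ring.add S,
     smult = (\<lambda>r s. \<phi> r \<otimes>\<^bsub>S\<^esub> s)\<rparr>"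

definition linear_maps ::
    "('a, 'p) ring_scheme \<Rightarrow> ('a, 'b, 'q) module_scheme \<Rightarrow> ('a, 'c, 'r) module_scheme
      \<Rightarrow> ('b \<Rightarrow> 'c) set"
  where "linear_maps R M N =
    {f \<in> carrier M \<rightarrow> carrier N.
      (\<forall>x\<in>carrier M. \<forall>y\<in>carrier M. f (x \<oplus>\<^bsub>M\<^esub> y) = f x \<oplus>\<^bsub>N\<^esub> f y) \<and>
      (\<forall>r\<in>carrier R. \<forall>x\<in>carrier M. f (r \<odot>\<^bsub>M\<^esub> x) = r \<odot>\<^bsub>N\<^esub> f x)}"

definition trace_ideal ::
    "('a, 'p) ring_scheme \<Rightarrow> ('a, 'b, 'q) module_scheme \<Rightarrow> 'b \<Rightarrow> 'a set"
  where "trace_ideal R M x = {f x | f. f \<in> linear_maps R M (ring_as_module R (\<lambda>r. r))}"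

text \<open>\<open>IM\<close>: finite sums of products \<open>a \<cdot> m\<close> with \<open>a \<in> I\<close>, \<open>m \<in> M\<close>.\<close>

definition ideal_smult :: "'a set \<Rightarrow> ('a, 'b, 'q) module_scheme \<Rightarrow> 'b set"
  where "ideal_smult I M = generate (add_monoid M) {a \<odot>\<^bsub>M\<^esub> m | a m. a \<in> I \<and> m \<in> carrier M}"

definition ohm_rush_trace :: "('a, 'p) ring_scheme \<Rightarrow> ('a, 'b, 'q) module_scheme \<Rightarrow> bool"
  where "ohm_rush_trace R M \<longleftrightarrow>
    Module.module R M \<and> (\<forall>x\<in>carrier M. x \<in> ideal_smult (trace_ideal R M x) M)"

definition split_extension ::
    "('a, 'p) ring_scheme \<Rightarrow> ('b, 'q) ring_scheme \<Rightarrow> ('a \<Rightarrow> 'b) \<Rightarrow> bool"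
  where "split_extension R S \<phi> \<longleftrightarrow>
    ring_extension R S \<phi> \<and>
    (\<exists>\<sigma>\<in>linear_maps R (ring_as_module S \<phi>) (ring_as_module R (\<lambda>r. r)).
      \<forall>r\<in>carrier R. \<sigma> (\<phi> r) = r)"


section \<open>Tensor products and faithful flatness\<close>

text \<open>
  The abelian group \<open>M \<otimes>\<^sub>R N\<close> is the free abelian group on \<open>M \<times> N\<close> modulo the bilinearity and balancing
  relations. Its \<open>R\<close>-module structure plays no role for exactness. As in \<open>free_Abelian_group\<close>, the
  group is written multiplicatively, with unit \<open>\<one>\<close> for the zero tensor.
\<close>

definition tensor_relations ::
    "('a, 'p) ring_scheme \<Rightarrow> ('a, 'b, 'q) module_scheme \<Rightarrow> ('a, 'c, 'r) module_scheme
      \<Rightarrow> ('b \<times> 'c \<Rightarrow>\<^sub>0 int) set"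
  where "tensor_relations R M N = generate (free_Abelian_group (carrier M \<times> carrier N))
    ({frag_of (x \<oplus>\<^bsub>M\<^esub> x', y) - frag_of (x, y) - frag_of (x', y) | x x' y.
        x \<in> carrier M \<and> x' \<in> carrier M \<and> y \<in> carrier N} \<union>
     {frag_of (x, y \<oplus>\<^bsub>N\<^esub> y') - frag_of (x, y) - frag_of (x, y') | x y y'.
        x \<in> carrier M \<and> y \<in> carrier N \<and> y' \<in> carrier N} \<union>
     {frag_of (r \<odot>\<^bsub>M\<^esub> x, y) - frag_of (x, r \<odot>\<^bsub>N\<^esub> y) | r x y.
        r \<in> carrier R \<and> x \<in> carrier M \<and> y \<in> carrier N})"

definition tensor ::
    "('a, 'p) ring_scheme \<Rightarrow> ('a, 'b, 'q) module_scheme \<Rightarrow> ('a, 'c, 'r) module_scheme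
      \<Rightarrow> ('b \<times> 'c \<Rightarrow>\<^sub>0 int) set monoid"
  where "tensor R M N =
    free_Abelian_group (carrier M \<times> carrier N) Mod tensor_relations R M N"

text \<open>
  The map \<open>M \<otimes> N \<rightarrow> M \<otimes> N'\<close> induced by a linear map \<open>f : N \<rightarrow> N'\<close>. All members \<open>c\<close> of a coset \<open>C\<close> yield
  the same coset, so the union is just that coset.
\<close>

definition tensor_map ::
    "('a, 'p) ring_scheme \<Rightarrow> ('a, 'b, 'q) module_scheme \<Rightarrow> ('a, 'd, 's) module_scheme
      \<Rightarrow> ('c \<Rightarrow> 'd) \<Rightarrow> ('b \<times> 'c \<Rightarrow>\<^sub>0 int) set \<Rightarrow> ('b \<times> 'd \<Rightarrow>\<^sub>0 int) set"
  where "tensor_map R M N' f C =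
    (\<Union>c\<in>C. tensor_relations R M N' #>\<^bsub>free_Abelian_group (carrier M \<times> carrier N')\<^esub>
      frag_extend (\<lambda>(x, y). frag_of (x, f y)) c)"

text \<open>
  \<open>M\<close> is faithfully flat if a sequence \<open>N\<^sub>1 \<rightarrow> N\<^sub>2 \<rightarrow> N\<^sub>3\<close> is exact iff \<open>M \<otimes> N\<^sub>1 \<rightarrow> M \<otimes> N\<^sub>2 \<rightarrow> M \<otimes> N\<^sub>3\<close> is. HOL
  cannot quantify over types inside a formula: the carrier types of the \<open>N\<^sub>i\<close> are parameters, and
  a theorem that leaves them as type variables covers all modules.
\<close>

definition faithfully_flat ::
    "'c itself \<Rightarrow> 'd itself \<Rightarrow> 'e itself
      \<Rightarrow> ('a, 'p) ring_scheme \<Rightarrow> ('a, 'b, 'q) module_scheme \<Rightarrow> bool"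
  where "faithfully_flat TC TD TE R M \<longleftrightarrow>
    Module.module R M \<and>
    (\<forall>(N1 :: ('a, 'c) module) (N2 :: ('a, 'd) module) (N3 :: ('a, 'e) module) f g.
      Module.module R N1 \<and> Module.module R N2 \<and> Module.module R N3 \<and>
      f \<in> linear_maps R N1 N2 \<and> g \<in> linear_maps R N2 N3 \<longrightarrow>
      (f ` carrier N1 = a_kernel N2 N3 g \<longleftrightarrow>
       tensor_map R M N2 f ` carrier (tensor R M N1) =
         kernel (tensor R M N2) (tensor R M N3) (tensor_map R M N3 g)))"

definition faithfully_flat_extension ::
    "'c itself \<Rightarrow> 'd itself \<Rightarrow> 'e itself
      \<Rightarrow> ('a, 'p) ring_scheme \<Rightarrow> ('b, 'q) ring_scheme \<Rightarrow> ('a \<Rightarrow> 'b) \<Rightarrow> bool"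
  where "faithfully_flat_extension TC TD TE R S \<phi> \<longleftrightarrow>
    ring_extension R S \<phi> \<and> faithfully_flat TC TD TE R (ring_as_module S \<phi>)"

end

(*
  Coefficientwise application of a bounded k-linear functional l -> k is a T_n(k)-linear form on
  T_n(l). Such functionals separate the points of l: they are built by extending partial functionals
  one vector at a time, without loss of norm if k is spherically complete, and with an arbitrarily
  small loss along a countable spanning set otherwise.

  Let I be the trace ideal of x in T_n(l). By Dickson's lemma, finitely many g in I have leading
  exponents that generate all leading exponents of I. Division of x by these g (over l) leaves a
  remainder h whose exponents avoid those of I. A coefficientwise functional maps h into I, hence
  to 0; so h = 0 and x lies in I T_n(l).

  A trace module has, for any finitely many elements, an endomorphism of finite rank fixing them.
  This reduces exactness of the tensored sequence to contractions with linear forms, which gives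
  flatness; a linear form with value 1 gives faithfulness and the splitting.
*)

theory Submission
  imports Defs "HOL-Library.Function_Algebras"
begin

section \<open>Non-Archimedean absolute values\<close>

text \<open>Where \<open>k\<close> is not spherically complete, a functional need not extend with
  the same norm. Only boundedness matters for the coefficientwise maps, since it keeps coefficients
  tending to 0; a countable sequence of losses with bounded product is therefore affordable, and a
  dense domain then extends by limits.

  The leading exponent of a nonzero series is the heaviest among the finitely many exponents whose
  coefficient has maximal absolute value. It does not change from \<open>k\<close> to
  \<open>l\<close>, so divisors found over \<open>k\<close> serve over \<open>l\<close>. The
  quotients live over \<open>l\<close>, but a functional turns the division identity into one over
  \<open>k\<close>, because the divisors have coefficients in \<open>k\<close>; this links the
  remainder to \<open>I\<close>.

  For power series a monomial order alone gives no terminating division, as there may be no heaviest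
  exponent. The remedy is to work up to an error smaller by a factor \<rho> < 1: then only finitely
  many coefficients count, an order of type omega permits plain induction on the weight, and
  completeness sums the corrections. The result is an exact finite combination, so \<open>x\<close>
  lies in \<open>I T_n(l)\<close> itself and not only in its closure.\<close>

context na_field
begin

lemma v_zero [simp]: "v 0 = 0"
  by (simp add: eq_0_iff)

lemma v_pos_iff [simp]: "0 < v x \<longleftrightarrow> x \<noteq> 0"
  using nonneg[of x] eq_0_iff[of x] by linarith

lemma v_one [simp]: "v 1 = 1"
proof -
  have "v 1 * v 1 = v 1" "v 1 \<noteq> 0"
    using mult[of 1 1] eq_0_iff[of 1] by simp_all
  then show ?thesis
    by simp
qed

lemma v_minus [simp]: "v (- x) = v x"
proof -
  have "v (-1) * v (-1) = 1"
    using mult[of "-1" "-1"] by simp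
  then have "v (-1) = 1"
    using nonneg[of "-1"] by (metis abs_of_nonneg abs_one power2_eq_1_iff power2_eq_square abs_minus_cancel)
  then show ?thesis
    using mult[of "-1" x] by simp
qed

lemma v_minus_commute: "v (x - y) = v (y - x)"
  using v_minus[of "x - y"] by simp

lemma v_diff: "v (x - y) \<le> max (v x) (v y)"
  using ultrametric[of x "-y"] by simp

lemma v_inverse: "v (inverse x) = inverse (v x)"
proof (cases "x = 0")
  case False
  then have "v x * v (inverse x) = 1"
    using mult[of x "inverse x"] by simp
  then show ?thesis
    using inverse_unique by metis
qed simp

lemma v_add_le: "v x \<le> r \<Longrightarrow> v y \<le> r \<Longrightarrow> v (x + y) \<le> r"
  using ultrametric[of x y] by linarith

lemma v_diff_le: "v x \<le> r \<Longrightarrow> v y \<le> r \<Longrightarrow> v (x - y) \<le> r"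
  using v_diff[of x y] by linarith

lemma v_sum_le:
  assumes "0 \<le> r" "\<And>i. i \<in> A \<Longrightarrow> v (f i) \<le> r"
  shows "v (sum f A) \<le> r"
  using assms by (induction A rule: infinite_finite_induct) (auto intro: v_add_le)

sublocale metric: Metric_space UNIV "na_dist v"
proof
  show "0 \<le> na_dist v x y" "na_dist v x y = na_dist v y x" for x y
    by (simp_all add: na_dist_def nonneg v_minus_commute)
  show "na_dist v x y = 0 \<longleftrightarrow> x = y" for x y
    by (simp add: na_dist_def eq_0_iff)
  show "na_dist v x z \<le> na_dist v x y + na_dist v y z" for x y z
    using ultrametric[of "x - y" "y - z"] nonneg[of "x - y"] nonneg[of "y - z"]
    by (simp add: na_dist_def)
qed

lemma Cauchy_limit:
  fixes s :: "nat \<Rightarrow> 'k"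
  assumes "\<And>\<epsilon>. \<epsilon> > 0 \<Longrightarrow> \<exists>N. \<forall>m\<ge>N. \<forall>n\<ge>N. v (s m - s n) < \<epsilon>"
  obtains l where "\<And>\<epsilon>. \<epsilon> > 0 \<Longrightarrow> \<exists>N. \<forall>n\<ge>N. v (s n - l) < \<epsilon>"
proof -
  have "metric.MCauchy s"
    unfolding metric.MCauchy_def na_dist_def using assms by blast
  then obtain l where "limitin metric.mtopology s l sequentially"
    using complete unfolding metric.mcomplete_def by blast
  then have "\<exists>N. \<forall>n\<ge>N. v (s n - l) < \<epsilon>" if "\<epsilon> > 0" for \<epsilon>
    using that unfolding metric.limitin_metric na_dist_def
    by (auto simp: eventually_sequentially)
  then show thesis
    using that by blast
qed

end

section \<open>Bounded functionals\<close>

context na_field_extension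
begin

lemma hom_zero [simp]: "\<iota> 0 = 0"
  using hom_add[of 0 0] by (metis add.right_neutral add_left_cancel)

lemma hom_uminus: "\<iota> (- x) = - \<iota> x"
  using hom_add[of x "- x"] by (simp add: eq_neg_iff_add_eq_0 add.commute)

lemma hom_diff: "\<iota> (x - y) = \<iota> x - \<iota> y"
  using hom_add[of x "- y"] by (simp add: hom_uminus)

lemma hom_eq_0_iff [simp]: "\<iota> x = 0 \<longleftrightarrow> x = 0"
  using extends[of x] base.eq_0_iff ext.eq_0_iff by metis

lemma hom_inverse: "\<iota> (inverse x) = inverse (\<iota> x)"
proof (cases "x = 0")
  case False
  then have "\<iota> x * \<iota> (inverse x) = 1"
    using hom_mult[of x "inverse x"] hom_one by simp
  then show ?thesis
    using inverse_unique by metis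
qed simp

lemma hom_sum: "\<iota> (sum f A) = (\<Sum>i\<in>A. \<iota> (f i))"
  by (induction A rule: infinite_finite_induct) (simp_all add: hom_add)

text \<open>
  The graph of a linear functional of norm at most \<open>C\<close> on a \<open>k\<close>-subspace of \<open>\<ell>\<close>; the bound makes
  it single-valued.
\<close>

definition functional_graph :: "real \<Rightarrow> ('l \<times> 'k) set \<Rightarrow> bool"
  where "functional_graph C G \<longleftrightarrow> (0, 0) \<in> G \<and>
    (\<forall>a b a' b'. (a, b) \<in> G \<longrightarrow> (a', b') \<in> G \<longrightarrow> (a + a', b + b') \<in> G) \<and>
    (\<forall>c a b. (a, b) \<in> G \<longrightarrow> (\<iota> c * a, c * b) \<in> G) \<and>
    (\<forall>a b. (a, b) \<in> G \<longrightarrow> v b \<le> C * w a)"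

lemma functional_graph_diff:
  assumes "functional_graph C G" "(a, b) \<in> G" "(a', b') \<in> G"
  shows "(a - a', b - b') \<in> G"
proof -
  have "(\<iota> (-1) * a', (-1) * b') \<in> G"
    using assms unfolding functional_graph_def by blast
  then have "(- a', - b') \<in> G"
    by (simp add: hom_uminus hom_one)
  then have "(a + (- a'), b + (- b')) \<in> G"
    using assms(1,2) unfolding functional_graph_def by blast
  then show ?thesis
    by simp
qed

lemma functional_graph_diff_le:
  assumes "functional_graph C G" "(a, b) \<in> G" "(a', b') \<in> G"
  shows "v (b - b') \<le> C * w (a - a')"
  using functional_graph_diff[OF assms] assms(1) unfolding functional_graph_def by blast

lemma functional_graph_mono:
  assumes "functional_graph C G" "C \<le> C'"
  shows "functional_graph C' G"
proof -
  have "v b \<le> C' * w a" if "(a, b) \<in> G" for a b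
    using assms that mult_right_mono[OF assms(2) ext.nonneg[of a]]
    unfolding functional_graph_def by fastforce
  then show ?thesis
    using assms(1) unfolding functional_graph_def by blast
qed

lemma functional_graph_Union:
  assumes "\<C> \<noteq> {}" and fg: "\<And>G. G \<in> \<C> \<Longrightarrow> functional_graph C G"
    and chain: "\<And>G G'. G \<in> \<C> \<Longrightarrow> G' \<in> \<C> \<Longrightarrow> G \<subseteq> G' \<or> G' \<subseteq> G"
  shows "functional_graph C (\<Union>\<C>)"
  unfolding functional_graph_def
proof (intro conjI allI impI)
  show "(0, 0) \<in> \<Union>\<C>"
    using assms(1) fg unfolding functional_graph_def by blast
next
  fix a b a' b' assume "(a, b) \<in> \<Union>\<C>" "(a', b') \<in> \<Union>\<C>"
  then obtain G G' where G: "G \<in> \<C>" "G' \<in> \<C>" "(a, b) \<in> G" "(a', b') \<in> G'"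
    by blast
  then obtain H where "H \<in> \<C>" "(a, b) \<in> H" "(a', b') \<in> H"
    using chain[OF G(1,2)] by blast
  then show "(a + a', b + b') \<in> \<Union>\<C>"
    using fg[of H] unfolding functional_graph_def by blast
next
  fix c a b assume "(a, b) \<in> \<Union>\<C>"
  then obtain G where "G \<in> \<C>" "(a, b) \<in> G"
    by blast
  then show "(\<iota> c * a, c * b) \<in> \<Union>\<C>"
    using fg[of G] unfolding functional_graph_def by blast
next
  fix a b assume "(a, b) \<in> \<Union>\<C>"
  then obtain G where "G \<in> \<C>" "(a, b) \<in> G"
    by blast
  then show "v b \<le> C * w a"
    using fg[of G] unfolding functional_graph_def by blast
qed

text \<open>The admissible values are the points common to the balls around \<open>b\<close> of
  radius \<open>C * w (z - a)\<close>. Such a point also bounds the functional at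
  \<open>a + \<iota> t * z\<close>: factoring out \<open>t \<noteq> 0\<close> replaces the graph
  point \<open>(a, b)\<close> by its multiple with \<open>- inverse t\<close>. If \<open>z\<close>
  is already in the domain, the ball for \<open>a = z\<close> has radius 0 and forces the old
  value.\<close>

lemma functional_graph_insert:
  assumes G: "functional_graph C G" and "0 \<le> C"
    and c: "\<And>a b. (a, b) \<in> G \<Longrightarrow> v (c - b) \<le> C * w (z - a)"
  obtains G' where "functional_graph C G'" "G \<subseteq> G'" "(z, c) \<in> G'"
proof
  let ?G = "{(a + \<iota> t * z, b + t * c) | a b t. (a, b) \<in> G}"
  have bound: "v (b + t * c) \<le> C * w (a + \<iota> t * z)" if "(a, b) \<in> G" for a b t
  proof (cases "t = 0")
    case True
    then show ?thesis
      using G that unfolding functional_graph_def by simp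
  next
    case False
    have "(\<iota> (- inverse t) * a, (- inverse t) * b) \<in> G"
      using G that unfolding functional_graph_def by blast
    then have *: "v (c - (- inverse t) * b) \<le> C * w (z - \<iota> (- inverse t) * a)"
      by (rule c)
    have "b + t * c = t * (c - (- inverse t) * b)"
      using False by (simp add: field_simps)
    moreover have "a + \<iota> t * z = \<iota> t * (z - \<iota> (- inverse t) * a)"
      using False by (simp add: algebra_simps hom_uminus hom_inverse)
    ultimately have "v (b + t * c) = v t * v (c - (- inverse t) * b)"
      "w (a + \<iota> t * z) = v t * w (z - \<iota> (- inverse t) * a)"
      by (simp_all only: base.mult ext.mult extends)
    then show ?thesis
      using mult_left_mono[OF * base.nonneg[of t]] by (simp add: mult_ac)
  qed
  have zero: "(0, 0) \<in> G" and
    add: "\<And>a b a' b'. (a, b) \<in> G \<Longrightarrow> (a', b') \<in> G \<Longrightarrow> (a + a', b + b') \<in> G" and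
    scale: "\<And>s a b. (a, b) \<in> G \<Longrightarrow> (\<iota> s * a, s * b) \<in> G"
    using G unfolding functional_graph_def by blast+
  show "functional_graph C ?G"
    unfolding functional_graph_def
  proof (intro conjI allI impI)
    show "(0, 0) \<in> ?G"
      using zero by (intro CollectI exI[of _ 0]) auto
  next
    fix a b a' b' assume "(a, b) \<in> ?G" "(a', b') \<in> ?G"
    then obtain x y t x' y' t' where "(x, y) \<in> G" "(x', y') \<in> G"
      "a = x + \<iota> t * z" "b = y + t * c" "a' = x' + \<iota> t' * z" "b' = y' + t' * c"
      by blast
    then show "(a + a', b + b') \<in> ?G"
      using add[of x y x' y']
      by (intro CollectI exI[of _ "x + x'"] exI[of _ "y + y'"] exI[of _ "t + t'"])
        (auto simp: hom_add algebra_simps)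
  next
    fix s a b assume "(a, b) \<in> ?G"
    then obtain x y t where "(x, y) \<in> G" "a = x + \<iota> t * z" "b = y + t * c"
      by auto
    then show "(\<iota> s * a, s * b) \<in> ?G"
      using scale[of x y s]
      by (intro CollectI exI[of _ "\<iota> s * x"] exI[of _ "s * y"] exI[of _ "s * t"])
        (auto simp: hom_mult algebra_simps)
  next
    fix a b assume "(a, b) \<in> ?G"
    then show "v b \<le> C * w a"
      using bound by auto
  qed
  show "G \<subseteq> ?G"
  proof
    fix p assume "p \<in> G"
    then show "p \<in> ?G"
      by (intro CollectI exI[of _ "fst p"] exI[of _ "snd p"] exI[of _ 0]) auto
  qed
  show "(z, c) \<in> ?G"
    using zero by (intro CollectI exI[of _ 0] exI[of _ 1]) (auto simp: hom_one)
qed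

text \<open>When \<open>z\<close> is a limit of domain vectors, their values form a Cauchy sequence
  and completeness of \<open>k\<close> supplies \<open>c\<close>. The bound passes to the limit with
  the same \<open>C\<close>, so extension from a dense domain is free of loss.\<close>

lemma extension_value_limit:
  assumes G: "functional_graph C G" and "0 \<le> C"
    and dense: "\<And>\<epsilon>. \<epsilon> > 0 \<Longrightarrow> \<exists>(a, b)\<in>G. w (z - a) < \<epsilon>"
  obtains c where "\<And>a b. (a, b) \<in> G \<Longrightarrow> v (c - b) \<le> C * w (z - a)"
proof -
  have "\<forall>m. \<exists>p\<in>G. w (z - fst p) < inverse (real (Suc m))"
    using dense by (fastforce simp: case_prod_unfold)
  then obtain p where p: "\<And>m. p m \<in> G" "\<And>m. w (z - fst (p m)) < inverse (real (Suc m))"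
    by metis
  have diff: "v (snd (p m) - b) \<le> C * max (w (z - fst (p m))) (w (z - a))"
    if "(a, b) \<in> G" for m a b
  proof -
    have "v (snd (p m) - b) \<le> C * w (fst (p m) - a)"
      using functional_graph_diff_le[OF G _ that] p(1)[of m] by (metis prod.collapse)
    moreover have "w (fst (p m) - a) \<le> max (w (z - fst (p m))) (w (z - a))"
      using ext.v_diff[of "z - a" "z - fst (p m)"] by (simp add: max.commute)
    ultimately show ?thesis
      using mult_left_mono[OF _ \<open>0 \<le> C\<close>] order_trans by blast
  qed
  have small: "\<exists>N. \<forall>m\<ge>N. C * inverse (real (Suc m)) < \<epsilon>" if "\<epsilon> > 0" for \<epsilon>
  proof -
    have "(\<lambda>m. C * inverse (real (Suc m))) \<longlonglongrightarrow> C * 0"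
      by (intro tendsto_mult tendsto_const LIMSEQ_inverse_real_of_nat)
    then have "\<forall>\<^sub>F m in sequentially. C * inverse (real (Suc m)) < \<epsilon>"
      using that by (intro order_tendstoD(2)) auto
    then show ?thesis
      by (simp add: eventually_sequentially)
  qed
  have "\<exists>N. \<forall>m\<ge>N. \<forall>n\<ge>N. v (snd (p m) - snd (p n)) < \<epsilon>" if "\<epsilon> > 0" for \<epsilon>
  proof -
    obtain N where N: "\<And>m. m \<ge> N \<Longrightarrow> C * inverse (real (Suc m)) < \<epsilon>"
      using small[OF \<open>\<epsilon> > 0\<close>] by blast
    have "v (snd (p m) - snd (p n)) < \<epsilon>" if "m \<ge> N" "n \<ge> N" for m n
    proof -
      have "v (snd (p m) - snd (p n)) \<le> C * max (w (z - fst (p m))) (w (z - fst (p n)))"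
        using diff[of "fst (p n)" "snd (p n)" m] p(1)[of n] by simp
      also have "\<dots> \<le> C * max (inverse (real (Suc m))) (inverse (real (Suc n)))"
        using p(2)[of m] p(2)[of n] by (intro mult_left_mono \<open>0 \<le> C\<close>) linarith
      also have "\<dots> < \<epsilon>"
        using N[OF that(1)] N[OF that(2)] by (simp add: max_def)
      finally show ?thesis .
    qed
    then show ?thesis
      by blast
  qed
  then obtain c where c: "\<And>\<epsilon>. \<epsilon> > 0 \<Longrightarrow> \<exists>N. \<forall>m\<ge>N. v (snd (p m) - c) < \<epsilon>"
    using base.Cauchy_limit[of "\<lambda>m. snd (p m)"] by blast
  show thesis
  proof
    fix a b assume "(a, b) \<in> G"
    show "v (c - b) \<le> C * w (z - a)"
    proof (rule field_le_epsilon)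
      fix \<epsilon> :: real assume "\<epsilon> > 0"
      obtain N where N: "\<And>m. m \<ge> N \<Longrightarrow> C * inverse (real (Suc m)) < \<epsilon>"
        using small[OF \<open>\<epsilon> > 0\<close>] by blast
      obtain N' where N': "\<And>m. m \<ge> N' \<Longrightarrow> v (snd (p m) - c) < \<epsilon>"
        using c[OF \<open>\<epsilon> > 0\<close>] by blast
      let ?m = "max N N'"
      have "C * w (z - fst (p ?m)) < \<epsilon>"
        using N[of ?m] mult_left_mono[OF less_imp_le[OF p(2)[of ?m]] \<open>0 \<le> C\<close>] by simp
      then have "v (snd (p ?m) - b) \<le> max \<epsilon> (C * w (z - a))"
        using diff[OF \<open>(a, b) \<in> G\<close>, of ?m] by (auto simp: max_def split: if_splits)
      moreover have "v (c - b) \<le> max (v (snd (p ?m) - b)) (v (snd (p ?m) - c))"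
        using base.v_diff[of "snd (p ?m) - b" "snd (p ?m) - c"] by simp
      moreover have "v (snd (p ?m) - c) < \<epsilon>"
        using N' by simp
      moreover have "0 \<le> C * w (z - a)"
        using \<open>0 \<le> C\<close> ext.nonneg by simp
      ultimately show "v (c - b) \<le> C * w (z - a) + \<epsilon>"
        using \<open>\<epsilon> > 0\<close> by linarith
    qed
  qed
qed

text \<open>Let \<open>d\<close> be the distance from \<open>z\<close> to the domain. For
  \<open>d = 0\<close> the limit argument applies. Otherwise the slack \<open>C' / C > 1\<close>
  allows an almost nearest vector \<open>a0\<close>, whose own value works: replacing
  \<open>z\<close> by \<open>a0\<close> increases the distance to any \<open>a\<close> by at most
  the factor \<open>C' / C\<close>.\<close>

lemma extension_value_lossy:
  assumes G: "functional_graph C G" and "0 < C" "C < C'"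
  obtains c where "\<And>a b. (a, b) \<in> G \<Longrightarrow> v (c - b) \<le> C' * w (z - a)"
proof -
  define d where "d = (INF p\<in>G. w (z - fst p))"
  have bdd: "bdd_below ((\<lambda>p. w (z - fst p)) ` G)"
    using ext.nonneg by (intro bdd_belowI[of _ 0]) auto
  have "G \<noteq> {}"
    using G unfolding functional_graph_def by auto
  then have "0 \<le> d"
    unfolding d_def using ext.nonneg by (intro cINF_greatest) auto
  have d_le: "d \<le> w (z - a)" if "(a, b) \<in> G" for a b
    unfolding d_def using cINF_lower[OF bdd that] by simp
  have near: "\<exists>(a, b)\<in>G. w (z - a) < r" if "r > d" for r
    using that cINF_less_iff[OF \<open>G \<noteq> {}\<close> bdd, of r] unfolding d_def
    by (auto simp: case_prod_unfold)
  show thesis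
  proof (cases "d = 0")
    case True
    have "functional_graph C' G" "0 \<le> C'"
      using functional_graph_mono[OF G] assms by simp_all
    then show thesis
      using extension_value_limit[of C' G z] near that unfolding True by blast
  next
    case False
    then have "d < C' / C * d"
      using \<open>0 \<le> d\<close> assms by (simp add: field_simps)
    then obtain a0 b0 where *: "(a0, b0) \<in> G" "w (z - a0) < C' / C * d"
      using near by fast
    show thesis
    proof
      fix a b assume ab: "(a, b) \<in> G"
      have "w (a0 - a) \<le> max (w (z - a)) (w (z - a0))"
        using ext.v_diff[of "z - a" "z - a0"] by simp
      also have "\<dots> \<le> C' / C * w (z - a)"
      proof -
        have "1 * w (z - a) \<le> C' / C * w (z - a)"
          using assms ext.nonneg by (intro mult_right_mono) auto
        moreover have "C' / C * d \<le> C' / C * w (z - a)"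
          using assms d_le[OF ab] by (intro mult_left_mono) auto
        ultimately show ?thesis
          using *(2) by simp
      qed
      finally have "C * w (a0 - a) \<le> C' * w (z - a)"
        using assms by (simp add: field_simps)
      then show "v (b0 - b) \<le> C' * w (z - a)"
        using functional_graph_diff_le[OF G *(1) ab] by simp
    qed
  qed
qed

text \<open>Of any two balls that must contain \<open>c\<close>, the larger contains the center of
  the smaller, by the ultrametric inequality. If the distance \<open>d\<close> is attained, the
  value at a nearest vector lies in all of them; otherwise vectors whose distances approach
  \<open>d\<close> give a decreasing sequence of balls.\<close>

lemma extension_value_spherical:
  assumes G: "functional_graph C G" and "0 < C" and sph: "spherically_complete v"
  obtains c where "\<And>a b. (a, b) \<in> G \<Longrightarrow> v (c - b) \<le> C * w (z - a)"
proof -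
  define d where "d = (INF p\<in>G. w (z - fst p))"
  have bdd: "bdd_below ((\<lambda>p. w (z - fst p)) ` G)"
    using ext.nonneg by (intro bdd_belowI[of _ 0]) auto
  have "G \<noteq> {}"
    using G unfolding functional_graph_def by auto
  have d_le: "d \<le> w (z - a)" if "(a, b) \<in> G" for a b
    unfolding d_def using cINF_lower[OF bdd that] by simp
  have near: "\<exists>(a, b)\<in>G. w (z - a) < r" if "r > d" for r
    using that cINF_less_iff[OF \<open>G \<noteq> {}\<close> bdd, of r] unfolding d_def
    by (auto simp: case_prod_unfold)
  have bound: "v (b - b') \<le> C * max (w (z - a)) (w (z - a'))"
    if "(a, b) \<in> G" "(a', b') \<in> G" for a b a' b'
  proof -
    have "w (a - a') \<le> max (w (z - a)) (w (z - a'))"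
      using ext.v_diff[of "z - a'" "z - a"] by (simp add: max.commute)
    then show ?thesis
      using functional_graph_diff_le[OF G that] \<open>0 < C\<close>
      by (meson mult_left_mono less_imp_le order_trans)
  qed
  show thesis
  proof (cases "\<exists>(a, b)\<in>G. w (z - a) = d")
    case True
    then obtain a0 b0 where *: "(a0, b0) \<in> G" "w (z - a0) = d"
      by blast
    have "v (b0 - b) \<le> C * w (z - a)" if "(a, b) \<in> G" for a b
      using bound[OF *(1) that] *(2) d_le[OF that] by (simp add: max_def split: if_splits)
    then show thesis
      using that by blast
  next
    case False
    have "\<exists>q\<in>G. w (z - fst q) < d + inverse (real (Suc m)) \<and> w (z - fst q) \<le> w (z - fst p)"
      if "p \<in> G" for p m
    proof -
      have "d < min (d + inverse (real (Suc m))) (w (z - fst p))"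
        using False d_le[of "fst p" "snd p"] that by (force simp: case_prod_unfold)
      then show ?thesis
        using near[of "min (d + inverse (real (Suc m))) (w (z - fst p))"]
        by (force simp: case_prod_unfold)
    qed
    \<comment> \<open>For \<open>m = 0\<close> the bound is suspended, since
      \<open>inverse 0 = 0\<close> would demand a distance below \<open>d\<close>. The distances are
      made to decrease so that the balls \<open>D m\<close> are nested.\<close>
    then have "\<exists>f. \<forall>m. (f m \<in> G \<and> (m > 0 \<longrightarrow> w (z - fst (f m)) < d + inverse (real m))) \<and>
        w (z - fst (f (Suc m))) \<le> w (z - fst (f m))"
      using \<open>G \<noteq> {}\<close>
      by (intro dependent_nat_choice[where P = "\<lambda>m p. p \<in> G \<and> (m > 0 \<longrightarrow> w (z - fst p) < d + inverse (real m))"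
            and Q = "\<lambda>_ p q. w (z - fst q) \<le> w (z - fst p)"]) blast+
    then obtain f where f: "\<And>m. f m \<in> G"
      "\<And>m. m > 0 \<Longrightarrow> w (z - fst (f m)) < d + inverse (real m)"
      "\<And>m. w (z - fst (f (Suc m))) \<le> w (z - fst (f m))"
      by blast
    define D where "D = (\<lambda>m. base.metric.mcball (snd (f m)) (C * w (z - fst (f m))))"
    have "decseq D"
    proof (rule decseq_SucI, rule subsetI)
      fix m x assume "x \<in> D (Suc m)"
      then have "v (snd (f (Suc m)) - x) \<le> C * w (z - fst (f (Suc m)))"
        by (simp add: D_def na_dist_def)
      also have "\<dots> \<le> C * w (z - fst (f m))"
        using f(3) \<open>0 < C\<close> by simp
      finally have "v (snd (f (Suc m)) - x) \<le> C * w (z - fst (f m))" .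
      moreover have "v (snd (f m) - snd (f (Suc m))) \<le> C * w (z - fst (f m))"
        using bound[of "fst (f m)" "snd (f m)" "fst (f (Suc m))" "snd (f (Suc m))"] f(1) f(3)[of m]
        by (simp add: max_absorb1)
      ultimately show "x \<in> D m"
        using base.v_add_le[of "snd (f m) - snd (f (Suc m))" _ "snd (f (Suc m)) - x"]
        by (simp add: D_def na_dist_def)
    qed
    moreover have "D m \<noteq> {}" for m
      using \<open>0 < C\<close> ext.nonneg unfolding D_def base.metric.mcball_eq_empty by (simp add: not_less)
    moreover have "\<exists>x r. D m = base.metric.mcball x r" for m
      unfolding D_def by blast
    ultimately have "(\<Inter>m. D m) \<noteq> {}"
      using sph[unfolded spherically_complete_def, rule_format, of D] by simp
    then obtain c where c: "\<And>m. c \<in> D m"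
      by blast
    have "v (c - b) \<le> C * w (z - a)" if "(a, b) \<in> G" for a b
    proof -
      \<comment> \<open>As \<open>d\<close> is not attained, every \<open>a\<close> is strictly
        farther from \<open>z\<close> than \<open>d\<close>, hence farther than some
        \<open>f m\<close>, whose ball then lies in the ball of \<open>a\<close>.\<close>
      have "d < w (z - a)"
        using False d_le[OF that] that by force
      then obtain m where m: "m > 0" "inverse (real m) < w (z - a) - d"
        using ex_inverse_of_nat_less[of "w (z - a) - d"] by auto
      then have le: "w (z - fst (f m)) \<le> w (z - a)"
        using f(2)[of m] by linarith
      then have "v (snd (f m) - b) \<le> C * w (z - a)"
        using bound[of "fst (f m)" "snd (f m)" a b] f(1)[of m] that by (simp add: max_absorb2)
      moreover have "v (snd (f m) - c) \<le> C * w (z - a)"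
      proof -
        have "v (snd (f m) - c) \<le> C * w (z - fst (f m))"
          using c[of m] by (simp add: D_def na_dist_def)
        then show ?thesis
          using mult_left_mono[OF le, of C] \<open>0 < C\<close> by linarith
      qed
      ultimately show ?thesis
        using base.v_diff_le[of "snd (f m) - b" _ "snd (f m) - c"] by simp
    qed
    then show thesis
      using that by blast
  qed
qed

section \<open>Everywhere defined bounded functionals\<close>

definition bounded_functional :: "('l \<Rightarrow> 'k) \<Rightarrow> bool"
  where "bounded_functional \<phi> \<longleftrightarrow> (\<forall>x y. \<phi> (x + y) = \<phi> x + \<phi> y) \<and>
    (\<forall>c x. \<phi> (\<iota> c * x) = c * \<phi> x) \<and> (\<exists>C. \<forall>x. v (\<phi> x) \<le> C * w x)"

text \<open>Zorn's lemma on the graphs above \<open>G0\<close>: a maximal one has a value at every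
  vector, since a value from \<open>step\<close> would otherwise enlarge it. \<open>step\<close> is
  asked only of graphs containing \<open>G0\<close>, so that density of the domain of
  \<open>G0\<close> can be used to produce values.\<close>

lemma functional_graph_total:
  assumes G0: "functional_graph C G0" and "0 \<le> C"
    and step: "\<And>G z. functional_graph C G \<Longrightarrow> G0 \<subseteq> G \<Longrightarrow>
      \<exists>c. \<forall>a b. (a, b) \<in> G \<longrightarrow> v (c - b) \<le> C * w (z - a)"
  shows "\<exists>\<phi>. bounded_functional \<phi> \<and> (\<forall>a b. (a, b) \<in> G0 \<longrightarrow> \<phi> a = b)"
proof -
  define A where "A = {G. functional_graph C G \<and> G0 \<subseteq> G}"
  have "\<exists>M\<in>A. \<forall>H\<in>A. M \<subseteq> H \<longrightarrow> H = M"
  proof (rule subset_Zorn_nonempty)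
    show "A \<noteq> {}"
      using G0 unfolding A_def by blast
    fix \<C> assume ne: "\<C> \<noteq> {}" and chain: "pred_on.chain A (\<subset>) \<C>"
    then have all: "\<And>G. G \<in> \<C> \<Longrightarrow> functional_graph C G" "\<And>G. G \<in> \<C> \<Longrightarrow> G0 \<subseteq> G"
      unfolding subset.chain_def A_def by auto
    have "functional_graph C (\<Union>\<C>)"
      using functional_graph_Union[OF ne all(1)] chain unfolding subset.chain_def by blast
    then show "\<Union>\<C> \<in> A"
      using ne all(2) unfolding A_def by blast
  qed
  then obtain M where "M \<in> A" and max: "\<And>H. H \<in> A \<Longrightarrow> M \<subseteq> H \<Longrightarrow> H = M"
    by metis
  then have M: "functional_graph C M" "G0 \<subseteq> M"
    by (simp_all add: A_def)
  have "\<exists>c. (z, c) \<in> M" for z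
  proof -
    obtain c where c: "\<And>a b. (a, b) \<in> M \<Longrightarrow> v (c - b) \<le> C * w (z - a)"
      using step[OF M, of z] by auto
    obtain H where "functional_graph C H" "M \<subseteq> H" "(z, c) \<in> H"
      by (rule functional_graph_insert[OF M(1) \<open>0 \<le> C\<close> c])
    moreover from this have "H = M"
      using M(2) by (intro max) (auto simp: A_def)
    ultimately show ?thesis
      by blast
  qed
  then obtain \<phi> where \<phi>: "\<And>z. (z, \<phi> z) \<in> M"
    by metis
  have unique: "b = \<phi> a" if "(a, b) \<in> M" for a b
    using functional_graph_diff_le[OF M(1) that \<phi>[of a]] base.eq_0_iff[of "b - \<phi> a"]
      base.nonneg[of "b - \<phi> a"] by simp
  have "bounded_functional \<phi>"
    unfolding bounded_functional_def
  proof (intro conjI allI exI)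
    show "\<phi> (x + y) = \<phi> x + \<phi> y" for x y
      using M(1) \<phi>[of x] \<phi>[of y] unique[symmetric] unfolding functional_graph_def by blast
    show "\<phi> (\<iota> c * x) = c * \<phi> x" for c x
      using M(1) \<phi>[of x] unique[symmetric] unfolding functional_graph_def by blast
    show "v (\<phi> x) \<le> C * w x" for x
      using M(1) \<phi>[of x] unfolding functional_graph_def by blast
  qed
  moreover have "\<phi> a = b" if "(a, b) \<in> G0" for a b
    using unique[of a b] M(2) that by auto
  ultimately show ?thesis
    by blast
qed

lemma functional_graph_line:
  assumes "y \<noteq> 0"
  shows "functional_graph (inverse (w y)) {(\<iota> t * y, t) | t. True}"
  unfolding functional_graph_def
proof (intro conjI allI impI)
  show "(0, 0) \<in> {(\<iota> t * y, t) | t. True}"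
    by (auto intro!: exI[of _ 0])
qed (use assms in \<open>auto simp: hom_add hom_mult algebra_simps ext.mult extends ext.eq_0_iff\<close>)

text \<open>The basis vectors are adjoined one at a time by the lossy extension. The domain of the
  union contains their span and is dense, though it need not be all of \<open>l\<close>.\<close>

lemma countable_type_dense_graph:
  assumes "countable_type w \<iota>" "functional_graph C0 G0" "0 < C0"
  obtains G where "functional_graph (2 * C0) G" "G0 \<subseteq> G"
    "\<And>z \<epsilon>. \<epsilon> > 0 \<Longrightarrow> \<exists>(a, b)\<in>G. w (z - a) < \<epsilon>"
proof -
  interpret L: Modules.module "\<lambda>c x. \<iota> c * x"
    by standard (simp_all add: algebra_simps hom_add hom_mult hom_one)
  obtain B where B: "countable B" "ext.metric.mtopology closure_of L.span B = UNIV"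
    using assms(1) unfolding countable_type_def by blast
  \<comment> \<open>\<open>B\<close> may be finite, or empty as far as this argument knows, so
    \<open>e\<close> merely covers it; further vectors in the range of \<open>e\<close> do no
    harm.\<close>
  obtain e :: "nat \<Rightarrow> 'l" where e: "B \<subseteq> range e"
    using B(1) by (metis countable_def from_nat_into_surj subsetI rangeI empty_subsetI)
  \<comment> \<open>Strictly increasing from \<open>C0\<close> with limit \<open>2 * C0\<close>:
    each step has room for a loss, while the union keeps the bound \<open>2 * C0\<close>.\<close>
  define c where "c = (\<lambda>m. C0 * (2 - inverse (2 ^ m)))"
  have c0: "c 0 = C0" and c_pos: "0 < c m" and c_Suc: "c m < c (Suc m)" and c_le: "c m \<le> 2 * C0" for m
  proof -
    have "inverse (2 ^ m) \<le> (1::real)"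
      by (simp add: inverse_le_1_iff)
    then show "0 < c m" "c m < c (Suc m)" "c m \<le> 2 * C0"
      using \<open>0 < C0\<close> by (simp_all add: c_def)
  qed (simp add: c_def)
  have "\<exists>G'. (functional_graph (c (Suc m)) G' \<and> G0 \<subseteq> G') \<and> (G \<subseteq> G' \<and> e m \<in> fst ` G')"
    if G: "functional_graph (c m) G \<and> G0 \<subseteq> G" for m G
  proof -
    obtain t where "\<And>a b. (a, b) \<in> G \<Longrightarrow> v (t - b) \<le> c (Suc m) * w (e m - a)"
      using extension_value_lossy[of "c m" G "c (Suc m)" "e m"] G c_pos c_Suc by blast
    moreover have "functional_graph (c (Suc m)) G"
      using functional_graph_mono G c_Suc less_imp_le by blast
    ultimately obtain G' where "functional_graph (c (Suc m)) G'" "G \<subseteq> G'" "(e m, t) \<in> G'"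
      using functional_graph_insert[of "c (Suc m)" G t "e m"] c_pos less_imp_le by metis
    then show ?thesis
      using G by (force intro!: exI[of _ G'])
  qed
  moreover have "\<exists>G. functional_graph (c 0) G \<and> G0 \<subseteq> G"
    using assms(2) c0 by auto
  ultimately obtain \<G> where \<G>: "\<And>m. functional_graph (c m) (\<G> m)" "\<And>m. G0 \<subseteq> \<G> m"
    "\<And>m. \<G> m \<subseteq> \<G> (Suc m)" "\<And>m. e m \<in> fst ` \<G> (Suc m)"
    using dependent_nat_choice[of "\<lambda>m G. functional_graph (c m) G \<and> G0 \<subseteq> G"
        "\<lambda>m G G'. G \<subseteq> G' \<and> e m \<in> fst ` G'"] by metis
  have mono: "\<G> m \<subseteq> \<G> m'" if "m \<le> m'" for m m'
    using lift_Suc_mono_le[of \<G>, OF \<G>(3) that] .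
  define G where "G = (\<Union>m. \<G> m)"
  have G: "functional_graph (2 * C0) G"
    unfolding G_def
  proof (rule functional_graph_Union)
    show "functional_graph (2 * C0) H" if "H \<in> range \<G>" for H
      using that functional_graph_mono[OF \<G>(1) c_le] by blast
    show "H \<subseteq> H' \<or> H' \<subseteq> H" if "H \<in> range \<G>" "H' \<in> range \<G>" for H H'
      using that mono by (metis nle_le rangeE)
  qed simp
  have "L.subspace (fst ` G)"
  proof (rule L.subspaceI)
    show "0 \<in> fst ` G"
      using G unfolding functional_graph_def by (auto intro: rev_image_eqI)
  next
    fix x y assume "x \<in> fst ` G" "y \<in> fst ` G"
    then obtain b b' where "(x, b) \<in> G" "(y, b') \<in> G"
      by auto
    then have "(x + y, b + b') \<in> G"
      using G unfolding functional_graph_def by blast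
    then show "x + y \<in> fst ` G"
      by (rule rev_image_eqI) simp
  next
    fix c x assume "x \<in> fst ` G"
    then obtain b where "(x, b) \<in> G"
      by auto
    then have "(\<iota> c * x, c * b) \<in> G"
      using G unfolding functional_graph_def by blast
    then show "\<iota> c * x \<in> fst ` G"
      by (rule rev_image_eqI) simp
  qed
  moreover have "B \<subseteq> fst ` G"
  proof
    fix x assume "x \<in> B"
    then obtain m where "x = e m"
      using e by blast
    then show "x \<in> fst ` G"
      using \<G>(4)[of m] unfolding G_def by blast
  qed
  ultimately have span: "L.span B \<subseteq> fst ` G"
    by (rule L.span_minimal[rotated])
  have "\<exists>(a, b)\<in>G. w (z - a) < \<epsilon>" if "\<epsilon> > 0" for z \<epsilon>
  proof -
    have "z \<in> ext.metric.mtopology closure_of L.span B"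
      using B(2) by simp
    then have "\<exists>x\<in>L.span B. x \<in> ext.metric.mball z \<epsilon>"
      using that unfolding ext.metric.metric_closure_of by blast
    then obtain x where "x \<in> L.span B" "w (z - x) < \<epsilon>"
      by (auto simp: na_dist_def)
    moreover from this obtain p where "p \<in> G" "x = fst p"
      using span by blast
    ultimately show ?thesis
      by (intro bexI[of _ p]) (simp_all add: case_prod_unfold)
  qed
  moreover have "G0 \<subseteq> G"
    using \<G>(2) unfolding G_def by blast
  ultimately show thesis
    using that G by blast
qed

text \<open>Both cases start from the functional on the line through \<open>y\<close> that sends
  \<open>y\<close> to 1. In the countable case all loss is spent before Zorn's lemma comes in: from
  then on the domain is dense and each further value is a limit. Unlimited repetition of lossy steps
  would leave no common bound.\<close>

lemma bounded_functionals_separate: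
  assumes "spherically_complete v \<or> countable_type w \<iota>" and "y \<noteq> 0"
  obtains \<phi> where "bounded_functional \<phi>" "\<phi> y = 1"
proof -
  define G0 where "G0 = {(\<iota> t * y, t) | t. True}"
  have G0: "functional_graph (inverse (w y)) G0" and pos: "0 < inverse (w y)"
    using functional_graph_line assms(2) by (simp_all add: G0_def)
  have "\<exists>\<phi>. bounded_functional \<phi> \<and> (\<forall>a b. (a, b) \<in> G0 \<longrightarrow> \<phi> a = b)"
    using assms(1)
  proof
    assume sph: "spherically_complete v"
    have "\<exists>c. \<forall>a b. (a, b) \<in> G \<longrightarrow> v (c - b) \<le> inverse (w y) * w (z - a)"
      if "functional_graph (inverse (w y)) G" for G z
      by (rule extension_value_spherical[OF that pos sph, of z]) (rule exI, blast)
    then show ?thesis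
      by (intro functional_graph_total[OF G0 less_imp_le[OF pos]])
  next
    assume "countable_type w \<iota>"
    have nonneg: "0 \<le> 2 * inverse (w y)"
      by (simp add: ext.nonneg)
    from \<open>countable_type w \<iota>\<close> obtain G1 where G1: "functional_graph (2 * inverse (w y)) G1" "G0 \<subseteq> G1"
      and dense: "\<And>z \<epsilon>. \<epsilon> > 0 \<Longrightarrow> \<exists>(a, b)\<in>G1. w (z - a) < \<epsilon>"
      using countable_type_dense_graph[OF _ G0 pos] by blast
    have "\<exists>c. \<forall>a b. (a, b) \<in> G \<longrightarrow> v (c - b) \<le> (2 * inverse (w y)) * w (z - a)"
      if "functional_graph (2 * inverse (w y)) G" "G1 \<subseteq> G" for G z
    proof -
      have *: "\<exists>(a, b)\<in>G. w (z - a) < \<epsilon>" if "\<epsilon> > 0" for \<epsilon>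
        using dense[OF that, of z] \<open>G1 \<subseteq> G\<close> by blast
      show ?thesis
        by (rule extension_value_limit[OF that(1) nonneg, of z]) (erule *, rule exI, blast)
    qed
    then obtain \<phi> where "bounded_functional \<phi>" "\<forall>a b. (a, b) \<in> G1 \<longrightarrow> \<phi> a = b"
      using functional_graph_total[OF G1(1) nonneg] by metis
    then show ?thesis
      using G1(2) by blast
  qed
  moreover have "(y, 1) \<in> G0"
    by (auto simp: G0_def hom_one intro!: exI[of _ 1])
  ultimately show thesis
    using that by blast
qed

end

section \<open>Tate algebras\<close>

definition conv :: "((nat \<Rightarrow> nat) \<Rightarrow> 'k::field) \<Rightarrow> ((nat \<Rightarrow> nat) \<Rightarrow> 'k) \<Rightarrow> (nat \<Rightarrow> nat) \<Rightarrow> 'k"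
  where "conv a b = (\<lambda>\<nu>. \<Sum>\<mu>\<in>{..\<nu>}. a \<mu> * b (\<nu> - \<mu>))"

lemma tate_simps [simp]:
  "a \<otimes>\<^bsub>tate v n\<^esub> b = conv a b"
  "\<one>\<^bsub>tate v n\<^esub> = (\<lambda>\<nu>. if \<nu> = (\<lambda>_. 0) then 1 else 0)"
  "\<zero>\<^bsub>tate v n\<^esub> = (\<lambda>\<nu>. 0)"
  "a \<oplus>\<^bsub>tate v n\<^esub> b = (\<lambda>\<nu>. a \<nu> + b \<nu>)"
  by (simp_all add: tate_def power_series_def conv_def)

lemma index_le_add_diff: "\<mu> \<le> \<nu> \<Longrightarrow> \<mu> + (\<nu> - \<mu>) = \<nu>" for \<mu> \<nu> :: "nat \<Rightarrow> nat"
  by (auto simp: le_fun_def fun_eq_iff)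

lemma multi_indices_add_iff: "\<mu> + \<kappa> \<in> multi_indices n \<longleftrightarrow> \<mu> \<in> multi_indices n \<and> \<kappa> \<in> multi_indices n"
  by (auto simp: multi_indices_def)

lemma multi_indices_downward: "\<nu> \<in> multi_indices n \<Longrightarrow> \<mu> \<le> \<nu> \<Longrightarrow> \<mu> \<in> multi_indices n"
  using multi_indices_add_iff[of \<mu> "\<nu> - \<mu>" n] index_le_add_diff[of \<mu> \<nu>] by simp

lemma finite_bounded_indices: "finite {\<nu> \<in> multi_indices n. (\<Sum>i<n. \<nu> i) \<le> N}"
proof (rule finite_subset)
  show "{\<nu> \<in> multi_indices n. (\<Sum>i<n. \<nu> i) \<le> N} \<subseteq>
      {\<nu>. \<forall>i. (i \<in> {..<n} \<longrightarrow> \<nu> i \<in> {..N}) \<and> (i \<notin> {..<n} \<longrightarrow> \<nu> i = 0)}"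
  proof (intro subsetI CollectI allI conjI impI)
    fix \<nu> :: "nat \<Rightarrow> nat" and i assume "\<nu> \<in> {\<nu> \<in> multi_indices n. (\<Sum>i<n. \<nu> i) \<le> N}" "i \<in> {..<n}"
    then have "\<nu> i \<le> (\<Sum>i<n. \<nu> i)" "(\<Sum>i<n. \<nu> i) \<le> N"
      by (auto intro: member_le_sum)
    then show "\<nu> i \<in> {..N}"
      by simp
  qed (auto simp: multi_indices_def)
  show "finite {\<nu>. \<forall>i. (i \<in> {..<n} \<longrightarrow> \<nu> i \<in> {..N}) \<and> (i \<notin> {..<n} \<longrightarrow> \<nu> i = (0::nat))}"
    by (rule finite_set_of_finite_funs) auto
qed

lemma finite_index_atMost:
  assumes "\<nu> \<in> multi_indices n"
  shows "finite {..\<nu>}"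
proof (rule finite_subset[OF _ finite_bounded_indices])
  show "{..\<nu>} \<subseteq> {\<mu> \<in> multi_indices n. (\<Sum>i<n. \<mu> i) \<le> (\<Sum>i<n. \<nu> i)}"
    using multi_indices_downward[OF assms] by (auto simp: le_fun_def intro: sum_mono)
qed

lemma conv_commute: "conv a b = conv b a"
proof
  fix \<nu>
  have "\<nu> - (\<nu> - \<mu>) = \<mu>" "\<nu> - \<mu> \<le> \<nu>" if "\<mu> \<le> \<nu>" for \<mu> :: "nat \<Rightarrow> nat"
    using that by (auto simp: le_fun_def fun_eq_iff)
  then show "conv a b \<nu> = conv b a \<nu>"
    unfolding conv_def
    by (intro sum.reindex_bij_witness[of _ "\<lambda>\<mu>. \<nu> - \<mu>" "\<lambda>\<mu>. \<nu> - \<mu>"]) (auto simp: mult.commute)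
qed

lemma conv_add_left: "conv (\<lambda>\<nu>. a \<nu> + b \<nu>) c = (\<lambda>\<nu>. conv a c \<nu> + conv b c \<nu>)"
  by (simp add: conv_def fun_eq_iff distrib_right sum.distrib)

lemma conv_diff_left: "conv (\<lambda>\<nu>. a \<nu> - b \<nu>) c = (\<lambda>\<nu>. conv a c \<nu> - conv b c \<nu>)"
  by (simp add: conv_def fun_eq_iff left_diff_distrib sum_subtractf)

lemma conv_nonzeroE:
  assumes "conv a b \<nu> \<noteq> 0"
  obtains \<mu> where "\<mu> \<le> \<nu>" "a \<mu> \<noteq> 0" "b (\<nu> - \<mu>) \<noteq> 0"
proof -
  have "\<exists>\<mu>\<in>{..\<nu>}. a \<mu> * b (\<nu> - \<mu>) \<noteq> 0"
    using assms unfolding conv_def by (meson sum.neutral)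
  then show thesis
    using that by auto
qed

lemma conv_supported:
  assumes "\<And>\<nu>. \<nu> \<notin> multi_indices n \<Longrightarrow> a \<nu> = 0" "\<And>\<nu>. \<nu> \<notin> multi_indices n \<Longrightarrow> b \<nu> = 0"
    and "\<nu> \<notin> multi_indices n"
  shows "conv a b \<nu> = 0"
proof (rule ccontr)
  assume "conv a b \<nu> \<noteq> 0"
  then obtain \<mu> where \<mu>: "\<mu> \<le> \<nu>" "a \<mu> \<noteq> 0" "b (\<nu> - \<mu>) \<noteq> 0"
    by (rule conv_nonzeroE)
  then have "\<mu> \<in> multi_indices n" "\<nu> - \<mu> \<in> multi_indices n"
    using assms(1,2) by blast+
  then show False
    using assms(3) multi_indices_add_iff[of \<mu> "\<nu> - \<mu>" n] index_le_add_diff[OF \<mu>(1)] by simp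
qed

text \<open>Both sides sum over triples of indices with total \<nu>: the pairs
  \<open>\<kappa> \<le> \<mu> \<le> \<nu>\<close> correspond to the pairs of \<open>\<kappa>\<close>
  and \<open>\<mu> - \<kappa>\<close>. Exchanging the sums needs the sets \<open>{..\<mu>}\<close>
  to be finite, which holds for multi-indices in finitely many variables; at other indices the
  supports make both sides 0.\<close>

lemma conv_assoc:
  assumes a: "\<And>\<nu>. \<nu> \<notin> multi_indices n \<Longrightarrow> a \<nu> = 0" and b: "\<And>\<nu>. \<nu> \<notin> multi_indices n \<Longrightarrow> b \<nu> = 0"
    and c: "\<And>\<nu>. \<nu> \<notin> multi_indices n \<Longrightarrow> c \<nu> = 0"
  shows "conv (conv a b) c = conv a (conv b c)"
proof
  fix \<nu>
  show "conv (conv a b) c \<nu> = conv a (conv b c) \<nu>"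
  proof (cases "\<nu> \<in> multi_indices n")
    case False
    note ab = conv_supported[of n a b, OF a b] and bc = conv_supported[of n b c, OF b c]
    show ?thesis
      using conv_supported[of n _ _ \<nu>, OF ab c False] conv_supported[of n _ _ \<nu>, OF a bc False]
      by simp
  next
    case True
    have fin: "finite {..\<mu>}" if "\<mu> \<le> \<nu>" for \<mu>
      using finite_index_atMost multi_indices_downward[OF True that] by blast
    have "conv (conv a b) c \<nu> = (\<Sum>\<mu>\<in>{..\<nu>}. \<Sum>\<kappa>\<in>{..\<mu>}. a \<kappa> * b (\<mu> - \<kappa>) * c (\<nu> - \<mu>))"
      by (simp add: conv_def sum_distrib_right)
    also have "\<dots> = (\<Sum>(\<mu>, \<kappa>)\<in>Sigma {..\<nu>} (\<lambda>\<mu>. {..\<mu>}). a \<kappa> * b (\<mu> - \<kappa>) * c (\<nu> - \<mu>))"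
      using fin by (intro sum.Sigma) auto
    also have "\<dots> = (\<Sum>(\<kappa>, \<rho>)\<in>Sigma {..\<nu>} (\<lambda>\<kappa>. {..\<nu> - \<kappa>}). a \<kappa> * (b \<rho> * c (\<nu> - \<kappa> - \<rho>)))"
    proof -
      have 1: "\<kappa> + (\<mu> - \<kappa>) = \<mu>" "\<kappa> \<le> \<nu>" "\<mu> - \<kappa> \<le> \<nu> - \<kappa>" "\<nu> - \<kappa> - (\<mu> - \<kappa>) = \<nu> - \<mu>"
        if "\<mu> \<le> \<nu>" "\<kappa> \<le> \<mu>" for \<mu> \<kappa> :: "nat \<Rightarrow> nat"
        using that order_trans[OF that(2,1)] by (auto simp: le_fun_def fun_eq_iff diff_le_mono)
      have 2: "\<kappa> + \<rho> \<le> \<nu>" "\<kappa> \<le> \<kappa> + \<rho>" "\<kappa> + \<rho> - \<kappa> = \<rho>"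
        if "\<kappa> \<le> \<nu>" "\<rho> \<le> \<nu> - \<kappa>" for \<rho> \<kappa> :: "nat \<Rightarrow> nat"
      proof -
        have "\<kappa> i + \<rho> i \<le> \<nu> i" for i
          using le_funD[OF that(1), of i] le_funD[OF that(2), of i] by simp
        then show "\<kappa> + \<rho> \<le> \<nu>" "\<kappa> \<le> \<kappa> + \<rho>" "\<kappa> + \<rho> - \<kappa> = \<rho>"
          by (auto simp: le_fun_def fun_eq_iff)
      qed
      show ?thesis
        by (rule sum.reindex_bij_witness[of _ "\<lambda>(\<kappa>, \<rho>). (\<kappa> + \<rho>, \<kappa>)" "\<lambda>(\<mu>, \<kappa>). (\<kappa>, \<mu> - \<kappa>)"])
          (use 1 2 in \<open>auto simp: mult.assoc\<close>)
    qed
    also have "\<dots> = (\<Sum>\<kappa>\<in>{..\<nu>}. \<Sum>\<rho>\<in>{..\<nu> - \<kappa>}. a \<kappa> * (b \<rho> * c (\<nu> - \<kappa> - \<rho>)))"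
    proof (rule sum.Sigma[symmetric])
      show "\<forall>\<kappa>\<in>{..\<nu>}. finite {..\<nu> - \<kappa>}"
        using fin by (auto simp: le_fun_def)
    qed (use fin in auto)
    also have "\<dots> = conv a (conv b c) \<nu>"
      by (simp add: conv_def sum_distrib_left)
    finally show ?thesis .
  qed
qed

lemma conv_delta:
  assumes "\<kappa> \<in> multi_indices n" and "\<nu> \<in> multi_indices n"
  shows "conv (\<lambda>\<mu>. if \<mu> = \<kappa> then c else 0) b \<nu> = (if \<kappa> \<le> \<nu> then c * b (\<nu> - \<kappa>) else 0)"
proof -
  have "conv (\<lambda>\<mu>. if \<mu> = \<kappa> then c else 0) b \<nu> = (\<Sum>\<mu>\<in>{..\<nu>}. if \<mu> = \<kappa> then c * b (\<nu> - \<mu>) else 0)"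
    unfolding conv_def by (intro sum.cong) auto
  then show ?thesis
    using finite_index_atMost[OF assms(2)] by simp
qed

section \<open>The ring of convergent series\<close>

context na_field
begin

text \<open>Only finitely many multi-indices have bounded degree, so the coefficients tend to 0
  exactly if, for each \<epsilon>, all but finitely many are smaller than \<epsilon>. This form
  mentions no degree and turns closure properties into inclusions between finite sets.\<close>

lemma tate_iff: "a \<in> carrier (tate v n) \<longleftrightarrow>
  (\<forall>\<nu>. \<nu> \<notin> multi_indices n \<longrightarrow> a \<nu> = 0) \<and> (\<forall>\<epsilon>>0. finite {\<nu>. \<epsilon> \<le> v (a \<nu>)})"
proof -
  have "(\<exists>N. \<forall>\<nu>\<in>multi_indices n. (\<Sum>i<n. \<nu> i) \<ge> N \<longrightarrow> v (a \<nu>) < \<epsilon>) \<longleftrightarrow> finite {\<nu>. \<epsilon> \<le> v (a \<nu>)}"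
    if supp: "\<forall>\<nu>. \<nu> \<notin> multi_indices n \<longrightarrow> a \<nu> = 0" and "\<epsilon> > 0" for \<epsilon>
  proof
    assume "\<exists>N. \<forall>\<nu>\<in>multi_indices n. (\<Sum>i<n. \<nu> i) \<ge> N \<longrightarrow> v (a \<nu>) < \<epsilon>"
    then obtain N where N: "\<And>\<nu>. \<nu> \<in> multi_indices n \<Longrightarrow> (\<Sum>i<n. \<nu> i) \<ge> N \<Longrightarrow> v (a \<nu>) < \<epsilon>"
      by blast
    have "{\<nu>. \<epsilon> \<le> v (a \<nu>)} \<subseteq> {\<nu> \<in> multi_indices n. (\<Sum>i<n. \<nu> i) \<le> N}"
    proof
      fix \<nu> assume "\<nu> \<in> {\<nu>. \<epsilon> \<le> v (a \<nu>)}"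
      then have \<nu>: "\<epsilon> \<le> v (a \<nu>)"
        by simp
      then have "\<nu> \<in> multi_indices n"
        using supp \<open>\<epsilon> > 0\<close> by force
      then show "\<nu> \<in> {\<nu> \<in> multi_indices n. (\<Sum>i<n. \<nu> i) \<le> N}"
        using N[of \<nu>] \<nu> by force
    qed
    then show "finite {\<nu>. \<epsilon> \<le> v (a \<nu>)}"
      using finite_bounded_indices finite_subset by blast
  next
    assume fin: "finite {\<nu>. \<epsilon> \<le> v (a \<nu>)}"
    \<comment> \<open>If no coefficient reaches \<epsilon>, this is \<open>Max\<close> of the empty
      set, an unspecified number; any threshold is right in that case.\<close>
    let ?S = "(\<lambda>\<nu>. \<Sum>i<n. \<nu> i) ` {\<nu>. \<epsilon> \<le> v (a \<nu>)}"
    have "v (a \<nu>) < \<epsilon>" if "(\<Sum>i<n. \<nu> i) \<ge> Suc (Max ?S)" for \<nu>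
    proof (rule ccontr)
      assume "\<not> v (a \<nu>) < \<epsilon>"
      then have "(\<Sum>i<n. \<nu> i) \<le> Max ?S"
        using fin by (intro Max_ge) auto
      then show False
        using that by simp
    qed
    then show "\<exists>N. \<forall>\<nu>\<in>multi_indices n. (\<Sum>i<n. \<nu> i) \<ge> N \<longrightarrow> v (a \<nu>) < \<epsilon>"
      by blast
  qed
  then show ?thesis
    by (auto simp: tate_def power_series_def)
qed

lemma tateI:
  assumes "\<And>\<nu>. \<nu> \<notin> multi_indices n \<Longrightarrow> a \<nu> = 0" "\<And>\<epsilon>. \<epsilon> > 0 \<Longrightarrow> finite {\<nu>. \<epsilon> \<le> v (a \<nu>)}"
  shows "a \<in> carrier (tate v n)"
  using assms tate_iff by blast

lemma tate_supp: "a \<in> carrier (tate v n) \<Longrightarrow> \<nu> \<notin> multi_indices n \<Longrightarrow> a \<nu> = 0"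
  using tate_iff by blast

lemma tate_finite: "a \<in> carrier (tate v n) \<Longrightarrow> \<epsilon> > 0 \<Longrightarrow> finite {\<nu>. \<epsilon> \<le> v (a \<nu>)}"
  using tate_iff by blast

lemma tate_bounded:
  assumes "a \<in> carrier (tate v n)"
  obtains C where "C > 0" "\<And>\<nu>. v (a \<nu>) \<le> C"
proof
  let ?S = "insert 1 ((\<lambda>\<nu>. v (a \<nu>)) ` {\<nu>. 1 \<le> v (a \<nu>)})"
  have fin: "finite ?S"
    using tate_finite[OF assms] by simp
  then have "1 \<le> Max ?S"
    by (intro Max_ge) auto
  then show "0 < Max ?S"
    by linarith
  show "v (a \<nu>) \<le> Max ?S" for \<nu>
  proof (cases "1 \<le> v (a \<nu>)")
    case True
    then show ?thesis
      using fin by (intro Max_ge) auto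
  qed (use \<open>1 \<le> Max ?S\<close> in linarith)
qed

text \<open>The two absolute values may belong to different fields: besides rescaling and truncation
  over one field, this covers the application of a bounded functional to all coefficients.\<close>

lemma tate_mono:
  assumes a: "a \<in> carrier (tate v n)" and supp: "\<And>\<nu>. \<nu> \<notin> multi_indices n \<Longrightarrow> b \<nu> = 0"
    and le: "\<And>\<nu>. w (b \<nu>) \<le> C * v (a \<nu>)" and w: "na_field w"
  shows "b \<in> carrier (tate w n)"
proof (rule na_field.tateI[OF w supp])
  fix \<epsilon> :: real assume "\<epsilon> > 0"
  \<comment> \<open>\<open>C\<close> is an arbitrary real; raising it to at least 1 makes it safe to
    divide by.\<close>
  define D where "D = max C 1"
  have "{\<nu>. \<epsilon> \<le> w (b \<nu>)} \<subseteq> {\<nu>. \<epsilon> / D \<le> v (a \<nu>)}"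
  proof
    fix \<nu> assume "\<nu> \<in> {\<nu>. \<epsilon> \<le> w (b \<nu>)}"
    then have "\<epsilon> \<le> C * v (a \<nu>)"
      using le[of \<nu>] by simp
    also have "\<dots> \<le> D * v (a \<nu>)"
      by (intro mult_right_mono nonneg) (simp add: D_def)
    finally show "\<nu> \<in> {\<nu>. \<epsilon> / D \<le> v (a \<nu>)}"
      by (simp add: D_def divide_le_eq mult.commute)
  qed
  moreover have "0 < \<epsilon> / D"
    using \<open>\<epsilon> > 0\<close> by (simp add: D_def)
  ultimately show "finite {\<nu>. \<epsilon> \<le> w (b \<nu>)}"
    using tate_finite[OF a] finite_subset by blast
qed

lemma tate_add:
  assumes "a \<in> carrier (tate v n)" "b \<in> carrier (tate v n)"
  shows "(\<lambda>\<nu>. a \<nu> + b \<nu>) \<in> carrier (tate v n)"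
proof (rule tateI)
  fix \<epsilon> :: real assume "\<epsilon> > 0"
  have "{\<nu>. \<epsilon> \<le> v (a \<nu> + b \<nu>)} \<subseteq> {\<nu>. \<epsilon> \<le> v (a \<nu>)} \<union> {\<nu>. \<epsilon> \<le> v (b \<nu>)}"
  proof
    fix \<nu> assume "\<nu> \<in> {\<nu>. \<epsilon> \<le> v (a \<nu> + b \<nu>)}"
    then show "\<nu> \<in> {\<nu>. \<epsilon> \<le> v (a \<nu>)} \<union> {\<nu>. \<epsilon> \<le> v (b \<nu>)}"
      using ultrametric[of "a \<nu>" "b \<nu>"] by (auto simp: max_def split: if_splits)
  qed
  then show "finite {\<nu>. \<epsilon> \<le> v (a \<nu> + b \<nu>)}"
    using tate_finite[OF assms(1) \<open>\<epsilon> > 0\<close>] tate_finite[OF assms(2) \<open>\<epsilon> > 0\<close>]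
    by (meson finite_UnI finite_subset)
qed (simp add: tate_supp[OF assms(1)] tate_supp[OF assms(2)])

lemma tate_uminus: "a \<in> carrier (tate v n) \<Longrightarrow> (\<lambda>\<nu>. - a \<nu>) \<in> carrier (tate v n)"
  by (auto simp: tate_iff)

lemma tate_diff:
  "a \<in> carrier (tate v n) \<Longrightarrow> b \<in> carrier (tate v n) \<Longrightarrow> (\<lambda>\<nu>. a \<nu> - b \<nu>) \<in> carrier (tate v n)"
  using tate_add[of a n "\<lambda>\<nu>. - b \<nu>"] tate_uminus[of b n] by simp

lemma tate_finite_support:
  assumes "finite A" "A \<subseteq> multi_indices n" "\<And>\<nu>. \<nu> \<notin> A \<Longrightarrow> a \<nu> = 0"
  shows "a \<in> carrier (tate v n)"
proof (rule tateI)
  fix \<epsilon> :: real assume "\<epsilon> > 0"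
  then have "{\<nu>. \<epsilon> \<le> v (a \<nu>)} \<subseteq> A"
    using assms(3) by force
  then show "finite {\<nu>. \<epsilon> \<le> v (a \<nu>)}"
    using assms(1) finite_subset by blast
qed (use assms in blast)

lemma tate_zero: "(\<lambda>\<nu>. 0) \<in> carrier (tate v n)"
  by (rule tate_finite_support[of "{}"]) auto

lemma tate_delta: "\<kappa> \<in> multi_indices n \<Longrightarrow> (\<lambda>\<nu>. if \<nu> = \<kappa> then c else 0) \<in> carrier (tate v n)"
  by (rule tate_finite_support[of "{\<kappa>}"]) auto

lemma conv_le:
  assumes "\<And>\<mu>. v (a \<mu>) \<le> r" "\<And>\<mu>. v (b \<mu>) \<le> s" "0 \<le> r"
  shows "v (conv a b \<nu>) \<le> r * s"
proof -
  have "0 \<le> s"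
    using assms(2)[of \<nu>] nonneg[of "b \<nu>"] by linarith
  then show ?thesis
    unfolding conv_def using assms nonneg by (intro v_sum_le) (auto simp: mult intro!: mult_mono)
qed

text \<open>A coefficient of size at least \<epsilon> has a summand larger than
  \<open>\<epsilon> / 2\<close>, and both factors of that summand must be large because the other
  one is bounded. Hence its index is a sum of two indices from finite sets. The factor 2 leaves room
  for a strict inequality, as \<open>v_sum_le\<close> yields only a weak one.\<close>

lemma tate_conv:
  assumes a: "a \<in> carrier (tate v n)" and b: "b \<in> carrier (tate v n)"
  shows "conv a b \<in> carrier (tate v n)"
proof (rule tateI)
  show "conv a b \<nu> = 0" if "\<nu> \<notin> multi_indices n" for \<nu>
    using conv_supported[of n a b \<nu>] tate_supp[OF a] tate_supp[OF b] that by blast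
next
  fix \<epsilon> :: real assume "\<epsilon> > 0"
  obtain C where C: "C > 0" "\<And>\<nu>. v (a \<nu>) \<le> C"
    using tate_bounded[OF a] by blast
  obtain D where D: "D > 0" "\<And>\<nu>. v (b \<nu>) \<le> D"
    using tate_bounded[OF b] by blast
  let ?A = "{\<mu>. \<epsilon> / (2 * D) \<le> v (a \<mu>)}" and ?B = "{\<mu>. \<epsilon> / (2 * C) \<le> v (b \<mu>)}"
  have "{\<nu>. \<epsilon> \<le> v (conv a b \<nu>)} \<subseteq> (\<lambda>(\<mu>, \<kappa>). \<mu> + \<kappa>) ` (?A \<times> ?B)"
  proof (rule subsetI, rule ccontr)
    fix \<nu> assume \<nu>: "\<nu> \<in> {\<nu>. \<epsilon> \<le> v (conv a b \<nu>)}" and not: "\<nu> \<notin> (\<lambda>(\<mu>, \<kappa>). \<mu> + \<kappa>) ` (?A \<times> ?B)"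
    have "v (a \<mu> * b (\<nu> - \<mu>)) \<le> \<epsilon> / 2" if "\<mu> \<in> {..\<nu>}" for \<mu>
    proof -
      have "\<mu> \<notin> ?A \<or> \<nu> - \<mu> \<notin> ?B"
      proof (rule ccontr)
        assume "\<not> ?thesis"
        then have "(\<mu>, \<nu> - \<mu>) \<in> ?A \<times> ?B"
          by blast
        moreover have "\<nu> = (\<lambda>(\<mu>, \<kappa>). \<mu> + \<kappa>) (\<mu>, \<nu> - \<mu>)"
          using index_le_add_diff[of \<mu> \<nu>] that by simp
        ultimately show False
          using not by (metis image_eqI)
      qed
      then consider "v (a \<mu>) \<le> \<epsilon> / (2 * D)" | "v (b (\<nu> - \<mu>)) \<le> \<epsilon> / (2 * C)"
        by fastforce
      then have "v (a \<mu>) * v (b (\<nu> - \<mu>)) \<le> \<epsilon> / 2"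
      proof cases
        case 1
        then have "v (a \<mu>) * v (b (\<nu> - \<mu>)) \<le> \<epsilon> / (2 * D) * D"
          using D nonneg \<open>\<epsilon> > 0\<close> by (intro mult_mono) auto
        then show ?thesis
          using D(1) by simp
      next
        case 2
        then have "v (a \<mu>) * v (b (\<nu> - \<mu>)) \<le> C * (\<epsilon> / (2 * C))"
          using C nonneg \<open>\<epsilon> > 0\<close> by (intro mult_mono) auto
        then show ?thesis
          using C(1) by simp
      qed
      then show ?thesis
        by (simp add: mult)
    qed
    then have "v (conv a b \<nu>) \<le> \<epsilon> / 2"
      unfolding conv_def using \<open>\<epsilon> > 0\<close> by (intro v_sum_le) auto
    then show False
      using \<nu> \<open>\<epsilon> > 0\<close> by simp
  qed
  moreover have "finite ?A" "finite ?B"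
    using C(1) D(1) \<open>\<epsilon> > 0\<close> by (auto intro!: tate_finite[OF a] tate_finite[OF b])
  ultimately show "finite {\<nu>. \<epsilon> \<le> v (conv a b \<nu>)}"
    by (meson finite_SigmaI finite_imageI finite_subset)
qed

lemma zero_index: "(\<lambda>_. 0) \<in> multi_indices n"
  by (simp add: multi_indices_def)

lemma conv_one:
  assumes "b \<in> carrier (tate v n)"
  shows "conv (\<lambda>\<nu>. if \<nu> = (\<lambda>_. 0) then c else 0) b = (\<lambda>\<nu>. c * b \<nu>)"
proof
  fix \<nu> :: "nat \<Rightarrow> nat"
  have "(\<lambda>_. 0) \<le> \<nu>" "\<nu> - (\<lambda>_. 0) = \<nu>"
    by (auto simp: le_fun_def fun_eq_iff)
  then show "conv (\<lambda>\<nu>. if \<nu> = (\<lambda>_. 0) then c else 0) b \<nu> = c * b \<nu>"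
    using conv_delta[OF zero_index[of n], where \<nu> = \<nu> and c = c and b = b] tate_supp[OF assms, of \<nu>]
      conv_supported[of n "\<lambda>\<nu>. if \<nu> = (\<lambda>_. 0) then c else 0" b \<nu>] tate_supp[OF assms]
      tate_supp[OF tate_delta[OF zero_index[of n], where c = c]]
    by (cases "\<nu> \<in> multi_indices n") auto
qed

lemma cring_tate: "cring (tate v n)"
proof (rule cringI)
  show "abelian_group (tate v n)"
  proof (rule abelian_groupI)
    fix a assume "a \<in> carrier (tate v n)"
    then show "\<exists>b\<in>carrier (tate v n). b \<oplus>\<^bsub>tate v n\<^esub> a = \<zero>\<^bsub>tate v n\<^esub>"
      using tate_uminus by (intro bexI[of _ "\<lambda>\<nu>. - a \<nu>"]) auto
  qed (auto simp: tate_add tate_zero add_ac)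
  show "comm_monoid (tate v n)"
  proof (rule comm_monoidI)
    fix a b c assume "a \<in> carrier (tate v n)" "b \<in> carrier (tate v n)" "c \<in> carrier (tate v n)"
    then show "a \<otimes>\<^bsub>tate v n\<^esub> b \<otimes>\<^bsub>tate v n\<^esub> c = a \<otimes>\<^bsub>tate v n\<^esub> (b \<otimes>\<^bsub>tate v n\<^esub> c)"
      using conv_assoc[of n a b c] tate_supp by (metis tate_simps(1))
    show "a \<otimes>\<^bsub>tate v n\<^esub> b = b \<otimes>\<^bsub>tate v n\<^esub> a"
      by (simp add: conv_commute)
  qed (simp_all add: tate_conv conv_one tate_delta zero_index)
qed (auto simp: conv_add_left)

end

section \<open>The extension as a module, and coefficientwise functionals\<close>

lemma module_ring_as_module:
  assumes "cring R" "cring S" "\<phi> \<in> ring_hom R S"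
  shows "Module.module R (ring_as_module S \<phi>)"
proof -
  interpret R: cring R by fact
  interpret S: cring S by fact
  interpret ring_hom_cring R S \<phi>
    using assms by (intro ring_hom_cring.intro ring_hom_cring_axioms.intro)
  show ?thesis
  proof (rule Module.moduleI)
    show "abelian_group (ring_as_module S \<phi>)"
    proof (rule abelian_groupI)
      fix x assume "x \<in> carrier (ring_as_module S \<phi>)"
      then show "\<exists>y\<in>carrier (ring_as_module S \<phi>). y \<oplus>\<^bsub>ring_as_module S \<phi>\<^esub> x = \<zero>\<^bsub>ring_as_module S \<phi>\<^esub>"
        by (intro bexI[of _ "\<ominus>\<^bsub>S\<^esub> x"]) (simp_all add: ring_as_module_def S.l_neg)
    qed (simp_all add: ring_as_module_def S.a_ac)
  qed (use assms(1) in \<open>auto simp: ring_as_module_def S.l_distr S.r_distr S.m_assoc\<close>)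
qed

context na_field_extension
begin

lemma conv_hom: "conv (\<lambda>\<nu>. \<iota> (a \<nu>)) (\<lambda>\<nu>. \<iota> (b \<nu>)) \<nu> = \<iota> (conv a b \<nu>)"
  by (simp add: conv_def hom_sum hom_mult)

lemma tate_map_closed: "a \<in> carrier (tate v n) \<Longrightarrow> tate_map \<iota> a \<in> carrier (tate w n)"
  by (simp add: base.tate_iff ext.tate_iff tate_map_def extends)

lemma ring_extension_tate: "ring_extension (tate v n) (tate w n) (tate_map \<iota>)"
  unfolding ring_extension_def
proof (intro conjI)
  show "tate_map \<iota> \<in> ring_hom (tate v n) (tate w n)"
    by (rule ring_hom_memI) (auto simp: tate_map_closed, auto simp: tate_map_def conv_hom hom_add hom_one)
  have "\<iota> x = \<iota> y \<Longrightarrow> x = y" for x y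
    using hom_diff[of x y] by simp
  then show "inj_on (tate_map \<iota>) (carrier (tate v n))"
    by (auto simp: inj_on_def tate_map_def fun_eq_iff)
qed (rule base.cring_tate ext.cring_tate)+

lemma tate_module: "Module.module (tate v n) (ring_as_module (tate w n) (tate_map \<iota>))"
  using ring_extension_tate[of n] module_ring_as_module unfolding ring_extension_def by blast

lemma bounded_functional_sum:
  assumes "bounded_functional \<phi>"
  shows "\<phi> 0 = 0" and "\<phi> (sum f A) = (\<Sum>i\<in>A. \<phi> (f i))" and "\<phi> (x - y) = \<phi> x - \<phi> y"
proof -
  have add: "\<phi> (x + y) = \<phi> x + \<phi> y" for x y
    using assms unfolding bounded_functional_def by blast
  show zero: "\<phi> 0 = 0"
    using add[of 0 0] by (metis add.right_neutral add_left_cancel)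
  show "\<phi> (sum f A) = (\<Sum>i\<in>A. \<phi> (f i))"
    by (induction A rule: infinite_finite_induct) (simp_all add: add zero)
  show "\<phi> (x - y) = \<phi> x - \<phi> y"
    using add[of "x - y" y] by simp
qed

lemma bounded_functional_closed:
  assumes "bounded_functional \<phi>" "a \<in> carrier (tate w n)"
  shows "(\<lambda>\<nu>. \<phi> (a \<nu>)) \<in> carrier (tate v n)"
proof -
  obtain C where "\<And>x. v (\<phi> x) \<le> C * w x"
    using assms(1) unfolding bounded_functional_def by blast
  then show ?thesis
    using ext.tate_mono[OF assms(2) _ _ base.na_field_axioms, of "\<lambda>\<nu>. \<phi> (a \<nu>)" C]
      bounded_functional_sum(1)[OF assms(1)] ext.tate_supp[OF assms(2)] by simp
qed

text \<open>Each coefficient of the product is a finite combination of coefficients of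
  \<open>a\<close> with scalars \<open>\<iota> (r \<mu>)\<close>, or 0 by default. Linearity over
  \<open>k\<close> therefore already gives linearity over the Tate algebra of
  \<open>k\<close>.\<close>

lemma bounded_functional_conv:
  assumes "bounded_functional \<phi>"
  shows "\<phi> (conv (tate_map \<iota> r) a \<nu>) = conv r (\<lambda>\<nu>. \<phi> (a \<nu>)) \<nu>"
proof -
  have "\<phi> (\<iota> c * x) = c * \<phi> x" for c x
    using assms unfolding bounded_functional_def by blast
  then show ?thesis
    by (simp add: conv_def tate_map_def bounded_functional_sum(2)[OF assms])
qed

lemma bounded_functional_linear:
  assumes "bounded_functional \<phi>"
  shows "(\<lambda>a \<nu>. \<phi> (a \<nu>)) \<in> linear_maps (tate v n) (ring_as_module (tate w n) (tate_map \<iota>))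
    (ring_as_module (tate v n) (\<lambda>r. r))"
  using assms bounded_functional_closed[OF assms] bounded_functional_conv[OF assms]
  unfolding linear_maps_def ring_as_module_def bounded_functional_def by auto

end

section \<open>A monomial order and Dickson's lemma\<close>

text \<open>
  Sending the \<open>i\<close>-th variable to the \<open>i\<close>-th prime embeds the monoid of multi-indices into
  \<open>(\<nat>, \<cdot>)\<close>, so the order of \<open>\<nat>\<close> is a monomial order of type \<open>\<omega>\<close>.
\<close>

definition weight :: "nat \<Rightarrow> (nat \<Rightarrow> nat) \<Rightarrow> nat"
  where "weight n \<nu> = (\<Prod>i<n. enumerate {p::nat. Factorial_Ring.prime p} i ^ \<nu> i)"

lemma prime_enumerate: "Factorial_Ring.prime (enumerate {p::nat. Factorial_Ring.prime p} i)"
  using enumerate_in_set[OF primes_infinite] by blast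

lemma weight_add: "weight n (\<mu> + \<kappa>) = weight n \<mu> * weight n \<kappa>"
  by (simp add: weight_def power_add prod.distrib)

text \<open>Unique factorization: the entry at \<open>i\<close> is the multiplicity of the
  \<open>i\<close>-th prime. Comparing weights is thus a total order on multi-indices.\<close>

lemma weight_inject:
  assumes "\<mu> \<in> multi_indices n" "\<kappa> \<in> multi_indices n" "weight n \<mu> = weight n \<kappa>"
  shows "\<mu> = \<kappa>"
proof
  fix i
  let ?p = "enumerate {p::nat. Factorial_Ring.prime p}"
  have inj: "inj_on ?p {..<n}"
    using enumerate_mono[OF _ primes_infinite] by (intro inj_onI) (metis linorder_neqE_nat less_irrefl)
  have mult: "multiplicity (?p i) (weight n \<nu>) = \<nu> i" if "i < n" for \<nu>
  proof -
    have "weight n \<nu> = (\<Prod>p\<in>?p ` {..<n}. p ^ \<nu> (the_inv_into {..<n} ?p p))"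
      unfolding weight_def prod.reindex[OF inj]
      by (intro prod.cong) (simp_all add: the_inv_into_f_f[OF inj])
    moreover have "multiplicity (?p i) (\<Prod>p\<in>?p ` {..<n}. p ^ \<nu> (the_inv_into {..<n} ?p p)) =
        \<nu> (the_inv_into {..<n} ?p (?p i))"
      using that prime_enumerate by (subst multiplicity_prod_prime_powers) auto
    ultimately show ?thesis
      using the_inv_into_f_f[OF inj, of i] that by simp
  qed
  show "\<mu> i = \<kappa> i"
  proof (cases "i < n")
    case True
    then show ?thesis
      using mult assms(3) by metis
  qed (use assms(1,2) in \<open>simp add: multi_indices_def\<close>)
qed

lemma nat_incseq_subsequence:
  fixes t :: "nat \<Rightarrow> nat"
  shows "\<exists>f. strict_mono f \<and> incseq (t \<circ> f)"
proof -
  obtain f where f: "strict_mono f" "monoseq (\<lambda>j. t (f j))"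
    using seq_monosub by blast
  show ?thesis
  proof (cases "incseq (\<lambda>j. t (f j))")
    case True
    then show ?thesis
      using f(1) by (auto simp: o_def)
  next
    case False
    then have dec: "decseq (\<lambda>j. t (f j))"
      using f(2) by (simp add: monoseq_iff)
    obtain N where N: "\<And>j. t (f N) \<le> t (f j)"
      using ex_has_least_nat[of "\<lambda>_. True" _ "\<lambda>j. t (f j)"] by blast
    have "t (f (j + N)) = t (f N)" for j
      using N[of "j + N"] decseqD[OF dec, of N "j + N"] by simp
    moreover have "strict_mono (\<lambda>j. f (j + N))"
      using f(1) by (simp add: strict_mono_def)
    ultimately show ?thesis
      by (intro exI[of _ "\<lambda>j. f (j + N)"]) (simp add: o_def incseq_def)
  qed
qed

text \<open>Coordinates are treated one after the other; a further subsequence keeps the coordinates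
  that are already nondecreasing.\<close>

lemma index_incseq_subsequence:
  fixes s :: "nat \<Rightarrow> nat \<Rightarrow> nat"
  shows "\<exists>f. strict_mono f \<and> (\<forall>i<m. incseq (\<lambda>j. s (f j) i))"
proof (induction m)
  case 0
  then show ?case
    by (intro exI[of _ id]) (simp add: strict_mono_def)
next
  case (Suc m)
  then obtain f where f: "strict_mono f" "\<And>i. i < m \<Longrightarrow> incseq (\<lambda>j. s (f j) i)"
    by blast
  obtain g where g: "strict_mono g" "incseq ((\<lambda>j. s (f j) m) \<circ> g)"
    using nat_incseq_subsequence by blast
  have "incseq (\<lambda>j. s (f (g j)) i)" if "i < Suc m" for i
  proof (cases "i = m")
    case True
    then show ?thesis
      using g(2) by (simp add: o_def)
  next
    case False
    then have "incseq (\<lambda>j. s (f j) i)"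
      using f(2) that by simp
    then show ?thesis
      using strict_mono_mono[OF g(1)] unfolding incseq_def monotone_def by simp
  qed
  then show ?case
    using strict_mono_o[OF f(1) g(1)] by (intro exI[of _ "f \<circ> g"]) (simp add: o_def)
qed

text \<open>\<open>B\<close> consists of the minimal elements. Infinitely many of them would contain
  a sequence that is nondecreasing in every coordinate after thinning, hence two distinct comparable
  ones. Below each \<nu> there is a minimal element: one of least degree.\<close>

lemma dickson:
  assumes A: "A \<subseteq> multi_indices n"
  obtains B where "finite B" "B \<subseteq> A" "\<And>\<nu>. \<nu> \<in> A \<Longrightarrow> \<exists>\<mu>\<in>B. \<mu> \<le> \<nu>"
proof
  let ?B = "{\<mu> \<in> A. \<forall>\<kappa>\<in>A. \<kappa> \<le> \<mu> \<longrightarrow> \<kappa> = \<mu>}"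
  show "finite ?B"
  proof (rule ccontr)
    assume "infinite ?B"
    then obtain s :: "nat \<Rightarrow> nat \<Rightarrow> nat" where s: "inj s" "range s \<subseteq> ?B"
      using infinite_countable_subset by blast
    obtain f where f: "strict_mono f" "\<And>i. i < n \<Longrightarrow> incseq (\<lambda>j. s (f j) i)"
      using index_incseq_subsequence by blast
    have mem: "s j \<in> ?B" for j
      using s(2) by blast
    have "s (f 0) i \<le> s (f 1) i" for i
    proof (cases "i < n")
      case True
      then show ?thesis
        using incseqD[OF f(2), of i 0 1] by simp
    next
      case False
      then show ?thesis
        using mem[of "f 0"] A by (auto simp: multi_indices_def)
    qed
    then have "s (f 0) = s (f 1)"
      using mem[of "f 0"] mem[of "f 1"] by (auto simp: le_fun_def)
    then have "f 0 = f 1"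
      using s(1) by (simp add: inj_eq)
    then show False
      using f(1) strict_mono_eq by fastforce
  qed
  show "?B \<subseteq> A"
    by blast
  fix \<nu> assume "\<nu> \<in> A"
  then obtain \<mu> where \<mu>: "\<mu> \<in> A" "\<mu> \<le> \<nu>"
    and min: "\<And>\<kappa>. \<kappa> \<in> A \<Longrightarrow> \<kappa> \<le> \<nu> \<Longrightarrow> (\<Sum>i<n. \<mu> i) \<le> (\<Sum>i<n. \<kappa> i)"
    using ex_has_least_nat[of "\<lambda>\<kappa>. \<kappa> \<in> A \<and> \<kappa> \<le> \<nu>" \<nu> "\<lambda>\<kappa>. \<Sum>i<n. \<kappa> i"] by blast
  have "\<kappa> = \<mu>" if \<kappa>: "\<kappa> \<in> A" "\<kappa> \<le> \<mu>" for \<kappa>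
  proof
    fix i
    have "(\<Sum>i<n. \<kappa> i) \<le> (\<Sum>i<n. \<mu> i)"
      using \<kappa>(2) by (intro sum_mono) (simp add: le_fun_def)
    then have eq: "(\<Sum>i<n. \<kappa> i) = (\<Sum>i<n. \<mu> i)"
      using min[OF \<kappa>(1)] \<kappa>(2) \<mu>(2) by (meson le_antisym order_trans)
    show "\<kappa> i = \<mu> i"
    proof (cases "i < n")
      case True
      show ?thesis
        using \<kappa>(2) True by (intro sum_mono_inv[OF eq]) (simp_all add: le_fun_def)
    next
      case False
      moreover have "\<kappa> \<in> multi_indices n" "\<mu> \<in> multi_indices n"
        using A \<kappa>(1) \<mu>(1) by blast+
      ultimately show ?thesis
        by (simp add: multi_indices_def)
    qed
  qed
  then show "\<exists>\<mu>\<in>?B. \<mu> \<le> \<nu>"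
    using \<mu> by blast
qed

section \<open>Division in Tate algebras\<close>

context na_field
begin

text \<open>A leading exponent with respect to the Gauss norm: the coefficient at \<open>e\<close>
  has the maximal absolute value, normalised to 1. Heavier coefficients are strictly smaller,
  whereas lighter ones may be equally large.\<close>

definition monic_lead :: "nat \<Rightarrow> ((nat \<Rightarrow> nat) \<Rightarrow> 'k) \<Rightarrow> (nat \<Rightarrow> nat) \<Rightarrow> bool"
  where "monic_lead n g e \<longleftrightarrow> g \<in> carrier (tate v n) \<and> e \<in> multi_indices n \<and> g e = 1 \<and>
    (\<forall>\<mu>. v (g \<mu>) \<le> 1) \<and> (\<forall>\<mu>. weight n e < weight n \<mu> \<longrightarrow> v (g \<mu>) < 1)"

lemma exists_monic_lead:
  assumes a: "a \<in> carrier (tate v n)" and "a \<mu>0 \<noteq> 0"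
  obtains e where "e \<in> multi_indices n" "a e \<noteq> 0" "monic_lead n (\<lambda>\<nu>. inverse (a e) * a \<nu>) e"
proof -
  \<comment> \<open>Coefficients at least as large as one fixed nonzero coefficient sit at finitely
    many exponents; so the maximum is attained, and among the exponents attaining it there is a
    heaviest.\<close>
  define S where "S = {\<mu>. v (a \<mu>0) \<le> v (a \<mu>)}"
  have S: "finite S" "\<mu>0 \<in> S"
    using tate_finite[OF a, of "v (a \<mu>0)"] assms(2) by (auto simp: S_def)
  define m where "m = Max ((\<lambda>\<mu>. v (a \<mu>)) ` S)"
  have m_ge: "v (a \<mu>) \<le> m" if "\<mu> \<in> S" for \<mu>
    unfolding m_def using S(1) that by (intro Max_ge) auto
  have "m \<in> (\<lambda>\<mu>. v (a \<mu>)) ` S"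
    unfolding m_def using S by (intro Max_in) auto
  define S' where "S' = {\<mu> \<in> S. v (a \<mu>) = m}"
  have S': "finite S'" "S' \<noteq> {}"
    using S(1) \<open>m \<in> _\<close> by (auto simp: S'_def)
  have "Max (weight n ` S') \<in> weight n ` S'"
    using S' by (intro Max_in) auto
  then obtain e where e: "e \<in> S'" "weight n e = Max (weight n ` S')"
    by auto
  have e_max: "weight n \<mu> \<le> weight n e" if "\<mu> \<in> S'" for \<mu>
    unfolding e(2) using S'(1) that by (intro Max_ge) auto
  have ve: "v (a e) = m"
    using e(1) by (simp add: S'_def)
  have m_pos: "0 < m"
    using m_ge[OF S(2)] assms(2) v_pos_iff[of "a \<mu>0"] by linarith
  then have ae: "a e \<noteq> 0"
    using ve by auto
  then have e_mem: "e \<in> multi_indices n"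
    using tate_supp[OF a] by blast
  have le: "v (a \<mu>) \<le> m" for \<mu>
    using m_ge[of \<mu>] m_ge[OF S(2)] by (cases "\<mu> \<in> S") (auto simp: S_def)
  have less: "v (a \<mu>) < m" if "weight n e < weight n \<mu>" for \<mu>
  proof -
    have "\<mu> \<notin> S'"
      using e_max[of \<mu>] that by auto
    then show ?thesis
      using le[of \<mu>] m_ge[OF S(2)] by (auto simp: S'_def S_def)
  qed
  have norm: "v (inverse (a e) * a \<nu>) = inverse m * v (a \<nu>)" for \<nu>
    by (simp add: mult v_inverse ve)
  have "monic_lead n (\<lambda>\<nu>. inverse (a e) * a \<nu>) e"
    unfolding monic_lead_def
  proof (intro conjI allI impI)
    show "(\<lambda>\<nu>. inverse (a e) * a \<nu>) \<in> carrier (tate v n)"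
      by (rule tate_mono[OF a _ _ na_field_axioms, of _ "inverse m"])
        (simp_all add: tate_supp[OF a] norm)
  qed (use ae e_mem le less m_pos in \<open>simp_all add: norm, simp_all add: field_simps\<close>)
  then show thesis
    using that e_mem ae by blast
qed

lemma tate_sum:
  "(\<And>i. i \<in> A \<Longrightarrow> f i \<in> carrier (tate v n)) \<Longrightarrow> (\<lambda>\<nu>. \<Sum>i\<in>A. f i \<nu>) \<in> carrier (tate v n)"
proof (induction A rule: infinite_finite_induct)
  case (insert i A)
  then show ?case
    using tate_add[of "f i" n "\<lambda>\<nu>. \<Sum>i\<in>A. f i \<nu>"] by simp
qed (simp_all add: tate_zero)

text \<open>By the ultrametric inequality, the distance to the limit is governed by the largest
  remaining step alone; no factor \<open>1 / (1 - \<rho>)\<close> of a geometric series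
  appears.\<close>

lemma geometric_limit:
  fixes s :: "nat \<Rightarrow> 'k"
  assumes step: "\<And>m. v (s (Suc m) - s m) \<le> \<rho> ^ m * r" and "0 < \<rho>" "\<rho> < 1" "0 < r"
  obtains l where "\<And>m. v (s m - l) \<le> \<rho> ^ m * r"
proof -
  have dist: "v (s (m + j) - s m) \<le> \<rho> ^ m * r" for m j
  proof (induction j)
    case 0
    then show ?case
      using assms by simp
  next
    case (Suc j)
    have "v (s (Suc (m + j)) - s (m + j)) \<le> \<rho> ^ m * r"
      using step[of "m + j"] power_decreasing[of m "m + j" \<rho>] assms
      by (meson le_add1 less_imp_le mult_right_mono order_trans)
    from v_add_le[OF this Suc] show ?case
      by simp
  qed
  have small: "\<exists>N. \<rho> ^ N * r < \<epsilon>" if "\<epsilon> > 0" for \<epsilon>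
    using real_arch_pow_inv[of "\<epsilon> / r" \<rho>] that assms by (auto simp: field_simps)
  have "\<exists>N. \<forall>m\<ge>N. \<forall>j\<ge>N. v (s m - s j) < \<epsilon>" if "\<epsilon> > 0" for \<epsilon>
  proof -
    obtain N where N: "\<rho> ^ N * r < \<epsilon>"
      using small[OF \<open>\<epsilon> > 0\<close>] by blast
    have near: "v (s m - s N) \<le> \<rho> ^ N * r" if "m \<ge> N" for m
      using dist[of N "m - N"] that by simp
    have "v (s m - s j) < \<epsilon>" if "m \<ge> N" "j \<ge> N" for m j
      using v_diff_le[OF near[OF that(1)] near[OF that(2)]] N by simp
    then show ?thesis
      by blast
  qed
  then obtain l where l: "\<And>\<epsilon>. \<epsilon> > 0 \<Longrightarrow> \<exists>N. \<forall>m\<ge>N. v (s m - l) < \<epsilon>"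
    using Cauchy_limit[of s] by blast
  have "v (s m - l) \<le> \<rho> ^ m * r" for m
  proof -
    have "0 < \<rho> ^ m * r"
      using assms by simp
    then obtain N where N: "\<And>j. j \<ge> N \<Longrightarrow> v (s j - l) < \<rho> ^ m * r"
      using l by blast
    have "v (s (m + N) - l) \<le> \<rho> ^ m * r"
      using N[of "m + N"] by simp
    from v_diff_le[OF this dist[of m N]] show ?thesis
      by simp
  qed
  then show thesis
    using that by blast
qed

end

text \<open>
  Division by \<open>G e\<close>, \<open>e \<in> B\<close>: the quotients and the remainder are both read off from a single
  series \<open>a\<close>, whose monomials above some \<open>e \<in> B\<close> are distributed among the quotients. The
  resulting map \<open>recombine\<close> is a perturbation of a unitriangular one, hence surjective.
\<close>

locale tate_division = na_field v for v :: "'k::field \<Rightarrow> real" +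
  fixes n :: nat and B :: "(nat \<Rightarrow> nat) set" and G :: "(nat \<Rightarrow> nat) \<Rightarrow> (nat \<Rightarrow> nat) \<Rightarrow> 'k"
  assumes finite_B: "finite B" and lead: "e \<in> B \<Longrightarrow> monic_lead n (G e) e"
begin

definition above :: "(nat \<Rightarrow> nat) \<Rightarrow> bool"
  where "above \<nu> \<longleftrightarrow> (\<exists>e\<in>B. e \<le> \<nu>)"

text \<open>Several members of \<open>B\<close> may lie below \<nu>; a fixed choice ensures that
  each coefficient of \<open>a\<close> is used exactly once, in one quotient or in the
  remainder.\<close>

definition sel :: "(nat \<Rightarrow> nat) \<Rightarrow> nat \<Rightarrow> nat"
  where "sel \<nu> = (SOME e. e \<in> B \<and> e \<le> \<nu>)"

lemma sel: "above \<nu> \<Longrightarrow> sel \<nu> \<in> B" "above \<nu> \<Longrightarrow> sel \<nu> \<le> \<nu>"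
  using someI_ex[of "\<lambda>e. e \<in> B \<and> e \<le> \<nu>"] unfolding above_def sel_def by blast+

definition quot :: "((nat \<Rightarrow> nat) \<Rightarrow> 'k) \<Rightarrow> (nat \<Rightarrow> nat) \<Rightarrow> (nat \<Rightarrow> nat) \<Rightarrow> 'k"
  where "quot a e \<mu> = (if sel (\<mu> + e) = e then a (\<mu> + e) else 0)"

definition rem :: "((nat \<Rightarrow> nat) \<Rightarrow> 'k) \<Rightarrow> (nat \<Rightarrow> nat) \<Rightarrow> 'k"
  where "rem a \<nu> = (if above \<nu> then 0 else a \<nu>)"

definition recombine :: "((nat \<Rightarrow> nat) \<Rightarrow> 'k) \<Rightarrow> (nat \<Rightarrow> nat) \<Rightarrow> 'k"
  where "recombine a \<nu> = (\<Sum>e\<in>B. conv (quot a e) (G e) \<nu>) + rem a \<nu>"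

lemma divisor: "e \<in> B \<Longrightarrow> G e \<in> carrier (tate v n)" "e \<in> B \<Longrightarrow> e \<in> multi_indices n"
  "e \<in> B \<Longrightarrow> G e e = 1" "e \<in> B \<Longrightarrow> v (G e \<mu>) \<le> 1"
  "e \<in> B \<Longrightarrow> weight n e < weight n \<mu> \<Longrightarrow> v (G e \<mu>) < 1"
  using lead unfolding monic_lead_def by blast+

lemma quot_closed:
  assumes "a \<in> carrier (tate v n)"
  shows "quot a e \<in> carrier (tate v n)"
proof (rule tateI)
  show "quot a e \<nu> = 0" if "\<nu> \<notin> multi_indices n" for \<nu>
    using that tate_supp[OF assms] by (simp add: quot_def multi_indices_add_iff)
next
  fix \<epsilon> :: real assume "\<epsilon> > 0"
  have "{\<nu>. \<epsilon> \<le> v (quot a e \<nu>)} \<subseteq> (\<lambda>\<mu>. \<mu> + e) -` {\<nu>. \<epsilon> \<le> v (a \<nu>)}"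
    using \<open>\<epsilon> > 0\<close> by (auto simp: quot_def split: if_splits)
  moreover have "finite ((\<lambda>\<mu>. \<mu> + e) -` {\<nu>. \<epsilon> \<le> v (a \<nu>)})"
    by (intro finite_vimageI tate_finite[OF assms \<open>\<epsilon> > 0\<close>] injI) (auto simp: fun_eq_iff)
  ultimately show "finite {\<nu>. \<epsilon> \<le> v (quot a e \<nu>)}"
    using finite_subset by blast
qed

lemma rem_closed:
  assumes "a \<in> carrier (tate v n)"
  shows "rem a \<in> carrier (tate v n)"
  by (rule tate_mono[OF assms _ _ na_field_axioms, of _ 1])
    (auto simp: rem_def tate_supp[OF assms] nonneg)

lemma recombine_diff: "recombine (\<lambda>\<nu>. a \<nu> - b \<nu>) \<nu> = recombine a \<nu> - recombine b \<nu>"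
proof -
  have "quot (\<lambda>\<nu>. a \<nu> - b \<nu>) e = (\<lambda>\<mu>. quot a e \<mu> - quot b e \<mu>)" for e
    by (auto simp: quot_def)
  then show ?thesis
    by (simp add: recombine_def rem_def conv_diff_left sum_subtractf)
qed

lemma recombine_zero: "recombine (\<lambda>_. 0) \<nu> = 0"
  using recombine_diff[of "\<lambda>_. 0" "\<lambda>_. 0" \<nu>] by simp

lemma recombine_add: "recombine (\<lambda>\<nu>. a \<nu> + b \<nu>) \<nu> = recombine a \<nu> + recombine b \<nu>"
  using recombine_diff[of "\<lambda>\<nu>. a \<nu> + b \<nu>" b \<nu>] by simp

lemma recombine_supp:
  assumes "a \<in> carrier (tate v n)" "\<nu> \<notin> multi_indices n"
  shows "recombine a \<nu> = 0"
proof -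
  have "conv (quot a e) (G e) \<nu> = 0" if "e \<in> B" for e
    using tate_supp[OF tate_conv[OF quot_closed[OF assms(1)] divisor(1)[OF that]] assms(2)] .
  then show ?thesis
    using tate_supp[OF assms] by (simp add: recombine_def rem_def)
qed

text \<open>Quotients and remainder only rearrange coefficients, and the divisors have norm at most
  1. This is the continuity of \<open>recombine\<close> that allows passing to the limit.\<close>

lemma recombine_le:
  assumes "\<And>\<nu>. v (a \<nu>) \<le> r"
  shows "v (recombine a \<nu>) \<le> r"
proof -
  have "0 \<le> r"
    using assms[of \<nu>] nonneg[of "a \<nu>"] by linarith
  have "v (quot a e \<mu>) \<le> r" for e \<mu>
    using assms \<open>0 \<le> r\<close> by (simp add: quot_def)
  then have "v (conv (quot a e) (G e) \<nu>) \<le> r" if "e \<in> B" for e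
    using conv_le[of "quot a e" r "G e" 1 \<nu>] divisor(4)[OF that] \<open>0 \<le> r\<close> by simp
  then show ?thesis
    unfolding recombine_def using assms \<open>0 \<le> r\<close>
    by (intro v_add_le v_sum_le) (simp_all add: rem_def)
qed

text \<open>A monomial at \<kappa> becomes the multiple of its divisor
  \<open>G (sel \<kappa>)\<close> that is shifted so as to have its leading exponent at
  \<kappa>.\<close>

lemma recombine_delta_above:
  assumes "above \<kappa>" "\<kappa> \<in> multi_indices n" "\<nu> \<in> multi_indices n"
  shows "recombine (\<lambda>\<mu>. if \<mu> = \<kappa> then c else 0) \<nu> =
    (if \<kappa> - sel \<kappa> \<le> \<nu> then c * G (sel \<kappa>) (\<nu> - (\<kappa> - sel \<kappa>)) else 0)"
proof -
  let ?\<delta> = "\<lambda>\<mu>. if \<mu> = \<kappa> then c else 0"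
  have "rem ?\<delta> \<nu> = 0"
    using assms(1) by (simp add: rem_def)
  moreover have "conv (quot ?\<delta> e) (G e) \<nu> = 0" if "e \<noteq> sel \<kappa>" for e
  proof -
    have "quot ?\<delta> e = (\<lambda>_. 0)"
      using that by (auto simp: quot_def)
    then show ?thesis
      by (simp add: conv_def)
  qed
  then have "(\<Sum>e\<in>B. conv (quot ?\<delta> e) (G e) \<nu>) =
      (\<Sum>e\<in>B. if e = sel \<kappa> then conv (quot ?\<delta> e) (G e) \<nu> else 0)"
    by (intro sum.cong) auto
  ultimately have "recombine ?\<delta> \<nu> = (\<Sum>e\<in>B. if e = sel \<kappa> then conv (quot ?\<delta> e) (G e) \<nu> else 0)"
    unfolding recombine_def by simp
  also have "\<dots> = conv (quot ?\<delta> (sel \<kappa>)) (G (sel \<kappa>)) \<nu>"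
    using sel(1)[OF assms(1)] finite_B by simp
  also have "quot ?\<delta> (sel \<kappa>) = (\<lambda>\<mu>. if \<mu> = \<kappa> - sel \<kappa> then c else 0)"
  proof
    fix \<mu>
    have "\<mu> + sel \<kappa> = \<kappa> \<longleftrightarrow> \<mu> = \<kappa> - sel \<kappa>"
      using index_le_add_diff[OF sel(2)[OF assms(1)]]
      by (metis add.commute add_left_cancel)
    then show "quot ?\<delta> (sel \<kappa>) \<mu> = (if \<mu> = \<kappa> - sel \<kappa> then c else 0)"
      by (auto simp: quot_def)
  qed
  also have "conv (\<lambda>\<mu>. if \<mu> = \<kappa> - sel \<kappa> then c else 0) (G (sel \<kappa>)) \<nu> =
      (if \<kappa> - sel \<kappa> \<le> \<nu> then c * G (sel \<kappa>) (\<nu> - (\<kappa> - sel \<kappa>)) else 0)"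
    by (rule conv_delta[OF multi_indices_downward[OF assms(2)] assms(3)]) (simp add: le_fun_def)
  finally show ?thesis .
qed

lemma recombine_delta_not_above:
  assumes "\<not> above \<kappa>"
  shows "recombine (\<lambda>\<mu>. if \<mu> = \<kappa> then c else 0) \<nu> = (if \<nu> = \<kappa> then c else 0)"
proof -
  have "\<mu> + e \<noteq> \<kappa>" if "e \<in> B" for e \<mu>
    using assms that unfolding above_def by (auto simp: le_fun_def)
  then have "quot (\<lambda>\<mu>. if \<mu> = \<kappa> then c else 0) e = (\<lambda>_. 0)" if "e \<in> B" for e
    using that by (auto simp: quot_def)
  then show ?thesis
    using assms by (simp add: recombine_def rem_def conv_def)
qed

text \<open>Multiplicativity of \<open>weight\<close> carries comparisons with a leading exponent
  over to the shifted divisor. So the matrix of \<open>recombine\<close> has diagonal entries 1 and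
  entries of size at most \<rho> on the heavier side; those on the lighter side are only bounded by
  1.\<close>

lemma recombine_delta:
  assumes \<kappa>: "\<kappa> \<in> multi_indices n" and \<nu>: "\<nu> \<in> multi_indices n"
    and \<rho>: "\<And>e \<mu>. e \<in> B \<Longrightarrow> weight n e < weight n \<mu> \<Longrightarrow> v (G e \<mu>) \<le> \<rho>" "0 \<le> \<rho>"
  shows "recombine (\<lambda>\<mu>. if \<mu> = \<kappa> then c else 0) \<kappa> = c"
    and "weight n \<kappa> < weight n \<nu> \<Longrightarrow> v (recombine (\<lambda>\<mu>. if \<mu> = \<kappa> then c else 0) \<nu>) \<le> \<rho> * v c"
proof -
  show "recombine (\<lambda>\<mu>. if \<mu> = \<kappa> then c else 0) \<kappa> = c"
  proof (cases "above \<kappa>")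
    case True
    have "\<kappa> - (\<kappa> - sel \<kappa>) = sel \<kappa>" "\<kappa> - sel \<kappa> \<le> \<kappa>"
      using sel(2)[OF True] by (auto simp: le_fun_def fun_eq_iff)
    then show ?thesis
      using recombine_delta_above[OF True \<kappa> \<kappa>] divisor(3)[OF sel(1)[OF True]] by simp
  qed (simp add: recombine_delta_not_above)
  assume less: "weight n \<kappa> < weight n \<nu>"
  show "v (recombine (\<lambda>\<mu>. if \<mu> = \<kappa> then c else 0) \<nu>) \<le> \<rho> * v c"
  proof (cases "above \<kappa> \<and> \<kappa> - sel \<kappa> \<le> \<nu>")
    case True
    let ?e = "sel \<kappa>"
    have "weight n (\<kappa> - ?e) * weight n ?e = weight n \<kappa>"
      using index_le_add_diff[OF sel(2), of \<kappa>] True weight_add[of n ?e "\<kappa> - ?e"] by simp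
    moreover have "weight n (\<kappa> - ?e) * weight n (\<nu> - (\<kappa> - ?e)) = weight n \<nu>"
      using index_le_add_diff[of "\<kappa> - ?e" \<nu>] True weight_add[of n "\<kappa> - ?e" "\<nu> - (\<kappa> - ?e)"] by simp
    ultimately have "weight n ?e < weight n (\<nu> - (\<kappa> - ?e))"
      using less by (metis mult_less_cancel1)
    then have "v (G ?e (\<nu> - (\<kappa> - ?e))) \<le> \<rho>"
      using \<rho>(1) sel(1) True by blast
    from mult_right_mono[OF this nonneg[of c]] show ?thesis
      using recombine_delta_above[OF _ \<kappa> \<nu>, of c] True by (simp add: mult mult.commute)
  next
    case False
    then have "recombine (\<lambda>\<mu>. if \<mu> = \<kappa> then c else 0) \<nu> = 0"
      using recombine_delta_above[OF _ \<kappa> \<nu>] recombine_delta_not_above less by (cases "above \<kappa>") auto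
    then show ?thesis
      using \<rho>(2) nonneg by simp
  qed
qed

text \<open>Induction on the weight bound. The coefficient at the only multi-index of top weight is
  cancelled by the image of a monomial. Of what this introduces, the heavier part is within
  \<open>\<rho> * r\<close> and is left as error, and the lighter part goes to the induction
  hypothesis. Errors do not accumulate, since they combine by maximum.\<close>

lemma recombine_approx_polynomial:
  assumes \<rho>: "\<And>e \<mu>. e \<in> B \<Longrightarrow> weight n e < weight n \<mu> \<Longrightarrow> v (G e \<mu>) \<le> \<rho>" "0 \<le> \<rho>"
    and "\<And>\<nu>. f \<nu> \<noteq> 0 \<Longrightarrow> \<nu> \<in> multi_indices n \<and> weight n \<nu> < N" "\<And>\<nu>. v (f \<nu>) \<le> r"
  shows "\<exists>a\<in>carrier (tate v n). (\<forall>\<nu>. v (a \<nu>) \<le> r) \<and> (\<forall>\<nu>. v (f \<nu> - recombine a \<nu>) \<le> \<rho> * r)"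
  using assms(3,4)
proof (induction N arbitrary: f)
  case 0
  then have "f \<nu> = 0" for \<nu>
    by blast
  moreover have "0 \<le> r"
    using 0(2) nonneg order_trans by blast
  ultimately show ?case
    using tate_zero \<rho>(2) by (intro bexI[of _ "\<lambda>_. 0"]) (simp_all add: recombine_zero)
next
  case (Suc N)
  have r: "0 \<le> r"
    using Suc(3) nonneg order_trans by blast
  show ?case
  proof (cases "\<exists>\<kappa>\<in>multi_indices n. weight n \<kappa> = N")
    case False
    then show ?thesis
      using Suc.prems by (intro Suc.IH) (metis less_Suc_eq)+
  next
    case True
    then obtain \<kappa> where \<kappa>: "\<kappa> \<in> multi_indices n" "weight n \<kappa> = N"
      by blast
    let ?\<delta> = "\<lambda>\<mu>. if \<mu> = \<kappa> then f \<kappa> else 0"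
    define g where "g = (\<lambda>\<nu>. f \<nu> - recombine ?\<delta> \<nu>)"
    define f' where "f' = (\<lambda>\<nu>. if weight n \<nu> < N then g \<nu> else 0)"
    have \<delta>: "?\<delta> \<in> carrier (tate v n)" "v (?\<delta> \<nu>) \<le> r" for \<nu>
      using tate_delta[OF \<kappa>(1)] Suc.prems(2) r by auto
    have g_supp: "g \<nu> = 0" if "\<nu> \<notin> multi_indices n" for \<nu>
      using Suc.prems(1)[of \<nu>] recombine_supp[OF \<delta>(1) that] that by (auto simp: g_def)
    have g_le: "v (g \<nu>) \<le> r" for \<nu>
      unfolding g_def using Suc.prems(2) recombine_le[OF \<delta>(2)] by (intro v_diff_le) auto
    have g_high: "v (g \<nu>) \<le> \<rho> * r" if "\<not> weight n \<nu> < N" for \<nu>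
    proof (cases "\<nu> \<in> multi_indices n \<and> \<nu> \<noteq> \<kappa>")
      case True
      then have "weight n \<nu> \<noteq> N"
        using weight_inject[of \<nu> n \<kappa>] \<kappa> by metis
      then have less: "weight n \<kappa> < weight n \<nu>"
        using that \<kappa>(2) by simp
      then have "f \<nu> = 0"
        using Suc.prems(1)[of \<nu>] \<kappa>(2) by fastforce
      moreover have "v (recombine ?\<delta> \<nu>) \<le> \<rho> * v (f \<kappa>)"
        using recombine_delta(2)[OF \<kappa>(1) _ \<rho> less] True by blast
      moreover have "\<rho> * v (f \<kappa>) \<le> \<rho> * r"
        using Suc.prems(2) \<rho>(2) by (intro mult_left_mono) auto
      ultimately show ?thesis
        by (simp add: g_def)
    next
      case False
      then have "g \<nu> = 0"
        using g_supp recombine_delta(1)[OF \<kappa>(1) \<kappa>(1) \<rho>] by (auto simp: g_def)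
      then show ?thesis
        using \<rho>(2) r by simp
    qed
    have "\<nu> \<in> multi_indices n \<and> weight n \<nu> < N" if "f' \<nu> \<noteq> 0" for \<nu>
      using that g_supp by (auto simp: f'_def split: if_splits)
    moreover have "v (f' \<nu>) \<le> r" for \<nu>
      using g_le r by (simp add: f'_def)
    ultimately obtain a where a: "a \<in> carrier (tate v n)" "\<And>\<nu>. v (a \<nu>) \<le> r"
      "\<And>\<nu>. v (f' \<nu> - recombine a \<nu>) \<le> \<rho> * r"
      using Suc.IH[of f'] by blast
    show ?thesis
    proof (intro bexI[of _ "\<lambda>\<nu>. a \<nu> + ?\<delta> \<nu>"] conjI allI)
      show "(\<lambda>\<nu>. a \<nu> + ?\<delta> \<nu>) \<in> carrier (tate v n)"
        by (rule tate_add[OF a(1) \<delta>(1)])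
      show "v (a \<nu> + ?\<delta> \<nu>) \<le> r" for \<nu>
        by (rule v_add_le[OF a(2) \<delta>(2)])
      fix \<nu>
      have "f \<nu> - recombine (\<lambda>\<nu>. a \<nu> + ?\<delta> \<nu>) \<nu> = (f' \<nu> - recombine a \<nu>) + (g \<nu> - f' \<nu>)"
        unfolding recombine_add by (simp add: g_def)
      moreover have "v (g \<nu> - f' \<nu>) \<le> \<rho> * r"
        using g_high[of \<nu>] \<rho>(2) r by (simp add: f'_def)
      ultimately show "v (f \<nu> - recombine (\<lambda>\<nu>. a \<nu> + ?\<delta> \<nu>) \<nu>) \<le> \<rho> * r"
        using v_add_le[OF a(3)[of \<nu>]] by metis
    qed
  qed
qed

text \<open>Dropping all coefficients below \<open>\<rho> * r\<close> costs no more than the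
  permitted error and leaves a polynomial.\<close>

lemma recombine_approx:
  assumes \<rho>: "\<And>e \<mu>. e \<in> B \<Longrightarrow> weight n e < weight n \<mu> \<Longrightarrow> v (G e \<mu>) \<le> \<rho>" "0 < \<rho>"
    and f: "f \<in> carrier (tate v n)" "\<And>\<nu>. v (f \<nu>) \<le> r" "0 < r"
  shows "\<exists>a\<in>carrier (tate v n). (\<forall>\<nu>. v (a \<nu>) \<le> r) \<and> (\<forall>\<nu>. v (f \<nu> - recombine a \<nu>) \<le> \<rho> * r)"
proof -
  define S where "S = {\<nu>. \<rho> * r \<le> v (f \<nu>)}"
  define f' where "f' = (\<lambda>\<nu>. if \<nu> \<in> S then f \<nu> else 0)"
  have S: "finite S"
    unfolding S_def using tate_finite[OF f(1)] \<rho>(2) f(3) by simp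
  have "\<nu> \<in> multi_indices n \<and> weight n \<nu> < Suc (Max (weight n ` S))" if "f' \<nu> \<noteq> 0" for \<nu>
  proof -
    have "\<nu> \<in> S" "f \<nu> \<noteq> 0"
      using that by (auto simp: f'_def split: if_splits)
    then show ?thesis
      using tate_supp[OF f(1)] S by (auto simp: less_Suc_eq_le)
  qed
  moreover have "v (f' \<nu>) \<le> r" for \<nu>
    using f(2,3) by (simp add: f'_def)
  ultimately obtain a where a: "a \<in> carrier (tate v n)" "\<And>\<nu>. v (a \<nu>) \<le> r"
    "\<And>\<nu>. v (f' \<nu> - recombine a \<nu>) \<le> \<rho> * r"
    using recombine_approx_polynomial[of \<rho> f' "Suc (Max (weight n ` S))" r] \<rho> by fastforce
  have "v (f \<nu> - f' \<nu>) \<le> \<rho> * r" for \<nu>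
    using \<rho>(2) f(3) by (auto simp: f'_def S_def)
  then have "v (f \<nu> - recombine a \<nu>) \<le> \<rho> * r" for \<nu>
    using v_add_le[OF _ a(3), of "f \<nu> - f' \<nu>" \<nu>] by simp
  then show ?thesis
    using a by blast
qed

text \<open>There are finitely many divisors, each with finitely many coefficients of size at least
  1/2, so the sizes below 1 have a maximum or stay under 1/2. The value 1/2 is an arbitrary number
  strictly between 0 and 1.\<close>

lemma uniform_bound:
  obtains \<rho> where "0 < \<rho>" "\<rho> < 1" "\<And>e \<mu>. e \<in> B \<Longrightarrow> weight n e < weight n \<mu> \<Longrightarrow> v (G e \<mu>) \<le> \<rho>"
proof
  define U where "U = (\<Union>e\<in>B. (\<lambda>\<mu>. v (G e \<mu>)) ` {\<mu>. 1 / 2 \<le> v (G e \<mu>)})"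
  let ?S = "insert (1 / 2) {x \<in> U. x < 1}"
  have "finite U"
    unfolding U_def by (intro finite_UN_I finite_B finite_imageI tate_finite[OF divisor(1)]) auto
  then have fin: "finite ?S"
    by simp
  show "Max ?S < 1"
    using fin by (subst Max_less_iff) auto
  have half: "1 / 2 \<le> Max ?S"
    using fin by (intro Max_ge) auto
  then show "0 < Max ?S"
    by linarith
  fix e \<mu> assume e: "e \<in> B" "weight n e < weight n \<mu>"
  show "v (G e \<mu>) \<le> Max ?S"
  proof (cases "1 / 2 \<le> v (G e \<mu>)")
    case True
    then show ?thesis
      using divisor(5)[OF e] e(1) fin by (intro Max_ge) (auto simp: U_def)
  qed (use half in linarith)
qed

text \<open>Each round shrinks the error by the factor \<rho>, and a correction is no larger than
  the error it repairs, so the approximations converge. They do so uniformly over all exponents,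
  which puts the limit into the Tate algebra.\<close>

lemma recombine_surj:
  assumes f: "f \<in> carrier (tate v n)"
  obtains a where "a \<in> carrier (tate v n)" "recombine a = f"
proof -
  obtain \<rho> where \<rho>: "0 < \<rho>" "\<rho> < 1" "\<And>e \<mu>. e \<in> B \<Longrightarrow> weight n e < weight n \<mu> \<Longrightarrow> v (G e \<mu>) \<le> \<rho>"
    using uniform_bound by blast
  obtain r where r: "0 < r" "\<And>\<nu>. v (f \<nu>) \<le> r"
    using tate_bounded[OF f] by blast
  define P where "P = (\<lambda>m a. a \<in> carrier (tate v n) \<and> (\<forall>\<nu>. v (f \<nu> - recombine a \<nu>) \<le> \<rho> ^ m * r))"
  have "\<exists>a. P 0 a"
    using r(2) tate_zero by (intro exI[of _ "\<lambda>_. 0"]) (simp add: P_def recombine_zero)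
  moreover have "\<exists>a'. P (Suc m) a' \<and> (\<forall>\<nu>. v (a' \<nu> - a \<nu>) \<le> \<rho> ^ m * r)" if a: "P m a" for m a
  proof -
    have "(\<lambda>\<nu>. \<Sum>e\<in>B. conv (quot a e) (G e) \<nu>) \<in> carrier (tate v n)"
      using a by (intro tate_sum tate_conv quot_closed divisor(1)) (simp_all add: P_def)
    then have "recombine a \<in> carrier (tate v n)"
      using tate_add[OF _ rem_closed] a unfolding recombine_def[abs_def] P_def by blast
    then have "(\<lambda>\<nu>. f \<nu> - recombine a \<nu>) \<in> carrier (tate v n)"
      by (rule tate_diff[OF f])
    then obtain b where b: "b \<in> carrier (tate v n)" "\<And>\<nu>. v (b \<nu>) \<le> \<rho> ^ m * r"
      "\<And>\<nu>. v (f \<nu> - recombine a \<nu> - recombine b \<nu>) \<le> \<rho> * (\<rho> ^ m * r)"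
      using recombine_approx[OF \<rho>(3,1), of "\<lambda>\<nu>. f \<nu> - recombine a \<nu>" "\<rho> ^ m * r"] a \<rho>(1) r(1)
      unfolding P_def by auto
    show ?thesis
    proof (intro exI[of _ "\<lambda>\<nu>. a \<nu> + b \<nu>"] conjI allI)
      show "P (Suc m) (\<lambda>\<nu>. a \<nu> + b \<nu>)"
        using tate_add[of a n b] a b unfolding P_def recombine_add by (simp add: diff_diff_add mult.assoc)
    qed (use b(2) in simp)
  qed
  ultimately obtain A where A: "\<And>m. P m (A m)" "\<And>m \<nu>. v (A (Suc m) \<nu> - A m \<nu>) \<le> \<rho> ^ m * r"
    using dependent_nat_choice[of P "\<lambda>m a a'. \<forall>\<nu>. v (a' \<nu> - a \<nu>) \<le> \<rho> ^ m * r"] by blast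
  have "\<exists>l. \<forall>m. v (A m \<nu> - l) \<le> \<rho> ^ m * r" for \<nu>
    by (rule geometric_limit[of "\<lambda>m. A m \<nu>" \<rho> r, OF A(2) \<rho>(1,2) r(1)]) blast
  then obtain a where a: "\<And>m \<nu>. v (A m \<nu> - a \<nu>) \<le> \<rho> ^ m * r"
    by metis
  have small: "\<exists>m. \<rho> ^ m * r < \<epsilon>" if "\<epsilon> > 0" for \<epsilon>
    using real_arch_pow_inv[of "\<epsilon> / r" \<rho>] that \<rho>(2) r(1) by (auto simp: field_simps)
  have eq_0: "x = 0" if "\<And>m. v x \<le> \<rho> ^ m * r" for x
  proof (rule ccontr)
    assume "x \<noteq> 0"
    then obtain m where "\<rho> ^ m * r < v x"
      using small[of "v x"] by auto
    then show False
      using that[of m] by simp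
  qed
  have a_mem: "a \<in> carrier (tate v n)"
  proof (rule tateI)
    show "a \<nu> = 0" if "\<nu> \<notin> multi_indices n" for \<nu>
    proof (rule eq_0)
      fix m
      have "A m \<nu> = 0"
        using A(1)[of m] tate_supp[OF _ that] by (simp add: P_def)
      then show "v (a \<nu>) \<le> \<rho> ^ m * r"
        using a[of m \<nu>] by simp
    qed
  next
    fix \<epsilon> :: real assume "\<epsilon> > 0"
    then obtain m where m: "\<rho> ^ m * r < \<epsilon>"
      using small by blast
    have "{\<nu>. \<epsilon> \<le> v (a \<nu>)} \<subseteq> {\<nu>. \<epsilon> \<le> v (A m \<nu>)}"
    proof
      fix \<nu> assume "\<nu> \<in> {\<nu>. \<epsilon> \<le> v (a \<nu>)}"
      moreover have "v (a \<nu>) \<le> max (v (A m \<nu>)) (v (A m \<nu> - a \<nu>))"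
        using v_diff[of "A m \<nu>" "A m \<nu> - a \<nu>"] by simp
      ultimately show "\<nu> \<in> {\<nu>. \<epsilon> \<le> v (A m \<nu>)}"
        using a[of m \<nu>] m by simp
    qed
    moreover have "finite {\<nu>. \<epsilon> \<le> v (A m \<nu>)}"
      using A(1)[of m] tate_finite[OF _ \<open>\<epsilon> > 0\<close>] unfolding P_def by blast
    ultimately show "finite {\<nu>. \<epsilon> \<le> v (a \<nu>)}"
      using finite_subset by blast
  qed
  have "f \<nu> - recombine a \<nu> = 0" for \<nu>
  proof (rule eq_0)
    fix m
    have "v (recombine (A m) \<nu> - recombine a \<nu>) \<le> \<rho> ^ m * r"
      using recombine_le[of "\<lambda>\<nu>. A m \<nu> - a \<nu>", OF a] by (simp add: recombine_diff)
    moreover have "v (f \<nu> - recombine (A m) \<nu>) \<le> \<rho> ^ m * r"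
      using A(1)[of m] by (simp add: P_def)
    ultimately show "v (f \<nu> - recombine a \<nu>) \<le> \<rho> ^ m * r"
      using v_add_le[of "f \<nu> - recombine (A m) \<nu>" _ "recombine (A m) \<nu> - recombine a \<nu>"] by simp
  qed
  then have "recombine a = f"
    by (auto simp: fun_eq_iff)
  then show thesis
    using that a_mem by blast
qed

lemma division:
  assumes "f \<in> carrier (tate v n)"
  obtains q h where "\<And>e. q e \<in> carrier (tate v n)" "h \<in> carrier (tate v n)"
    "\<And>e \<nu>. e \<in> B \<Longrightarrow> e \<le> \<nu> \<Longrightarrow> h \<nu> = 0"
    "\<And>\<nu>. f \<nu> = (\<Sum>e\<in>B. conv (q e) (G e) \<nu>) + h \<nu>"
proof -
  obtain a where a: "a \<in> carrier (tate v n)" "recombine a = f"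
    using recombine_surj[OF assms] by blast
  show thesis
  proof
    show "quot a e \<in> carrier (tate v n)" "rem a \<in> carrier (tate v n)" for e
      by (rule quot_closed[OF a(1)], rule rem_closed[OF a(1)])
    show "rem a \<nu> = 0" if "e \<in> B" "e \<le> \<nu>" for e \<nu>
      using that by (auto simp: rem_def above_def)
    show "f \<nu> = (\<Sum>e\<in>B. conv (quot a e) (G e) \<nu>) + rem a \<nu>" for \<nu>
      by (simp add: recombine_def flip: a(2))
  qed
qed

end

section \<open>Tensor products and trace modules\<close>

lemma free_carrier_diff:
  "x \<in> carrier (free_Abelian_group S) \<Longrightarrow> y \<in> carrier (free_Abelian_group S) \<Longrightarrow>
    x - y \<in> carrier (free_Abelian_group S)"
  using keys_diff[of x y] by auto

lemma free_carrier_add: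
  "x \<in> carrier (free_Abelian_group S) \<Longrightarrow> y \<in> carrier (free_Abelian_group S) \<Longrightarrow>
    x + y \<in> carrier (free_Abelian_group S)"
  using keys_add[of x y] by auto

lemma free_carrier_sum_list:
  "(\<And>x. x \<in> set xs \<Longrightarrow> x \<in> carrier (free_Abelian_group S)) \<Longrightarrow>
    sum_list xs \<in> carrier (free_Abelian_group S)"
proof (induction xs)
  case (Cons a xs)
  then show ?case
    using free_carrier_add[of a S "sum_list xs"] by (simp del: carrier_free_Abelian_group_iff)
qed simp

lemma linear_mapsD:
  assumes "f \<in> linear_maps R M N"
  shows "x \<in> carrier M \<Longrightarrow> f x \<in> carrier N"
    and "x \<in> carrier M \<Longrightarrow> y \<in> carrier M \<Longrightarrow> f (x \<oplus>\<^bsub>M\<^esub> y) = f x \<oplus>\<^bsub>N\<^esub> f y"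
    and "r \<in> carrier R \<Longrightarrow> x \<in> carrier M \<Longrightarrow> f (r \<odot>\<^bsub>M\<^esub> x) = r \<odot>\<^bsub>N\<^esub> f x"
  using assms unfolding linear_maps_def by auto

lemma linear_maps_zero:
  assumes "abelian_group M" "abelian_group N" "f \<in> linear_maps R M N"
  shows "f \<zero>\<^bsub>M\<^esub> = \<zero>\<^bsub>N\<^esub>"
proof -
  interpret M: abelian_group M by fact
  interpret N: abelian_group N by fact
  have "f \<zero>\<^bsub>M\<^esub> \<oplus>\<^bsub>N\<^esub> f \<zero>\<^bsub>M\<^esub> = f \<zero>\<^bsub>M\<^esub> \<oplus>\<^bsub>N\<^esub> \<zero>\<^bsub>N\<^esub>" "f \<zero>\<^bsub>M\<^esub> \<in> carrier N"
    using linear_mapsD[OF assms(3)] by (metis M.l_zero M.zero_closed N.r_zero)+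
  then show ?thesis
    using N.add.l_cancel by blast
qed

lemma linear_maps_minus:
  assumes "abelian_group M" "abelian_group N" "f \<in> linear_maps R M N"
    "x \<in> carrier M" "y \<in> carrier M"
  shows "f (x \<ominus>\<^bsub>M\<^esub> y) = f x \<ominus>\<^bsub>N\<^esub> f y"
proof -
  interpret M: abelian_group M by fact
  interpret N: abelian_group N by fact
  have "f (\<ominus>\<^bsub>M\<^esub> y) \<oplus>\<^bsub>N\<^esub> f y = \<zero>\<^bsub>N\<^esub>"
    using linear_mapsD(2)[OF assms(3), of "\<ominus>\<^bsub>M\<^esub> y" y] linear_maps_zero[OF assms(1-3)] assms(5)
    by (simp add: M.l_neg)
  then have "f (\<ominus>\<^bsub>M\<^esub> y) = \<ominus>\<^bsub>N\<^esub> f y"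
    using linear_mapsD(1)[OF assms(3)] assms(5) by (metis M.a_inv_closed N.minus_equality)
  then show ?thesis
    using linear_mapsD(2)[OF assms(3)] assms(4,5) by (simp add: a_minus_def)
qed

locale tensor_pair = M?: Module.module R M + N: Module.module R N
  for R (structure) and M (structure) and N
begin

abbreviation F where "F \<equiv> free_Abelian_group (carrier M \<times> carrier N)"
abbreviation T where "T \<equiv> tensor_relations R M N"

lemma relations_subgroup: "subgroup T F"
  unfolding tensor_relations_def
proof (rule group.generate_is_subgroup[OF group_free_Abelian_group], safe)
  show "frag_of (x \<oplus>\<^bsub>M\<^esub> x', y) - frag_of (x, y) - frag_of (x', y) \<in> carrier F"
    if "x \<in> carrier M" "x' \<in> carrier M" "y \<in> carrier N" for x x' y
    using that by (intro free_carrier_diff) auto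
  show "frag_of (x, y \<oplus>\<^bsub>N\<^esub> y') - frag_of (x, y) - frag_of (x, y') \<in> carrier F"
    if "x \<in> carrier M" "y \<in> carrier N" "y' \<in> carrier N" for x y y'
    using that by (intro free_carrier_diff) auto
  show "frag_of (r \<odot>\<^bsub>M\<^esub> x, y) - frag_of (x, r \<odot>\<^bsub>N\<^esub> y) \<in> carrier F"
    if "r \<in> carrier R" "x \<in> carrier M" "y \<in> carrier N" for r x y
    using that by (intro free_carrier_diff) auto
qed

lemma relations_carrier: "t \<in> T \<Longrightarrow> t \<in> carrier F"
  using subgroup.subset[OF relations_subgroup] by blast

lemma relations_zero: "0 \<in> T"
  using subgroup.one_closed[OF relations_subgroup] by simp

lemma relations_add: "s \<in> T \<Longrightarrow> t \<in> T \<Longrightarrow> s + t \<in> T"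
  using subgroup.m_closed[OF relations_subgroup] by simp

lemma relations_uminus: "t \<in> T \<Longrightarrow> - t \<in> T"
  using subgroup.m_inv_closed[OF relations_subgroup, of t] relations_carrier[of t] by simp

lemma relations_diff: "s \<in> T \<Longrightarrow> t \<in> T \<Longrightarrow> s - t \<in> T"
  using relations_add[OF _ relations_uminus] by fastforce

lemma relations_left:
  "x \<in> carrier M \<Longrightarrow> x' \<in> carrier M \<Longrightarrow> y \<in> carrier N \<Longrightarrow>
    frag_of (x \<oplus>\<^bsub>M\<^esub> x', y) - frag_of (x, y) - frag_of (x', y) \<in> T"
  unfolding tensor_relations_def by (rule generate.incl) blast

lemma relations_right:
  "x \<in> carrier M \<Longrightarrow> y \<in> carrier N \<Longrightarrow> y' \<in> carrier N \<Longrightarrow>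
    frag_of (x, y \<oplus>\<^bsub>N\<^esub> y') - frag_of (x, y) - frag_of (x, y') \<in> T"
  unfolding tensor_relations_def by (rule generate.incl) blast

lemma relations_balanced:
  "r \<in> carrier R \<Longrightarrow> x \<in> carrier M \<Longrightarrow> y \<in> carrier N \<Longrightarrow>
    frag_of (r \<odot>\<^bsub>M\<^esub> x, y) - frag_of (x, r \<odot>\<^bsub>N\<^esub> y) \<in> T"
  unfolding tensor_relations_def by (rule generate.incl) blast

lemma relations_zero_left: "y \<in> carrier N \<Longrightarrow> frag_of (\<zero>\<^bsub>M\<^esub>, y) \<in> T"
  using relations_left[of "\<zero>\<^bsub>M\<^esub>" "\<zero>\<^bsub>M\<^esub>" y] relations_uminus by fastforce

lemma relations_zero_right: "x \<in> carrier M \<Longrightarrow> frag_of (x, \<zero>\<^bsub>N\<^esub>) \<in> T"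
  using relations_right[of x "\<zero>\<^bsub>N\<^esub>" "\<zero>\<^bsub>N\<^esub>"] relations_uminus by fastforce

lemma relations_minus_right:
  assumes "x \<in> carrier M" "y \<in> carrier N" "y' \<in> carrier N"
  shows "frag_of (x, y \<ominus>\<^bsub>N\<^esub> y') - (frag_of (x, y) - frag_of (x, y')) \<in> T"
proof -
  have "(y \<ominus>\<^bsub>N\<^esub> y') \<oplus>\<^bsub>N\<^esub> y' = y"
    using assms by (simp add: a_minus_def N.a_assoc N.l_neg)
  then have "frag_of (x, y) - frag_of (x, y \<ominus>\<^bsub>N\<^esub> y') - frag_of (x, y') \<in> T"
    using relations_right[of x "y \<ominus>\<^bsub>N\<^esub> y'" y'] assms by simp
  from relations_uminus[OF this] show ?thesis
    by (simp add: algebra_simps)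
qed

text \<open>The map \<open>h \<otimes> 1 : M \<otimes> N \<rightarrow> N\<close> of a linear form \<open>h\<close> on \<open>M\<close>, on representatives.\<close>

definition contraction :: "('c \<Rightarrow> 'a) \<Rightarrow> ('c \<times> 'e \<Rightarrow>\<^sub>0 int) \<Rightarrow> 'e"
  where "contraction h = (SOME c. c \<in> hom F (add_monoid N) \<and>
    (\<forall>x\<in>carrier M. \<forall>y\<in>carrier N. c (frag_of (x, y)) = h x \<odot>\<^bsub>N\<^esub> y))"

context
  fixes h
  assumes h: "h \<in> linear_maps R M (ring_as_module R (\<lambda>r. r))"
begin

lemma form_closed: "x \<in> carrier M \<Longrightarrow> h x \<in> carrier R"
  using linear_mapsD(1)[OF h] by (simp add: ring_as_module_def)

lemma form_add: "x \<in> carrier M \<Longrightarrow> y \<in> carrier M \<Longrightarrow> h (x \<oplus>\<^bsub>M\<^esub> y) = h x \<oplus>\<^bsub>R\<^esub> h y"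
  using linear_mapsD(2)[OF h] by (simp add: ring_as_module_def)

lemma form_smult: "r \<in> carrier R \<Longrightarrow> x \<in> carrier M \<Longrightarrow> h (r \<odot>\<^bsub>M\<^esub> x) = r \<otimes>\<^bsub>R\<^esub> h x"
  using linear_mapsD(3)[OF h] by (simp add: ring_as_module_def)

lemma contraction_hom: "contraction h \<in> hom F (add_monoid N)"
  and contraction_frag_of:
    "x \<in> carrier M \<Longrightarrow> y \<in> carrier N \<Longrightarrow> contraction h (frag_of (x, y)) = h x \<odot>\<^bsub>N\<^esub> y"
proof -
  have "(\<lambda>(x, y). h x \<odot>\<^bsub>N\<^esub> y) ` (carrier M \<times> carrier N) \<subseteq> carrier (add_monoid N)"
    using form_closed by auto
  then obtain c where "c \<in> hom F (add_monoid N)"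
    "\<And>p. p \<in> carrier M \<times> carrier N \<Longrightarrow> c (frag_of p) = (\<lambda>(x, y). h x \<odot>\<^bsub>N\<^esub> y) p"
    using comm_group.free_Abelian_group_universal[OF N.a_comm_group]
    by metis
  then have "\<exists>c. c \<in> hom F (add_monoid N) \<and>
      (\<forall>x\<in>carrier M. \<forall>y\<in>carrier N. c (frag_of (x, y)) = h x \<odot>\<^bsub>N\<^esub> y)"
    by (intro exI[of _ c]) auto
  from someI_ex[OF this] show "contraction h \<in> hom F (add_monoid N)"
    "x \<in> carrier M \<Longrightarrow> y \<in> carrier N \<Longrightarrow> contraction h (frag_of (x, y)) = h x \<odot>\<^bsub>N\<^esub> y"
    unfolding contraction_def by blast+
qed

lemma contraction_closed: "z \<in> carrier F \<Longrightarrow> contraction h z \<in> carrier N"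
  using hom_in_carrier[OF contraction_hom] by simp

lemma contraction_group_hom: "group_hom F (add_monoid N) (contraction h)"
  using contraction_hom N.a_group by (simp add: group_hom_def group_hom_axioms_def)

lemma contraction_zero: "contraction h 0 = \<zero>\<^bsub>N\<^esub>"
  using group_hom.hom_one[OF contraction_group_hom] by simp

lemma contraction_add:
  "z \<in> carrier F \<Longrightarrow> z' \<in> carrier F \<Longrightarrow> contraction h (z + z') = contraction h z \<oplus>\<^bsub>N\<^esub> contraction h z'"
  using group_hom.hom_mult[OF contraction_group_hom, of z z'] by simp

lemma contraction_diff:
  assumes "z \<in> carrier F" "z' \<in> carrier F"
  shows "contraction h (z - z') = contraction h z \<ominus>\<^bsub>N\<^esub> contraction h z'"
proof -
  have "contraction h (z - z') \<oplus>\<^bsub>N\<^esub> contraction h z' = contraction h z"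
    using contraction_add[OF free_carrier_diff[OF assms] assms(2)] by simp
  then show ?thesis
    using contraction_closed assms free_carrier_diff[OF assms]
    by (metis N.add.inv_closed N.a_assoc N.r_neg N.r_zero a_minus_def)
qed

text \<open>The contraction is thereby well defined on the tensor product. For the balancing
  relations the reason is commutativity of \<open>R\<close>: the scalars \<open>r\<close> and
  \<open>h x\<close> may be applied in either order.\<close>

lemma contraction_relations:
  assumes "t \<in> T"
  shows "contraction h t = \<zero>\<^bsub>N\<^esub>"
proof -
  let ?K = "kernel F (add_monoid N) (contraction h)"
  have K: "z \<in> ?K \<longleftrightarrow> z \<in> carrier F \<and> contraction h z = \<zero>\<^bsub>N\<^esub>" for z
    by (auto simp: kernel_def)
  have "T \<subseteq> ?K"
    unfolding tensor_relations_def
  proof (rule group.generate_subgroup_incl[OF group_free_Abelian_group], safe)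
    fix x x' y assume *: "x \<in> carrier M" "x' \<in> carrier M" "y \<in> carrier N"
    then have **: "frag_of (x \<oplus>\<^bsub>M\<^esub> x', y) \<in> carrier F" "frag_of (x, y) \<in> carrier F" "frag_of (x', y) \<in> carrier F"
      by auto
    show "frag_of (x \<oplus>\<^bsub>M\<^esub> x', y) - frag_of (x, y) - frag_of (x', y) \<in> ?K"
      unfolding K
    proof
      show "frag_of (x \<oplus>\<^bsub>M\<^esub> x', y) - frag_of (x, y) - frag_of (x', y) \<in> carrier F"
        by (intro free_carrier_diff **)
      have "contraction h (frag_of (x \<oplus>\<^bsub>M\<^esub> x', y) - frag_of (x, y) - frag_of (x', y)) =
        (h x \<oplus>\<^bsub>R\<^esub> h x') \<odot>\<^bsub>N\<^esub> y \<ominus>\<^bsub>N\<^esub> h x \<odot>\<^bsub>N\<^esub> y \<ominus>\<^bsub>N\<^esub> h x' \<odot>\<^bsub>N\<^esub> y"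
        using * ** by (simp add: contraction_diff free_carrier_diff contraction_frag_of form_add
            del: carrier_free_Abelian_group_iff)
      also have "\<dots> = \<zero>\<^bsub>N\<^esub>"
        using * form_closed
        by (simp add: N.smult_l_distr a_minus_def N.a_ac N.r_neg N.r_neg1 N.r_neg2)
      finally show "contraction h (frag_of (x \<oplus>\<^bsub>M\<^esub> x', y) - frag_of (x, y) - frag_of (x', y)) = \<zero>\<^bsub>N\<^esub>" .
    qed
  next
    fix x y y' assume *: "x \<in> carrier M" "y \<in> carrier N" "y' \<in> carrier N"
    then have **: "frag_of (x, y \<oplus>\<^bsub>N\<^esub> y') \<in> carrier F" "frag_of (x, y) \<in> carrier F" "frag_of (x, y') \<in> carrier F"
      by auto
    show "frag_of (x, y \<oplus>\<^bsub>N\<^esub> y') - frag_of (x, y) - frag_of (x, y') \<in> ?K"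
      unfolding K
    proof
      show "frag_of (x, y \<oplus>\<^bsub>N\<^esub> y') - frag_of (x, y) - frag_of (x, y') \<in> carrier F"
        by (intro free_carrier_diff **)
      have "contraction h (frag_of (x, y \<oplus>\<^bsub>N\<^esub> y') - frag_of (x, y) - frag_of (x, y')) =
        h x \<odot>\<^bsub>N\<^esub> (y \<oplus>\<^bsub>N\<^esub> y') \<ominus>\<^bsub>N\<^esub> h x \<odot>\<^bsub>N\<^esub> y \<ominus>\<^bsub>N\<^esub> h x \<odot>\<^bsub>N\<^esub> y'"
        using * ** by (simp add: contraction_diff free_carrier_diff contraction_frag_of
            del: carrier_free_Abelian_group_iff)
      also have "\<dots> = \<zero>\<^bsub>N\<^esub>"
        using * form_closed
        by (simp add: N.smult_r_distr a_minus_def N.a_ac N.r_neg N.r_neg1 N.r_neg2)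
      finally show "contraction h (frag_of (x, y \<oplus>\<^bsub>N\<^esub> y') - frag_of (x, y) - frag_of (x, y')) = \<zero>\<^bsub>N\<^esub>" .
    qed
  next
    fix r x y assume *: "r \<in> carrier R" "x \<in> carrier M" "y \<in> carrier N"
    then have **: "frag_of (r \<odot>\<^bsub>M\<^esub> x, y) \<in> carrier F" "frag_of (x, r \<odot>\<^bsub>N\<^esub> y) \<in> carrier F"
      by auto
    show "frag_of (r \<odot>\<^bsub>M\<^esub> x, y) - frag_of (x, r \<odot>\<^bsub>N\<^esub> y) \<in> ?K"
      unfolding K
    proof
      show "frag_of (r \<odot>\<^bsub>M\<^esub> x, y) - frag_of (x, r \<odot>\<^bsub>N\<^esub> y) \<in> carrier F"
        by (intro free_carrier_diff **)
      have "contraction h (frag_of (r \<odot>\<^bsub>M\<^esub> x, y) - frag_of (x, r \<odot>\<^bsub>N\<^esub> y)) =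
        (r \<otimes>\<^bsub>R\<^esub> h x) \<odot>\<^bsub>N\<^esub> y \<ominus>\<^bsub>N\<^esub> h x \<odot>\<^bsub>N\<^esub> (r \<odot>\<^bsub>N\<^esub> y)"
        using * ** by (simp add: contraction_diff contraction_frag_of form_smult
            del: carrier_free_Abelian_group_iff)
      also have "\<dots> = \<zero>\<^bsub>N\<^esub>"
        using * form_closed by (simp add: R.m_comm[of r] N.smult_assoc1 a_minus_def N.r_neg)
      finally show "contraction h (frag_of (r \<odot>\<^bsub>M\<^esub> x, y) - frag_of (x, r \<odot>\<^bsub>N\<^esub> y)) = \<zero>\<^bsub>N\<^esub>" .
    qed
  qed (rule group_hom.subgroup_kernel[OF contraction_group_hom])
  then show ?thesis
    using assms K by blast
qed

end

end

section \<open>Induced maps, and exactness on representatives\<close>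

definition induced :: "('c \<Rightarrow> 'd) \<Rightarrow> ('b \<times> 'c \<Rightarrow>\<^sub>0 int) \<Rightarrow> ('b \<times> 'd \<Rightarrow>\<^sub>0 int)"
  where "induced f = frag_extend (\<lambda>(x, y). frag_of (x, f y))"

lemma induced_simps [simp]:
  "induced f 0 = 0" "induced f (frag_of (x, y)) = frag_of (x, f y)"
  "induced f (- z) = - induced f z" "induced f (z + z') = induced f z + induced f z'"
  "induced f (z - z') = induced f z - induced f z'"
  by (simp_all add: induced_def frag_extend_minus frag_extend_add frag_extend_diff)

lemma induced_carrier:
  assumes f: "\<And>y. y \<in> carrier N \<Longrightarrow> f y \<in> carrier N'"
    and z: "z \<in> carrier (free_Abelian_group (carrier M \<times> carrier N))"
  shows "induced f z \<in> carrier (free_Abelian_group (carrier M \<times> carrier N'))"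
proof -
  have "Poly_Mapping.keys z \<subseteq> carrier M \<times> carrier N"
    using z by simp
  then show ?thesis
  proof (induction z rule: frag_induction)
    case (diff a b)
    then show ?case
      using free_carrier_diff by (simp del: carrier_free_Abelian_group_iff)
  qed (use f in auto)
qed

context tensor_pair
begin

lemma coset_eq_iff:
  assumes "z \<in> carrier F" "z' \<in> carrier F"
  shows "T #>\<^bsub>F\<^esub> z = T #>\<^bsub>F\<^esub> z' \<longleftrightarrow> z - z' \<in> T"
proof -
  have coset: "T #>\<^bsub>F\<^esub> u = (\<lambda>t. t + u) ` T" for u
    by (auto simp: r_coset_def)
  show ?thesis
  proof
    assume "T #>\<^bsub>F\<^esub> z = T #>\<^bsub>F\<^esub> z'"
    then have "z \<in> (\<lambda>t. t + z') ` T"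
      using relations_zero unfolding coset by force
    then show "z - z' \<in> T"
      by auto
  next
    assume *: "z - z' \<in> T"
    show "T #>\<^bsub>F\<^esub> z = T #>\<^bsub>F\<^esub> z'"
      unfolding coset
    proof (intro equalityI subsetI)
      fix u assume "u \<in> (\<lambda>t. t + z) ` T"
      then obtain t where "t \<in> T" "u = (t + (z - z')) + z'"
        by auto
      then show "u \<in> (\<lambda>t. t + z') ` T"
        using relations_add[OF _ *] by blast
    next
      fix u assume "u \<in> (\<lambda>t. t + z') ` T"
      then obtain t where "t \<in> T" "u = (t - (z - z')) + z"
        by auto
      then show "u \<in> (\<lambda>t. t + z) ` T"
        using relations_diff[OF _ *] by blast
    qed
  qed
qed

lemma coset_eq_one_iff: "z \<in> carrier F \<Longrightarrow> T #>\<^bsub>F\<^esub> z = T \<longleftrightarrow> z \<in> T"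
  using coset_eq_iff[of z 0] group.coset_mult_one[OF group_free_Abelian_group, of T "carrier M \<times> carrier N"]
    relations_carrier by (auto simp: subset_iff)

lemma carrier_tensor: "carrier (tensor R M N) = (\<lambda>z. T #>\<^bsub>F\<^esub> z) ` carrier F"
  by (auto simp: tensor_def FactGroup_def RCOSETS_def)

lemma one_tensor: "\<one>\<^bsub>tensor R M N\<^esub> = T"
  by (simp add: tensor_def FactGroup_def)

end

lemma induced_relations:
  assumes "Module.module R M" "Module.module R N" "Module.module R N'" and f: "f \<in> linear_maps R N N'"
    and "t \<in> tensor_relations R M N"
  shows "induced f t \<in> tensor_relations R M N'"
proof -
  interpret P: tensor_pair R M N using assms by (simp add: tensor_pair_def)
  interpret Q: tensor_pair R M N' using assms by (simp add: tensor_pair_def)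
  note f = linear_mapsD[OF f]
  show ?thesis
    using assms(5) unfolding tensor_relations_def[of R M N]
  proof (induction rule: generate.induct)
    case one
    then show ?case
      using Q.relations_zero by simp
  next
    case (incl h)
    then show ?case
      using f Q.relations_left Q.relations_right Q.relations_balanced by auto
  next
    case (inv h)
    then have "h \<in> tensor_relations R M N"
      unfolding tensor_relations_def by (rule generate.incl)
    then have "inv\<^bsub>free_Abelian_group (carrier M \<times> carrier N)\<^esub> h = - h"
      using P.relations_carrier by simp
    moreover have "induced f h \<in> tensor_relations R M N'"
      using inv f Q.relations_left Q.relations_right Q.relations_balanced by auto
    ultimately show ?case
      using Q.relations_uminus by simp
  next
    case (eng h h')
    then show ?case
      using Q.relations_add by simp
  qed
qed

lemma tensor_map_coset:
  assumes "Module.module R M" "Module.module R N" "Module.module R N'" and f: "f \<in> linear_maps R N N'"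
    and z: "z \<in> carrier (free_Abelian_group (carrier M \<times> carrier N))"
  shows "tensor_map R M N' f (tensor_relations R M N #>\<^bsub>free_Abelian_group (carrier M \<times> carrier N)\<^esub> z) =
    tensor_relations R M N' #>\<^bsub>free_Abelian_group (carrier M \<times> carrier N')\<^esub> induced f z"
proof -
  interpret P: tensor_pair R M N using assms by (simp add: tensor_pair_def)
  interpret Q: tensor_pair R M N' using assms by (simp add: tensor_pair_def)
  have carr: "induced f u \<in> carrier Q.F" if "u \<in> carrier P.F" for u
    using induced_carrier[OF linear_mapsD(1)[OF f] that] .
  have "Q.T #>\<^bsub>Q.F\<^esub> induced f c = Q.T #>\<^bsub>Q.F\<^esub> induced f z" if "c \<in> P.T #>\<^bsub>P.F\<^esub> z" for c
  proof -
    from that obtain t where t: "t \<in> P.T" "c = t + z"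
      by (auto simp: r_coset_def)
    then have "c \<in> carrier P.F"
      using free_carrier_add[OF P.relations_carrier[OF t(1)] z] by simp
    moreover have "induced f c - induced f z \<in> Q.T"
      using induced_relations[OF assms(1-4) t(1)] t(2) by simp
    ultimately show ?thesis
      using Q.coset_eq_iff carr z by blast
  qed
  moreover have "z \<in> P.T #>\<^bsub>P.F\<^esub> z"
    using P.relations_zero by (force simp: r_coset_def)
  ultimately show ?thesis
    unfolding tensor_map_def induced_def[symmetric] by blast
qed

text \<open>Exactness is rephrased for representatives, as vanishing of the composite and lifting of
  kernel elements modulo the relations. Cosets and the union in \<open>tensor_map\<close> disappear
  from the flatness argument.\<close>

lemma tensor_exact_iff:
  fixes N1 :: "('a, 'c, 'r1) module_scheme" and N2 :: "('a, 'd, 'r2) module_scheme"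
    and N3 :: "('a, 'e, 'r3) module_scheme"
  assumes M: "Module.module R M" and N: "Module.module R N1" "Module.module R N2" "Module.module R N3"
    and f: "f \<in> linear_maps R N1 N2" and g: "g \<in> linear_maps R N2 N3"
  shows "tensor_map R M N2 f ` carrier (tensor R M N1) =
      kernel (tensor R M N2) (tensor R M N3) (tensor_map R M N3 g) \<longleftrightarrow>
    (\<forall>z\<in>carrier (free_Abelian_group (carrier M \<times> carrier N1)).
      induced g (induced f z) \<in> tensor_relations R M N3) \<and>
    (\<forall>z\<in>carrier (free_Abelian_group (carrier M \<times> carrier N2)).
      induced g z \<in> tensor_relations R M N3 \<longrightarrow>
      (\<exists>z'\<in>carrier (free_Abelian_group (carrier M \<times> carrier N1)).
        z - induced f z' \<in> tensor_relations R M N2))"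
    (is "?L \<longleftrightarrow> ?A \<and> ?B")
proof -
  interpret P1: tensor_pair R M N1 using assms by (simp add: tensor_pair_def)
  interpret P2: tensor_pair R M N2 using assms by (simp add: tensor_pair_def)
  interpret P3: tensor_pair R M N3 using assms by (simp add: tensor_pair_def)
  have fc: "induced f u \<in> carrier P2.F" if "u \<in> carrier P1.F" for u
    using induced_carrier[OF linear_mapsD(1)[OF f] that] .
  have gc: "induced g u \<in> carrier P3.F" if "u \<in> carrier P2.F" for u
    using induced_carrier[OF linear_mapsD(1)[OF g] that] .
  let ?q1 = "\<lambda>z. P1.T #>\<^bsub>P1.F\<^esub> z" and ?q2 = "\<lambda>z. P2.T #>\<^bsub>P2.F\<^esub> z" and ?q3 = "\<lambda>z. P3.T #>\<^bsub>P3.F\<^esub> z"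
  have im: "tensor_map R M N2 f ` carrier (tensor R M N1) = (\<lambda>z. ?q2 (induced f z)) ` carrier P1.F"
    unfolding P1.carrier_tensor image_image
    using tensor_map_coset[OF M N(1,2) f] by (intro image_cong refl)
  have gz: "tensor_map R M N3 g (?q2 z) = P3.T \<longleftrightarrow> induced g z \<in> P3.T" if "z \<in> carrier P2.F" for z
    using tensor_map_coset[OF M N(2,3) g that] P3.coset_eq_one_iff[OF gc[OF that]] by simp
  have ker: "kernel (tensor R M N2) (tensor R M N3) (tensor_map R M N3 g) =
      ?q2 ` {z \<in> carrier P2.F. induced g z \<in> P3.T}"
    unfolding kernel_def P2.carrier_tensor P3.one_tensor using gz by blast
  show ?thesis
    unfolding im ker
  proof (intro iffI conjI ballI impI)
    assume L: "(\<lambda>z. ?q2 (induced f z)) ` carrier P1.F = ?q2 ` {z \<in> carrier P2.F. induced g z \<in> P3.T}"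
    fix z assume z: "z \<in> carrier P1.F"
    then obtain u where u: "?q2 (induced f z) = ?q2 u" "u \<in> carrier P2.F" "induced g u \<in> P3.T"
      using L by blast
    have "induced g (induced f z) - induced g u \<in> P3.T"
      using induced_relations[OF M N(2,3) g] u(1) P2.coset_eq_iff[OF fc[OF z] u(2)]
      by (metis induced_simps(5))
    then show "induced g (induced f z) \<in> P3.T"
      using P3.relations_add[OF _ u(3)] by fastforce
  next
    assume L: "(\<lambda>z. ?q2 (induced f z)) ` carrier P1.F = ?q2 ` {z \<in> carrier P2.F. induced g z \<in> P3.T}"
    fix z assume z: "z \<in> carrier P2.F" "induced g z \<in> P3.T"
    then have "?q2 z \<in> (\<lambda>z. ?q2 (induced f z)) ` carrier P1.F"
      unfolding L by blast
    then obtain u where "u \<in> carrier P1.F" "?q2 z = ?q2 (induced f u)"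
      by blast
    then show "\<exists>z'\<in>carrier P1.F. z - induced f z' \<in> P2.T"
      using P2.coset_eq_iff[OF z(1) fc] by blast
  next
    assume AB: "?A \<and> ?B"
    show "(\<lambda>z. ?q2 (induced f z)) ` carrier P1.F = ?q2 ` {z \<in> carrier P2.F. induced g z \<in> P3.T}"
    proof (intro equalityI subsetI)
      fix C assume "C \<in> (\<lambda>z. ?q2 (induced f z)) ` carrier P1.F"
      then show "C \<in> ?q2 ` {z \<in> carrier P2.F. induced g z \<in> P3.T}"
        using AB fc by blast
    next
      fix C assume "C \<in> ?q2 ` {z \<in> carrier P2.F. induced g z \<in> P3.T}"
      then obtain z where z: "z \<in> carrier P2.F" "induced g z \<in> P3.T" "C = ?q2 z"
        by blast
      then obtain z' where "z' \<in> carrier P1.F" "z - induced f z' \<in> P2.T"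
        using AB by blast
      then show "C \<in> (\<lambda>z. ?q2 (induced f z)) ` carrier P1.F"
        using P2.coset_eq_iff[OF z(1) fc] z(3) by blast
    qed
  qed
qed

text \<open>Naturality of contraction, checked on generators. Since contraction kills relations, the
  contractions of an element killed by \<open>1 \<otimes> f\<close> are killed by
  \<open>f\<close>.\<close>

lemma (in tensor_pair) contraction_induced:
  assumes N': "Module.module R N'" and f: "f \<in> linear_maps R N N'"
    and h: "h \<in> linear_maps R M (ring_as_module R (\<lambda>r. r))" and z: "z \<in> carrier F"
  shows "tensor_pair.contraction M N' h (induced f z) = f (contraction h z)"
proof -
  interpret Q: tensor_pair R M N' using N' by (simp add: tensor_pair_def M.module_axioms)
  have "Poly_Mapping.keys z \<subseteq> carrier M \<times> carrier N"
    using z by simp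
  then show ?thesis
  proof (rule free_Abelian_group_induct)
    show "Q.contraction h (induced f 0) = f (contraction h 0)"
      using linear_maps_zero[OF N.abelian_group_axioms Q.N.abelian_group_axioms f]
        contraction_zero[OF h] Q.contraction_zero[OF h] by simp
  next
    fix p assume "p \<in> carrier M \<times> carrier N"
    then show "Q.contraction h (induced f (frag_of p)) = f (contraction h (frag_of p))"
      using linear_mapsD[OF f] contraction_frag_of[OF h] Q.contraction_frag_of[OF h] form_closed[OF h]
      by auto
  next
    fix a b assume keys: "Poly_Mapping.keys a \<subseteq> carrier M \<times> carrier N" "Poly_Mapping.keys b \<subseteq> carrier M \<times> carrier N"
      and eq: "Q.contraction h (induced f a) = f (contraction h a)"
        "Q.contraction h (induced f b) = f (contraction h b)"
    then have ab: "a \<in> carrier F" "b \<in> carrier F"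
      by simp_all
    have "induced f a \<in> carrier Q.F" "induced f b \<in> carrier Q.F"
      using induced_carrier[of N f N' _ M, OF linear_mapsD(1)[OF f]] ab by blast+
    then show "Q.contraction h (induced f (a - b)) = f (contraction h (a - b))"
      using ab eq contraction_diff[OF h] Q.contraction_diff[OF h] contraction_closed[OF h]
        linear_maps_minus[OF N.abelian_group_axioms Q.N.abelian_group_axioms f]
      by (simp del: carrier_free_Abelian_group_iff)
  qed
qed

text \<open>Encoded by a list of vectors and forms rather than as a property of a map: concatenation
  adds such endomorphisms, mapping the vectors composes them with another one, and the forms remain
  available for contracting tensors.\<close>

primrec finite_rank :: "('a, 'b, 'q) module_scheme \<Rightarrow> ('b \<times> ('b \<Rightarrow> 'a)) list \<Rightarrow> 'b \<Rightarrow> 'b"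
  where "finite_rank M [] x = \<zero>\<^bsub>M\<^esub>"
  | "finite_rank M (p # J) x = snd p x \<odot>\<^bsub>M\<^esub> fst p \<oplus>\<^bsub>M\<^esub> finite_rank M J x"

abbreviation linear_forms :: "('a, 'p) ring_scheme \<Rightarrow> ('a, 'b, 'q) module_scheme \<Rightarrow> ('b \<Rightarrow> 'a) set"
  where "linear_forms R M \<equiv> linear_maps R M (ring_as_module R (\<lambda>r. r))"

context Module.module
begin

lemma finite_rank_linear:
  assumes "set J \<subseteq> carrier M \<times> linear_forms R M"
  shows "finite_rank M J \<in> linear_maps R M M"
  using assms
proof (induction J)
  case Nil
  then show ?case
    by (auto simp: linear_maps_def)
next
  case (Cons p J)
  then have p: "fst p \<in> carrier M" "snd p \<in> linear_forms R M"
    and IH: "finite_rank M J \<in> linear_maps R M M"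
    by auto
  note h = linear_mapsD[OF p(2), unfolded ring_as_module_def, simplified]
  note u = linear_mapsD[OF IH]
  show ?case
    unfolding linear_maps_def
  proof (intro CollectI conjI ballI Pi_I)
    show "finite_rank M (p # J) x \<in> carrier M" if "x \<in> carrier M" for x
      using that h(1) u(1) p(1) by simp
    show "finite_rank M (p # J) (x \<oplus>\<^bsub>M\<^esub> y) = finite_rank M (p # J) x \<oplus>\<^bsub>M\<^esub> finite_rank M (p # J) y"
      if "x \<in> carrier M" "y \<in> carrier M" for x y
      using that h u p(1) by (simp add: smult_l_distr M.a_ac)
    show "finite_rank M (p # J) (r \<odot>\<^bsub>M\<^esub> x) = r \<odot>\<^bsub>M\<^esub> finite_rank M (p # J) x"
      if "r \<in> carrier R" "x \<in> carrier M" for r x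
      using that h u p(1) by (simp add: smult_assoc1 smult_r_distr)
  qed
qed

lemma finite_rank_append:
  assumes "set J \<subseteq> carrier M \<times> linear_forms R M" "set K \<subseteq> carrier M \<times> linear_forms R M" "x \<in> carrier M"
  shows "finite_rank M (J @ K) x = finite_rank M J x \<oplus>\<^bsub>M\<^esub> finite_rank M K x"
  using assms
proof (induction J)
  case Nil
  then show ?case
    using linear_mapsD(1)[OF finite_rank_linear[OF Nil(2)]] by simp
next
  case (Cons p J)
  then have "snd p x \<odot>\<^bsub>M\<^esub> fst p \<in> carrier M" "finite_rank M J x \<in> carrier M" "finite_rank M K x \<in> carrier M"
    using linear_mapsD(1)[OF finite_rank_linear, of J] linear_mapsD(1)[OF finite_rank_linear, of K]
      linear_mapsD(1)[of "snd p" R M "ring_as_module R (\<lambda>r. r)" x]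
    by (auto simp: ring_as_module_def)
  then show ?case
    using Cons by (simp add: M.a_assoc)
qed

lemma finite_rank_map:
  assumes "set J \<subseteq> carrier M \<times> linear_forms R M" "u \<in> linear_maps R M M" "x \<in> carrier M"
  shows "finite_rank M (map (\<lambda>(m, h). (u m, h)) J) x = u (finite_rank M J x)"
  using assms
proof (induction J)
  case Nil
  then show ?case
    using linear_maps_zero[OF M.abelian_group_axioms M.abelian_group_axioms assms(2)] by simp
next
  case (Cons p J)
  then have "snd p x \<in> carrier R" "fst p \<in> carrier M" "finite_rank M J x \<in> carrier M"
    using linear_mapsD(1)[OF finite_rank_linear, of J]
      linear_mapsD(1)[of "snd p" R M "ring_as_module R (\<lambda>r. r)" x]
    by (auto simp: ring_as_module_def)
  then show ?case
    using Cons linear_mapsD[OF assms(2)] by (simp add: case_prod_unfold)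
qed

text \<open>Elements of the trace ideal are values \<open>h x\<close>, so a member of its product
  with \<open>M\<close> is the value at \<open>x\<close> of a finite-rank endomorphism; inverses are
  absorbed by negating vectors. For \<open>y = x\<close>, the trace condition says that
  \<open>x\<close> is fixed by such an endomorphism.\<close>

lemma ideal_smult_trace_finite_rank:
  assumes "x \<in> carrier M" "y \<in> ideal_smult (trace_ideal R M x) M"
  obtains J where "set J \<subseteq> carrier M \<times> linear_forms R M" "finite_rank M J x = y"
proof -
  have mono: "h x \<in> carrier R" if "h \<in> linear_forms R M" for h
    using linear_mapsD(1)[OF that assms(1)] by (simp add: ring_as_module_def)
  have "\<exists>J. set J \<subseteq> carrier M \<times> linear_forms R M \<and> finite_rank M J x = y"
    using assms(2) unfolding ideal_smult_def
  proof (induction rule: generate.induct)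
    case one
    then show ?case
      by (intro exI[of _ "[]"]) simp
  next
    case (incl y)
    then obtain h m where "h \<in> linear_forms R M" "m \<in> carrier M" "y = h x \<odot>\<^bsub>M\<^esub> m"
      unfolding trace_ideal_def by blast
    then show ?case
      using mono by (intro exI[of _ "[(m, h)]"]) simp
  next
    case (inv y)
    then obtain h m where *: "h \<in> linear_forms R M" "m \<in> carrier M" "y = h x \<odot>\<^bsub>M\<^esub> m"
      unfolding trace_ideal_def by blast
    moreover from this have "inv\<^bsub>add_monoid M\<^esub> y = h x \<odot>\<^bsub>M\<^esub> (\<ominus>\<^bsub>M\<^esub> m)"
      using mono by (simp add: smult_r_minus a_inv_def[symmetric])
    ultimately show ?case
      using mono by (intro exI[of _ "[(\<ominus>\<^bsub>M\<^esub> m, h)]"]) simp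
  next
    case (eng y y')
    then obtain J J' where "set J \<subseteq> carrier M \<times> linear_forms R M" "finite_rank M J x = y"
      "set J' \<subseteq> carrier M \<times> linear_forms R M" "finite_rank M J' x = y'"
      by blast
    then show ?case
      using finite_rank_append[of J J' x] assms(1) by (intro exI[of _ "J @ J'"]) simp
  qed
  then show thesis
    using that by blast
qed

text \<open>
  If \<open>u\<close> fixes the elements of \<open>A\<close> and \<open>u'\<close> fixes \<open>x - u x\<close>, then \<open>u + u' - u' u\<close> fixes
  \<open>A\<close> and \<open>x\<close>.
\<close>

lemma ohm_rush_trace_finite_rank:
  assumes ort: "ohm_rush_trace R M" and "finite A" "A \<subseteq> carrier M"
  obtains J where "set J \<subseteq> carrier M \<times> linear_forms R M" "\<And>x. x \<in> A \<Longrightarrow> finite_rank M J x = x"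
proof -
  have "\<exists>J. set J \<subseteq> carrier M \<times> linear_forms R M \<and> (\<forall>x\<in>A. finite_rank M J x = x)"
    using assms(2,3)
  proof (induction A rule: finite_induct)
    case empty
    then show ?case
      by (intro exI[of _ "[]"]) simp
  next
    case (insert x A)
    then obtain J where J: "set J \<subseteq> carrier M \<times> linear_forms R M" "\<And>y. y \<in> A \<Longrightarrow> finite_rank M J y = y"
      by blast
    have x: "x \<in> carrier M"
      using insert by blast
    define u where "u = finite_rank M J"
    have u: "u \<in> linear_maps R M M"
      unfolding u_def by (rule finite_rank_linear[OF J(1)])
    have ux: "x \<ominus>\<^bsub>M\<^esub> u x \<in> carrier M"
      using linear_mapsD(1)[OF u] x by simp
    then have "x \<ominus>\<^bsub>M\<^esub> u x \<in> ideal_smult (trace_ideal R M (x \<ominus>\<^bsub>M\<^esub> u x)) M"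
      using ort unfolding ohm_rush_trace_def by blast
    then obtain J' where J': "set J' \<subseteq> carrier M \<times> linear_forms R M"
      "finite_rank M J' (x \<ominus>\<^bsub>M\<^esub> u x) = x \<ominus>\<^bsub>M\<^esub> u x"
      using ideal_smult_trace_finite_rank[OF ux] by metis
    define u' where "u' = finite_rank M J'"
    have u': "u' \<in> linear_maps R M M"
      unfolding u'_def by (rule finite_rank_linear[OF J'(1)])
    define d where "d = (\<lambda>m. m \<ominus>\<^bsub>M\<^esub> u' m)"
    have d: "d \<in> linear_maps R M M"
      unfolding linear_maps_def
    proof (intro CollectI conjI ballI Pi_I)
      show "d y \<in> carrier M" if "y \<in> carrier M" for y
        using that linear_mapsD(1)[OF u'] by (simp add: d_def)
      show "d (y \<oplus>\<^bsub>M\<^esub> z) = d y \<oplus>\<^bsub>M\<^esub> d z" if "y \<in> carrier M" "z \<in> carrier M" for y z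
        using that linear_mapsD(1,2)[OF u'] by (simp add: d_def a_minus_def M.minus_add M.a_ac)
      show "d (r \<odot>\<^bsub>M\<^esub> y) = r \<odot>\<^bsub>M\<^esub> d y" if "r \<in> carrier R" "y \<in> carrier M" for r y
        using that linear_mapsD(1,3)[OF u'] by (simp add: d_def a_minus_def smult_r_distr smult_r_minus)
    qed
    \<comment> \<open>\<open>u + u' - u' u = (1 - u') u + u'\<close>: composing \<open>u\<close>
      with \<open>d = 1 - u'\<close> acts on the vectors in \<open>J\<close>, and appending
      \<open>J'\<close> adds \<open>u'\<close>.\<close>
    define K where "K = map (\<lambda>(m, h). (d m, h)) J @ J'"
    have K: "set K \<subseteq> carrier M \<times> linear_forms R M"
      using J(1) J'(1) linear_mapsD(1)[OF d] unfolding K_def by auto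
    have K_eq: "finite_rank M K y = d (u y) \<oplus>\<^bsub>M\<^esub> u' y" if "y \<in> carrier M" for y
      using finite_rank_append[of "map (\<lambda>(m, h). (d m, h)) J" J' y] finite_rank_map[OF J(1) d that]
        K J'(1) that unfolding K_def u_def u'_def by simp
    have "finite_rank M K y = y" if "y \<in> A" for y
    proof -
      have y: "y \<in> carrier M" "u y = y" "u' y \<in> carrier M"
        using that insert(4) J(2) linear_mapsD(1)[OF u'] by (auto simp: u_def)
      then show ?thesis
        by (simp add: K_eq d_def a_minus_def M.a_assoc M.l_neg)
    qed
    moreover have "finite_rank M K x = x"
    proof -
      have c: "u x \<in> carrier M" "u' x \<in> carrier M" "u' (u x) \<in> carrier M"
        using x linear_mapsD(1)[OF u] linear_mapsD(1)[OF u'] by auto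
      have "u' x \<ominus>\<^bsub>M\<^esub> u' (u x) = x \<ominus>\<^bsub>M\<^esub> u x"
        using J'(2) linear_maps_minus[OF M.abelian_group_axioms M.abelian_group_axioms u' x c(1)]
        by (simp add: u'_def)
      moreover have "d (u x) \<oplus>\<^bsub>M\<^esub> u' x = u x \<oplus>\<^bsub>M\<^esub> (u' x \<ominus>\<^bsub>M\<^esub> u' (u x))"
        using c by (simp add: d_def a_minus_def M.a_ac)
      moreover have "u x \<oplus>\<^bsub>M\<^esub> (x \<ominus>\<^bsub>M\<^esub> u x) = x"
        using c x by (simp add: a_minus_def M.a_ac M.r_neg M.r_neg1 M.r_neg2)
      ultimately show ?thesis
        using K_eq[OF x] by simp
    qed
    ultimately show ?case
      using K by blast
  qed
  then show thesis
    using that by blast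
qed

end

section \<open>Recovering tensors from their contractions\<close>

context tensor_pair
begin

lemma finite_rank_relations:
  assumes J: "set J \<subseteq> carrier M \<times> linear_forms R M" and x: "x \<in> carrier M" "y \<in> carrier N"
  shows "frag_of (finite_rank M J x, y) -
    (\<Sum>(m, h)\<leftarrow>J. frag_of (m, h x \<odot>\<^bsub>N\<^esub> y)) \<in> T"
  using J
proof (induction J)
  case Nil
  then show ?case
    using relations_zero_left x by simp
next
  case (Cons p J)
  obtain m h where p: "p = (m, h)"
    by (cases p)
  have m: "m \<in> carrier M" "h \<in> linear_forms R M" "h x \<in> carrier R"
    using Cons.prems form_closed[of h] x by (auto simp: p)
  have J: "finite_rank M J x \<in> carrier M"
    using linear_mapsD(1)[OF finite_rank_linear, of J x] Cons.prems x by simp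
  have "frag_of (h x \<odot>\<^bsub>M\<^esub> m \<oplus>\<^bsub>M\<^esub> finite_rank M J x, y) - frag_of (h x \<odot>\<^bsub>M\<^esub> m, y) -
      frag_of (finite_rank M J x, y) \<in> T"
    using m J x by (intro relations_left) auto
  moreover have "frag_of (h x \<odot>\<^bsub>M\<^esub> m, y) - frag_of (m, h x \<odot>\<^bsub>N\<^esub> y) \<in> T"
    using m x by (intro relations_balanced) auto
  moreover have "frag_of (finite_rank M J x, y) - (\<Sum>(m, h)\<leftarrow>J. frag_of (m, h x \<odot>\<^bsub>N\<^esub> y)) \<in> T"
    using Cons by simp
  ultimately have "(frag_of (h x \<odot>\<^bsub>M\<^esub> m \<oplus>\<^bsub>M\<^esub> finite_rank M J x, y) - frag_of (h x \<odot>\<^bsub>M\<^esub> m, y) -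
      frag_of (finite_rank M J x, y)) + (frag_of (h x \<odot>\<^bsub>M\<^esub> m, y) - frag_of (m, h x \<odot>\<^bsub>N\<^esub> y)) +
      (frag_of (finite_rank M J x, y) - (\<Sum>(m, h)\<leftarrow>J. frag_of (m, h x \<odot>\<^bsub>N\<^esub> y))) \<in> T"
    by (intro relations_add)
  then show ?case
    by (simp add: p algebra_simps)
qed

text \<open>An element whose left components are all fixed is determined, modulo the relations, by
  its contractions with the forms in \<open>J\<close>. This turns a question about the tensor
  product into finitely many questions about \<open>N\<close>.\<close>

lemma finite_rank_contraction:
  assumes J: "set J \<subseteq> carrier M \<times> linear_forms R M" and z: "z \<in> carrier F"
    and fixed: "\<And>x. x \<in> fst ` Poly_Mapping.keys z \<Longrightarrow> finite_rank M J x = x"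
  shows "z - (\<Sum>(m, h)\<leftarrow>J. frag_of (m, contraction h z)) \<in> T"
proof -
  \<comment> \<open>The induction over generators runs inside this set, so that the left components
    remain fixed in all intermediate elements.\<close>
  define S where "S = {p \<in> carrier M \<times> carrier N. finite_rank M J (fst p) = fst p}"
  have SF: "u \<in> carrier F" if "Poly_Mapping.keys u \<subseteq> S" for u
    using that unfolding S_def by auto
  have forms: "m \<in> carrier M" "h \<in> linear_forms R M" if "(m, h) \<in> set J" for m h
    using that J by auto
  have "Poly_Mapping.keys z \<subseteq> S"
    using z fixed unfolding S_def by auto
  then show ?thesis
  proof (rule free_Abelian_group_induct)
    have "(\<Sum>(m, h)\<leftarrow>J'. frag_of (m, contraction h 0)) \<in> T" if "set J' \<subseteq> set J" for J'
      using that
    proof (induction J')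
      case (Cons p J')
      then show ?case
        using forms contraction_zero relations_zero_right by (cases p) (auto intro!: relations_add)
    qed (simp add: relations_zero)
    from relations_uminus[OF this[OF subset_refl]]
    show "0 - (\<Sum>(m, h)\<leftarrow>J. frag_of (m, contraction h 0)) \<in> T"
      by simp
  next
    fix p assume "p \<in> S"
    then obtain x y where p: "p = (x, y)" "x \<in> carrier M" "y \<in> carrier N" "finite_rank M J x = x"
      unfolding S_def by auto
    have "(\<Sum>(m, h)\<leftarrow>J. frag_of (m, contraction h (frag_of p))) = (\<Sum>(m, h)\<leftarrow>J. frag_of (m, h x \<odot>\<^bsub>N\<^esub> y))"
      using forms p contraction_frag_of by (intro arg_cong[where f = sum_list] map_cong) auto
    then show "frag_of p - (\<Sum>(m, h)\<leftarrow>J. frag_of (m, contraction h (frag_of p))) \<in> T"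
      using finite_rank_relations[OF J p(2,3)] p(4) by (simp add: p(1))
  next
    fix a b assume ab: "Poly_Mapping.keys a \<subseteq> S" "Poly_Mapping.keys b \<subseteq> S"
      and IH: "a - (\<Sum>(m, h)\<leftarrow>J. frag_of (m, contraction h a)) \<in> T"
        "b - (\<Sum>(m, h)\<leftarrow>J. frag_of (m, contraction h b)) \<in> T"
    \<comment> \<open>\<open>frag_of (m, y)\<close> is additive in \<open>y\<close> only modulo the
      relations, so the sums are compared entry by entry. The induction is over a separate list
      \<open>J'\<close>, which leaves the facts on \<open>J\<close> intact.\<close>
    have "(\<Sum>(m, h)\<leftarrow>J'. frag_of (m, contraction h a)) - (\<Sum>(m, h)\<leftarrow>J'. frag_of (m, contraction h b)) -
        (\<Sum>(m, h)\<leftarrow>J'. frag_of (m, contraction h (a - b))) \<in> T" if "set J' \<subseteq> set J" for J'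
      using that
    proof (induction J')
      case (Cons p J')
      obtain m h where p: "p = (m, h)"
        by (cases p)
      have "m \<in> carrier M" "h \<in> linear_forms R M"
        using Cons.prems forms p by auto
      then have "frag_of (m, contraction h (a - b)) -
          (frag_of (m, contraction h a) - frag_of (m, contraction h b)) \<in> T"
        using relations_minus_right[of m "contraction h a" "contraction h b"] contraction_closed SF ab
        by (simp add: contraction_diff del: carrier_free_Abelian_group_iff)
      from relations_diff[OF Cons.IH this] Cons.prems show ?case
        by (simp add: p algebra_simps)
    qed (simp add: relations_zero)
    from relations_add[OF relations_diff[OF IH] this[OF subset_refl]]
    show "a - b - (\<Sum>(m, h)\<leftarrow>J. frag_of (m, contraction h (a - b))) \<in> T"
      by (simp add: algebra_simps)
  qed
qed

end

section \<open>Faithful flatness of trace modules\<close>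

lemma induced_zero_relations:
  assumes "Module.module R M" "Module.module R N" and f: "\<And>y. y \<in> carrier N' \<Longrightarrow> f y = \<zero>\<^bsub>N\<^esub>"
    and z: "z \<in> carrier (free_Abelian_group (carrier M \<times> carrier N'))"
  shows "induced f z \<in> tensor_relations R M N"
proof -
  interpret P: tensor_pair R M N using assms by (simp add: tensor_pair_def)
  have "Poly_Mapping.keys z \<subseteq> carrier M \<times> carrier N'"
    using z by simp
  then show ?thesis
    by (induction z rule: frag_induction)
      (use f P.relations_zero P.relations_zero_right P.relations_diff in auto)
qed

text \<open>A kernel element is lifted contraction by contraction and reassembled with the vectors
  in \<open>J\<close>. For the converse, the passage from \<open>y\<close> to
  \<open>e \<otimes> y\<close> is undone by contracting with \<open>s\<close>, so exactness descends
  from the tensored sequence.\<close>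

lemma ohm_rush_trace_split_faithfully_flat:
  fixes M :: "('a, 'b, 'q) module_scheme"
  assumes ort: "ohm_rush_trace R M" and s: "s \<in> linear_forms R M" and e: "e \<in> carrier M" "s e = \<one>\<^bsub>R\<^esub>"
  shows "faithfully_flat TYPE('c) TYPE('d) TYPE('e) R M"
  unfolding faithfully_flat_def
proof (intro conjI allI impI)
  show M: "Module.module R M"
    using ort by (simp add: ohm_rush_trace_def)
  fix N1 :: "('a, 'c) module" and N2 :: "('a, 'd) module" and N3 :: "('a, 'e) module" and f g
  assume "Module.module R N1 \<and> Module.module R N2 \<and> Module.module R N3 \<and>
    f \<in> linear_maps R N1 N2 \<and> g \<in> linear_maps R N2 N3"
  then have N: "Module.module R N1" "Module.module R N2" "Module.module R N3"
    and f: "f \<in> linear_maps R N1 N2" and g: "g \<in> linear_maps R N2 N3"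
    by auto
  interpret P1: tensor_pair R M N1 using M N by (simp add: tensor_pair_def)
  interpret P2: tensor_pair R M N2 using M N by (simp add: tensor_pair_def)
  interpret P3: tensor_pair R M N3 using M N by (simp add: tensor_pair_def)
  note fc = linear_mapsD(1)[OF f] and gc = linear_mapsD(1)[OF g]
  have ker: "y \<in> a_kernel N2 N3 g \<longleftrightarrow> y \<in> carrier N2 \<and> g y = \<zero>\<^bsub>N3\<^esub>" for y
    by (auto simp: a_kernel_def kernel_def)
  show "f ` carrier N1 = a_kernel N2 N3 g \<longleftrightarrow>
       tensor_map R M N2 f ` carrier (tensor R M N1) =
         kernel (tensor R M N2) (tensor R M N3) (tensor_map R M N3 g)"
    unfolding tensor_exact_iff[OF M N f g]
  proof (intro iffI conjI ballI impI)
    assume ex: "f ` carrier N1 = a_kernel N2 N3 g"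
    fix z assume z: "z \<in> carrier P1.F"
    have "induced (g \<circ> f) z \<in> P3.T"
      using ex ker by (intro induced_zero_relations[OF M N(3) _ z]) auto
    moreover have "induced g (induced f z) = induced (g \<circ> f) z"
      unfolding induced_def
      using frag_extend_compose[of "\<lambda>(x, y). frag_of (x, g y)" "\<lambda>(x, y). (x, f y)" z]
      by (simp add: case_prod_unfold o_def)
    ultimately show "induced g (induced f z) \<in> P3.T"
      by simp
  next
    assume ex: "f ` carrier N1 = a_kernel N2 N3 g"
    fix z assume z: "z \<in> carrier P2.F" "induced g z \<in> P3.T"
    have "finite (fst ` Poly_Mapping.keys z)" "fst ` Poly_Mapping.keys z \<subseteq> carrier M"
      using z(1) by auto
    then obtain J where J: "set J \<subseteq> carrier M \<times> linear_forms R M"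
      "\<And>x. x \<in> fst ` Poly_Mapping.keys z \<Longrightarrow> finite_rank M J x = x"
      using P1.ohm_rush_trace_finite_rank[OF ort] by metis
    have "\<exists>w\<in>carrier N1. f w = P2.contraction h z" if h: "h \<in> linear_forms R M" for h
    proof -
      have "g (P2.contraction h z) = \<zero>\<^bsub>N3\<^esub>"
        using P2.contraction_induced[OF N(3) g h z(1)] P3.contraction_relations[OF h z(2)] by simp
      then have "P2.contraction h z \<in> a_kernel N2 N3 g"
        using ker P2.contraction_closed[OF h z(1)] by simp
      then show ?thesis
        unfolding ex[symmetric] by (metis imageE)
    qed
    then obtain W where W: "\<And>h. h \<in> linear_forms R M \<Longrightarrow> W h \<in> carrier N1"
      "\<And>h. h \<in> linear_forms R M \<Longrightarrow> f (W h) = P2.contraction h z"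
      by metis
    let ?z' = "\<Sum>(m, h)\<leftarrow>J. frag_of (m, W h)"
    have "?z' \<in> carrier P1.F"
      using J(1) W(1) by (intro free_carrier_sum_list) auto
    moreover have "induced f ?z' = (\<Sum>(m, h)\<leftarrow>J. frag_of (m, P2.contraction h z))"
      using J(1)
    proof (induction J)
      case (Cons p J)
      then show ?case
        using W(2) by (cases p) auto
    qed simp
    ultimately show "\<exists>z'\<in>carrier P1.F. z - induced f z' \<in> P2.T"
      using P2.finite_rank_contraction[OF J(1) z(1) J(2)] by (intro bexI[of _ ?z']) simp_all
  next
    assume AB: "(\<forall>z\<in>carrier P1.F. induced g (induced f z) \<in> P3.T) \<and>
      (\<forall>z\<in>carrier P2.F. induced g z \<in> P3.T \<longrightarrow> (\<exists>z'\<in>carrier P1.F. z - induced f z' \<in> P2.T))"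
    show "f ` carrier N1 = a_kernel N2 N3 g"
    proof (intro equalityI subsetI)
      fix y assume "y \<in> f ` carrier N1"
      then obtain x where x: "x \<in> carrier N1" "y = f x"
        by blast
      then have "frag_of (e, x) \<in> carrier P1.F"
        using e by simp
      then have "frag_of (e, g y) \<in> P3.T"
        using AB x(2) by fastforce
      then have "s e \<odot>\<^bsub>N3\<^esub> g y = \<zero>\<^bsub>N3\<^esub>"
        using P3.contraction_relations[OF s] P3.contraction_frag_of[OF s e(1)] gc fc x by metis
      then show "y \<in> a_kernel N2 N3 g"
        using ker e(2) gc fc x by simp
    next
      fix y assume "y \<in> a_kernel N2 N3 g"
      then have y: "y \<in> carrier N2" "g y = \<zero>\<^bsub>N3\<^esub>"
        using ker by auto
      have z: "frag_of (e, y) \<in> carrier P2.F"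
        using e y by simp
      have "induced g (frag_of (e, y)) \<in> P3.T"
        using P3.relations_zero_right[OF e(1)] y(2) by simp
      then obtain z' where z': "z' \<in> carrier P1.F" "frag_of (e, y) - induced f z' \<in> P2.T"
        using AB z by blast
      have c: "induced f z' \<in> carrier P2.F"
        using induced_carrier[OF fc z'(1)] .
      \<comment> \<open>The lift agrees with \<open>e \<otimes> y\<close> only modulo relations;
        splitting off that difference lets the contraction kill it.\<close>
      have "P2.contraction s (frag_of (e, y)) = P2.contraction s (induced f z' + (frag_of (e, y) - induced f z'))"
        by simp
      also have "\<dots> = P2.contraction s (induced f z')"
        using P2.contraction_add[OF s c P2.relations_carrier[OF z'(2)]] P2.contraction_relations[OF s z'(2)]
          P2.contraction_closed[OF s c] by simp
      also have "\<dots> = f (P1.contraction s z')"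
        by (rule P1.contraction_induced[OF N(2) f s z'(1)])
      finally have "y = f (P1.contraction s z')"
        using P2.contraction_frag_of[OF s e(1) y(1)] e(2) y(1) by simp
      then show "y \<in> f ` carrier N1"
        using P1.contraction_closed[OF s z'(1)] by blast
    qed
  qed
qed

section \<open>Trace ideals\<close>

context Module.module
begin

lemma trace_ideal_add:
  assumes x: "x \<in> carrier M" and "a \<in> trace_ideal R M x" "b \<in> trace_ideal R M x"
  shows "a \<oplus>\<^bsub>R\<^esub> b \<in> trace_ideal R M x"
proof -
  obtain f g where f: "f \<in> linear_forms R M" "a = f x" and g: "g \<in> linear_forms R M" "b = g x"
    using assms unfolding trace_ideal_def by blast
  note f' = linear_mapsD[OF f(1), unfolded ring_as_module_def, simplified]
  note g' = linear_mapsD[OF g(1), unfolded ring_as_module_def, simplified]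
  have "(\<lambda>y. f y \<oplus>\<^bsub>R\<^esub> g y) \<in> linear_forms R M"
    unfolding linear_maps_def using f' g' by (auto simp: ring_as_module_def R.r_distr R.a_ac)
  then show ?thesis
    unfolding trace_ideal_def f(2) g(2) by (intro CollectI exI[of _ "\<lambda>y. f y \<oplus>\<^bsub>R\<^esub> g y"]) simp
qed

lemma trace_ideal_mult:
  assumes x: "x \<in> carrier M" and "a \<in> trace_ideal R M x" "r \<in> carrier R"
  shows "r \<otimes>\<^bsub>R\<^esub> a \<in> trace_ideal R M x"
proof -
  obtain f where f: "f \<in> linear_forms R M" "a = f x"
    using assms unfolding trace_ideal_def by blast
  note f' = linear_mapsD[OF f(1), unfolded ring_as_module_def, simplified]
  have "(\<lambda>y. r \<otimes>\<^bsub>R\<^esub> f y) \<in> linear_forms R M"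
    unfolding linear_maps_def using f' assms(3) by (auto simp: ring_as_module_def R.r_distr R.m_lcomm)
  then show ?thesis
    unfolding trace_ideal_def f(2) by (intro CollectI exI[of _ "\<lambda>y. r \<otimes>\<^bsub>R\<^esub> f y"]) simp
qed

end

section \<open>The extension of Tate algebras\<close>

context na_field_extension
begin

text \<open>The extension preserves absolute values, hence leading exponents. Division over
  \<open>l\<close> can therefore use divisors from the trace ideal, which consists of series over
  \<open>k\<close>.\<close>

lemma monic_lead_map:
  assumes "base.monic_lead n g e"
  shows "ext.monic_lead n (tate_map \<iota> g) e"
  using assms tate_map_closed
  unfolding base.monic_lead_def ext.monic_lead_def by (simp add: tate_map_def extends hom_one)

text \<open>
  Divide \<open>x\<close> by elements of its trace ideal \<open>I\<close> whose leading exponents generate those of \<open>I\<close>.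
  Coefficientwise functionals send the remainder into \<open>I\<close>, where no leading exponent is left for
  it, so they all kill it.
\<close>

lemma ohm_rush_trace_tate:
  assumes "spherically_complete v \<or> countable_type w \<iota>"
  shows "ohm_rush_trace (tate v n) (ring_as_module (tate w n) (tate_map \<iota>))"
  unfolding ohm_rush_trace_def
proof (intro conjI ballI)
  let ?R = "tate v n" and ?M = "ring_as_module (tate w n) (tate_map \<iota>)"
  show module: "Module.module ?R ?M"
    by (rule tate_module)
  fix x assume "x \<in> carrier ?M"
  then have x: "x \<in> carrier (tate w n)" and xM: "x \<in> carrier ?M"
    by (simp_all add: ring_as_module_def)
  define I where "I = trace_ideal ?R ?M x"
  have I_add: "(\<lambda>\<nu>. a \<nu> + b \<nu>) \<in> I" if "a \<in> I" "b \<in> I" for a b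
    using module.trace_ideal_add[OF module xM] that unfolding I_def by simp
  have I_mult: "conv r a \<in> I" if "a \<in> I" "r \<in> carrier ?R" for a r
    using module.trace_ideal_mult[OF module xM] that unfolding I_def by simp
  have I_scale: "(\<lambda>\<nu>. c * a \<nu>) \<in> I" if "a \<in> I" for a c
  proof -
    have "a \<in> carrier ?R"
      using that linear_mapsD(1)[OF _ xM] unfolding I_def trace_ideal_def ring_as_module_def by fastforce
    then show ?thesis
      using I_mult[OF that base.tate_delta[OF base.zero_index]] base.conv_one by metis
  qed
  have I_functional: "(\<lambda>\<nu>. \<phi> (x \<nu>)) \<in> I" if "bounded_functional \<phi>" for \<phi>
    using bounded_functional_linear[OF that, of n] unfolding I_def trace_ideal_def by (intro CollectI exI[of _ "\<lambda>a \<nu>. \<phi> (a \<nu>)"]) simp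
  have I_zero: "(\<lambda>_. 0) \<in> I"
  proof -
    have "bounded_functional (\<lambda>_. 0)"
      unfolding bounded_functional_def by (auto intro: exI[of _ 0])
    from I_functional[OF this] show ?thesis .
  qed
  have I_sum: "(\<lambda>\<nu>. \<Sum>i\<in>A. f i \<nu>) \<in> I" if "\<And>i. i \<in> A \<Longrightarrow> f i \<in> I"
    for A :: "(nat \<Rightarrow> nat) set" and f
    using that
  proof (induction A rule: infinite_finite_induct)
    case (insert i A)
    then show ?case
      using I_add[of "f i" "\<lambda>\<nu>. \<Sum>i\<in>A. f i \<nu>"] by simp
  qed (simp_all add: I_zero)
  \<comment> \<open>As \<open>I\<close> is stable under scalars, the exponents of its normalised
    members are the leading exponents of all its nonzero members.\<close>
  define L where "L = {e. \<exists>g\<in>I. base.monic_lead n g e}"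
  have "L \<subseteq> multi_indices n"
    unfolding L_def base.monic_lead_def by blast
  then obtain B where B: "finite B" "B \<subseteq> L" "\<And>\<nu>. \<nu> \<in> L \<Longrightarrow> \<exists>\<mu>\<in>B. \<mu> \<le> \<nu>"
    using dickson by metis
  have "\<forall>e\<in>B. \<exists>g. g \<in> I \<and> base.monic_lead n g e"
    using B(2) unfolding L_def by blast
  then obtain g where g: "\<And>e. e \<in> B \<Longrightarrow> g e \<in> I" "\<And>e. e \<in> B \<Longrightarrow> base.monic_lead n (g e) e"
    by metis
  have g_closed: "g e \<in> carrier ?R" if "e \<in> B" for e
    using g(2)[OF that] unfolding base.monic_lead_def by blast
  interpret tate_division w n B "\<lambda>e. tate_map \<iota> (g e)"
    by (intro tate_division.intro tate_division_axioms.intro ext.na_field_axioms B(1) monic_lead_map g(2))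
  obtain q h where q: "\<And>e. q e \<in> carrier (tate w n)" and h: "h \<in> carrier (tate w n)"
    "\<And>e \<nu>. e \<in> B \<Longrightarrow> e \<le> \<nu> \<Longrightarrow> h \<nu> = 0"
    and x_eq: "\<And>\<nu>. x \<nu> = (\<Sum>e\<in>B. conv (q e) (tate_map \<iota> (g e)) \<nu>) + h \<nu>"
    by (rule division[OF x]) blast
  have "h \<mu> = 0" for \<mu>
  proof (rule ccontr)
    assume "h \<mu> \<noteq> 0"
    then obtain \<phi> where \<phi>: "bounded_functional \<phi>" "\<phi> (h \<mu>) = 1"
      using bounded_functionals_separate[OF assms] by blast
    let ?q = "\<lambda>e \<nu>. \<phi> (q e \<nu>)" and ?h = "\<lambda>\<nu>. \<phi> (h \<nu>)"
    have \<phi>_conv: "\<phi> (conv (q e) (tate_map \<iota> (g e)) \<nu>) = conv (?q e) (g e) \<nu>" for e \<nu>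
      using bounded_functional_conv[OF \<phi>(1), of "g e" "q e" \<nu>] by (simp add: conv_commute)
    have "h \<nu> = x \<nu> - (\<Sum>e\<in>B. conv (q e) (tate_map \<iota> (g e)) \<nu>)" for \<nu>
      using x_eq[of \<nu>] by simp
    \<comment> \<open>The minus sign is written as a scalar so that closure of \<open>I\<close>
      under sums and scalars applies directly.\<close>
    then have "?h \<nu> = \<phi> (x \<nu>) + (\<Sum>e\<in>B. (-1) * conv (?q e) (g e) \<nu>)" for \<nu>
      by (simp only: bounded_functional_sum(2,3)[OF \<phi>(1)] \<phi>_conv) (simp add: sum_negf)
    moreover have "(\<lambda>\<nu>. \<phi> (x \<nu>) + (\<Sum>e\<in>B. (-1) * conv (?q e) (g e) \<nu>)) \<in> I"
      by (intro I_add I_sum I_functional[OF \<phi>(1)] I_scale I_mult g(1)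
          bounded_functional_closed[OF \<phi>(1)] q)
    ultimately have h_I: "?h \<in> I"
      by presburger
    have "?h \<in> carrier ?R" "?h \<mu> \<noteq> 0"
      using bounded_functional_closed[OF \<phi>(1) h(1)] \<phi>(2) by simp_all
    \<comment> \<open>This leading exponent belongs to the image \<open>?h\<close>, not to
      \<open>h\<close>; but it lies above some member of \<open>B\<close>, where \<open>h\<close>
      itself vanishes, and with it the image.\<close>
    then obtain e where e: "?h e \<noteq> 0" "base.monic_lead n (\<lambda>\<nu>. inverse (?h e) * ?h \<nu>) e"
      using base.exists_monic_lead by metis
    then have "e \<in> L"
      using I_scale[OF h_I] unfolding L_def by blast
    then obtain e0 where "e0 \<in> B" "e0 \<le> e"
      using B(3) by blast
    then have "h e = 0"
      by (rule h(2))
    then show False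
      using e(1) bounded_functional_sum(1)[OF \<phi>(1)] by simp
  qed
  then have x_sum: "x = (\<lambda>\<nu>. \<Sum>e\<in>B. conv (tate_map \<iota> (g e)) (q e) \<nu>)"
    using x_eq by (simp add: fun_eq_iff conv_commute)
  have "(\<lambda>\<nu>. \<Sum>e\<in>A. conv (tate_map \<iota> (g e)) (q e) \<nu>) \<in> ideal_smult I ?M" if "A \<subseteq> B" for A
    using finite_subset[OF that B(1)] that
  proof (induction A rule: finite_induct)
    case empty
    then show ?case
      using generate.one[of "add_monoid ?M"] by (simp add: ideal_smult_def ring_as_module_def)
  next
    case (insert e A)
    have "conv (tate_map \<iota> (g e)) (q e) \<in> ideal_smult I ?M"
      unfolding ideal_smult_def
    proof (rule generate.incl, intro CollectI exI conjI)
      show "conv (tate_map \<iota> (g e)) (q e) = g e \<odot>\<^bsub>?M\<^esub> q e" "q e \<in> carrier ?M" "g e \<in> I"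
        using q g(1) insert.prems by (simp_all add: ring_as_module_def)
    qed
    then show ?case
      using insert generate.eng[of "conv (tate_map \<iota> (g e)) (q e)" "add_monoid ?M" _
          "\<lambda>\<nu>. \<Sum>e\<in>A. conv (tate_map \<iota> (g e)) (q e) \<nu>"]
      by (simp add: ideal_smult_def ring_as_module_def)
  qed
  then show "x \<in> ideal_smult (trace_ideal ?R ?M x) ?M"
    using x_sum unfolding I_def by auto
qed

end

theorem theorem5p22:
  fixes v :: "'k::field \<Rightarrow> real" and w :: "'l::field \<Rightarrow> real" and \<iota> :: "'k \<Rightarrow> 'l" and n :: nat
  assumes "na_field_extension v w \<iota>"
    and "spherically_complete v \<or> countable_type w \<iota>"
    and "n > 0"
  shows "ohm_rush_trace (tate v n) (ring_as_module (tate w n) (tate_map \<iota>)) \<and>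
    split_extension (tate v n) (tate w n) (tate_map \<iota>) \<and>
    faithfully_flat_extension TYPE('c) TYPE('d) TYPE('e) (tate v n) (tate w n) (tate_map \<iota>)"
proof -
  interpret na_field_extension v w \<iota>
    by fact
  let ?R = "tate v n" and ?M = "ring_as_module (tate w n) (tate_map \<iota>)"
  have ort: "ohm_rush_trace ?R ?M"
    by (rule ohm_rush_trace_tate[OF assms(2)])
  \<comment> \<open>A functional with value 1 at 1 is a \<open>k\<close>-linear retraction of
    \<iota>. Applied to coefficients it splits the extension, and it sends the unit to the unit,
    which is the form of value 1 that faithfulness calls for.\<close>
  obtain \<phi> where \<phi>: "bounded_functional \<phi>" "\<phi> 1 = 1"
    using bounded_functionals_separate[OF assms(2), of 1] by auto
  let ?s = "\<lambda>a \<nu>. \<phi> (a \<nu>)"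
  have s: "?s \<in> linear_forms ?R ?M"
    by (rule bounded_functional_linear[OF \<phi>(1)])
  have "\<phi> (\<iota> c) = c" for c
  proof -
    have "\<phi> (\<iota> c * 1) = c * \<phi> 1"
      using \<phi>(1) unfolding bounded_functional_def by blast
    then show ?thesis
      by (simp add: \<phi>(2))
  qed
  then have left_inverse: "?s (tate_map \<iota> r) = r" for r
    by (simp add: tate_map_def)
  have one: "\<one>\<^bsub>tate w n\<^esub> \<in> carrier ?M" "?s \<one>\<^bsub>tate w n\<^esub> = \<one>\<^bsub>?R\<^esub>"
    using ext.tate_delta[OF ext.zero_index] \<phi>(2) bounded_functional_sum(1)[OF \<phi>(1)]
    by (auto simp: ring_as_module_def)
  have "faithfully_flat TYPE('c) TYPE('d) TYPE('e) ?R ?M"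
    by (rule ohm_rush_trace_split_faithfully_flat[OF ort s one(1)]) (rule one(2))
  moreover have "split_extension ?R (tate w n) (tate_map \<iota>)"
    unfolding split_extension_def using left_inverse
    by (intro conjI ring_extension_tate bexI[OF _ s]) simp
  ultimately show ?thesis
    unfolding faithfully_flat_extension_def by (intro conjI ort ring_extension_tate)
qed

end
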